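(* Let $k$ be a field. A tetrahedral curve $C\subset\mathbb P^3_k$ is arithmetically Buchsbaum if and only if its Hartshorne-Rao module satisfies, as a graded module over $R=k[a,b,c,d]$, \[ M(C)\cong k^m(t)\quad\text{for some integers } m,t \text{ with } m\ge0 . \]
   Context: For integers $a_1,\dots,a_6\ge0$, the tetrahedral curve $(a_1,\dots,a_6)$ is the subscheme of $\mathbb P^3$ with saturated ideal $(a,b)^{a_1}\cap(a,c)^{a_2}\cap(a,d)^{a_3}\cap(b,c)^{a_4}\cap(b,d)^{a_5}\cap(c,d)^{a_6}\subset R$. The Hartshorne-Rao module of a curve $C$ is $M(C)=\bigoplus_{j\in\mathbb Z}H^1(\mathbb P^3,\mathcal I_C(j))$. A curve $C\subset\mathbb P^3$ is arithmetically Buchsbaum if its homogeneous coordinate ring is Buchsbaum; equivalently $(a,b,c,d)\cdot M(C)=0$. Here $k=R/(a,b,c,d)$ as an $R$-module, and $k^m(t)$ is the direct sum of $m$ copies with degree shift $t$. *)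

theory Defs
  imports
    "HOL-Algebra.QuotRing"
    "HOL-Algebra.Ideal_Product"
    "HOL-Algebra.Module"
    "HOL-Library.Poly_Mapping"
    "HOL-Library.Numeral_Type"
    "HOL-Library.Extended_Nat"
    "HOL-Computational_Algebra.Fraction_Field"
begin

section \<open>The polynomial ring in four variables\<close>

text \<open>
  A monomial is an exponent vector indexed by the four-element type \<open>4 = {0,1,2,3}\<close>; the variables
  \<open>a, b, c, d\<close> are \<open>Var 0, Var 1, Var 2, Var 3\<close>.
\<close>

type_synonym 'k poly4 = "(4 \<Rightarrow>\<^sub>0 nat) \<Rightarrow>\<^sub>0 'k"

definition Var :: "4 \<Rightarrow> 'k::field poly4" where
  "Var i = Poly_Mapping.single (Poly_Mapping.single i 1) 1"

definition mdeg :: "(4 \<Rightarrow>\<^sub>0 nat) \<Rightarrow> nat" where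
  "mdeg m = (\<Sum>i\<in>UNIV. Poly_Mapping.lookup m i)"

definition homogeneous :: "int \<Rightarrow> 'k::field poly4 \<Rightarrow> bool" where
  "homogeneous n f \<longleftrightarrow> (\<forall>m\<in>Poly_Mapping.keys f. int (mdeg m) = n)"

definition hom_part :: "nat \<Rightarrow> 'k::field poly4 \<Rightarrow> 'k poly4" where
  "hom_part n f = (\<Sum>m\<in>{m \<in> Poly_Mapping.keys f. mdeg m = n}. Poly_Mapping.single m (Poly_Mapping.lookup f m))"

definition R4 :: "'k::field poly4 ring" where
  "R4 = \<lparr>carrier = UNIV, mult = (*), one = 1, zero = 0, add = (+)\<rparr>"

definition irrelevant_ideal :: "'k::field poly4 set" where
  "irrelevant_ideal = Idl\<^bsub>R4\<^esub> (range Var)"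


section \<open>Tetrahedral curves\<close>

text \<open>A curve is represented by its saturated homogeneous ideal.\<close>

primrec ideal_power :: "('a, 'b) ring_scheme \<Rightarrow> 'a set \<Rightarrow> nat \<Rightarrow> 'a set" where
  "ideal_power R I 0 = carrier R"
| "ideal_power R I (Suc n) = I \<cdot>\<^bsub>R\<^esub> ideal_power R I n"

definition line_ideal :: "4 \<Rightarrow> 4 \<Rightarrow> 'k::field poly4 set" where
  "line_ideal i j = Idl\<^bsub>R4\<^esub> {Var i, Var j}"

definition tetrahedral_ideal ::
    "nat \<Rightarrow> nat \<Rightarrow> nat \<Rightarrow> nat \<Rightarrow> nat \<Rightarrow> nat \<Rightarrow> 'k::field poly4 set" where
  "tetrahedral_ideal a1 a2 a3 a4 a5 a6 =
     ideal_power R4 (line_ideal 0 1) a1 \<inter> ideal_power R4 (line_ideal 0 2) a2 \<inter>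
     ideal_power R4 (line_ideal 0 3) a3 \<inter> ideal_power R4 (line_ideal 1 2) a4 \<inter>
     ideal_power R4 (line_ideal 1 3) a5 \<inter> ideal_power R4 (line_ideal 2 3) a6"


section \<open>Graded modules\<close>

record ('a, 'b) graded_module = "('a, 'b) module" +
  component :: "int \<Rightarrow> 'b set"

definition graded_iso ::
    "('a, 'r) ring_scheme \<Rightarrow> ('a, 'b, 'x) graded_module_scheme \<Rightarrow>
     ('a, 'c, 'y) graded_module_scheme \<Rightarrow> bool" where
  "graded_iso R M N \<longleftrightarrow>
     (\<exists>\<phi>. bij_betw \<phi> (carrier M) (carrier N) \<and>
        (\<forall>x\<in>carrier M. \<forall>y\<in>carrier M. \<phi> (x \<oplus>\<^bsub>M\<^esub> y) = \<phi> x \<oplus>\<^bsub>N\<^esub> \<phi> y) \<and>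
        (\<forall>r\<in>carrier R. \<forall>x\<in>carrier M. \<phi> (r \<odot>\<^bsub>M\<^esub> x) = r \<odot>\<^bsub>N\<^esub> \<phi> x) \<and>
        (\<forall>j. \<phi> ` component M j = component N j))"

text \<open>
  The record fields \<open>mult\<close> and \<open>one\<close> of a module are inherited from rings and carry no meaning.
\<close>

definition residue_module :: "('k::field poly4, 'k poly4 set) graded_module" where
  "residue_module =
     (let Q = R4 Quot irrelevant_ideal; cls = (\<lambda>f. irrelevant_ideal +>\<^bsub>R4\<^esub> f) in
      \<lparr>carrier = carrier Q, mult = mult Q, one = one Q, zero = zero Q, add = add Q,
       smult = (\<lambda>r x. cls r \<otimes>\<^bsub>Q\<^esub> x),
       component = (\<lambda>j. cls ` {f. homogeneous j f})\<rparr>)"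

definition direct_power ::
    "nat \<Rightarrow> ('a, 'b, 'x) graded_module_scheme \<Rightarrow> ('a, nat \<Rightarrow> 'b) graded_module" where
  "direct_power m M =
     \<lparr>carrier = (\<Pi>\<^sub>E i\<in>{..<m}. carrier M), mult = undefined, one = undefined,
      zero = (\<lambda>i\<in>{..<m}. \<zero>\<^bsub>M\<^esub>), add = (\<lambda>u v. \<lambda>i\<in>{..<m}. u i \<oplus>\<^bsub>M\<^esub> v i),
      smult = (\<lambda>r v. \<lambda>i\<in>{..<m}. r \<odot>\<^bsub>M\<^esub> v i),
      component = (\<lambda>j. \<Pi>\<^sub>E i\<in>{..<m}. component M j)\<rparr>"

text \<open>Twist convention: \<open>M(t)\<^sub>j = M\<^sub>t\<^sub>+\<^sub>j\<close>.\<close>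

definition twist :: "('a, 'b) graded_module \<Rightarrow> int \<Rightarrow> ('a, 'b) graded_module" where
  "twist M t = M\<lparr>component := (\<lambda>j. component M (t + j))\<rparr>"


section \<open>Cohomology of twisted ideal sheaves and the Hartshorne-Rao module\<close>

text \<open>
  Cohomology on projective 3-space is computed by the Cech complex of the standard affine cover
  \<open>D\<^sub>+(x\<^sub>0), \<dots>, D\<^sub>+(x\<^sub>3)\<close>.  The intersection of the open sets with index in \<open>S\<close> is
  \<open>D\<^sub>+(x\<^sub>S)\<close> with \<open>x\<^sub>S\<close> the product of the variables in \<open>S\<close>, and the sections over it of the
  \<open>j\<close>-th twist of the ideal sheaf of \<open>I\<close> are the degree \<open>j\<close> elements of the localisation of \<open>I\<close>
  at \<open>x\<^sub>S\<close>, which is a subset of the fraction field because the polynomial ring is a domain.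
\<close>

definition var_prod :: "4 set \<Rightarrow> 'k::field poly4" where
  "var_prod S = (\<Prod>i\<in>S. Var i)"

definition sections :: "'k::field poly4 set \<Rightarrow> int \<Rightarrow> 4 set \<Rightarrow> 'k poly4 fract set" where
  "sections I j S =
     {Fract f (var_prod S ^ n) | f n. f \<in> I \<and> homogeneous (j + int (n * card S)) f}"

text \<open>
  A \<open>p\<close>-cochain has one entry for each increasing \<open>(p+1)\<close>-tuple of indices, encoded as a set \<open>S\<close> with
  \<open>p+1\<close> elements; the entries at sets of any other size are \<open>0\<close>.
\<close>

type_synonym 'k cochain = "4 set \<Rightarrow> 'k poly4 fract"

definition cochains :: "'k::field poly4 set \<Rightarrow> int \<Rightarrow> nat \<Rightarrow> 'k cochain set" where
  "cochains I j p =
     {c. \<forall>S. if card S = p + 1 then c S \<in> sections I j S else c S = 0}"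

definition cech_d :: "'k::field cochain \<Rightarrow> 'k cochain" where
  "cech_d c = (\<lambda>S. \<Sum>i\<in>S. (- 1) ^ card {l \<in> S. l < i} * c (S - {i}))"

definition cocycle_group :: "'k::field poly4 set \<Rightarrow> int \<Rightarrow> nat \<Rightarrow> 'k cochain monoid" where
  "cocycle_group I j p =
     \<lparr>carrier = {c \<in> cochains I j p. cech_d c = (\<lambda>S. 0)},
      mult = (\<lambda>c c'. \<lambda>S. c S + c' S), one = (\<lambda>S. 0)\<rparr>"

definition coboundaries :: "'k::field poly4 set \<Rightarrow> int \<Rightarrow> nat \<Rightarrow> 'k cochain set" where
  "coboundaries I j p =
     (case p of 0 \<Rightarrow> {\<lambda>S. 0} | Suc q \<Rightarrow> cech_d ` cochains I j q)"

definition cohomology ::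
    "nat \<Rightarrow> 'k::field poly4 set \<Rightarrow> int \<Rightarrow> 'k cochain set monoid" where
  "cohomology p I j = cocycle_group I j p Mod coboundaries I j p"

text \<open>
  The direct sum of all \<open>H\<^sup>1(\<I>(j))\<close>, as finitely supported families of classes.  A form \<open>r\<close> of
  degree \<open>n\<close> sends the class of a cocycle \<open>c\<close> in degree \<open>j - n\<close> to the class of \<open>r * c\<close> in degree
  \<open>j\<close>, and a general polynomial acts through its homogeneous parts.
\<close>

definition hom_act ::
    "'k::field poly4 set \<Rightarrow> int \<Rightarrow> 'k poly4 \<Rightarrow> 'k cochain set \<Rightarrow> 'k cochain set" where
  "hom_act I j r K =
     (\<Union>c\<in>K. coboundaries I j 1 #>\<^bsub>cocycle_group I j 1\<^esub> (\<lambda>S. Fract r 1 * c S))"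

definition hartshorne_rao ::
    "'k::field poly4 set \<Rightarrow> ('k poly4, int \<Rightarrow> 'k cochain set) graded_module" where
  "hartshorne_rao I =
     (let H = cohomology 1 I;
          C = {h. (\<forall>j. h j \<in> carrier (H j)) \<and> finite {j. h j \<noteq> \<one>\<^bsub>H j\<^esub>}} in
      \<lparr>carrier = C, mult = undefined, one = undefined,
       zero = (\<lambda>j. \<one>\<^bsub>H j\<^esub>), add = (\<lambda>h h'. \<lambda>j. h j \<otimes>\<^bsub>H j\<^esub> h' j),
       smult = (\<lambda>r h. \<lambda>j. finprod (H j) (\<lambda>n. hom_act I j (hom_part n r) (h (j - int n)))
                            {n. hom_part n r \<noteq> 0}),
       component = (\<lambda>j. {h \<in> C. \<forall>i. i \<noteq> j \<longrightarrow> h i = \<one>\<^bsub>H i\<^esub>})\<rparr>)"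


section \<open>Buchsbaum rings\<close>

definition prime_chain :: "('a, 'b) ring_scheme \<Rightarrow> 'a set list \<Rightarrow> bool" where
  "prime_chain A Ps \<longleftrightarrow> (\<forall>P\<in>set Ps. primeideal P A) \<and> sorted_wrt (\<subset>) Ps"

definition krull_dim :: "('a, 'b) ring_scheme \<Rightarrow> enat" where
  "krull_dim A = (SUP Ps\<in>{Ps. Ps \<noteq> [] \<and> prime_chain A Ps}. enat (length Ps - 1))"

text \<open>The following notions are meant for a Noetherian local ring \<open>A\<close> with maximal ideal \<open>M\<close>.\<close>

definition system_of_parameters :: "('a, 'b) ring_scheme \<Rightarrow> 'a set \<Rightarrow> 'a list \<Rightarrow> bool" where
  "system_of_parameters A M xs \<longleftrightarrow>
     set xs \<subseteq> M \<and> enat (length xs) = krull_dim A \<and>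
     (\<forall>y\<in>M. \<exists>n::nat. y [^]\<^bsub>A\<^esub> n \<in> Idl\<^bsub>A\<^esub> (set xs))"

text \<open>\<open>M \<cdot> ((x\<^sub>1,\<dots>,x\<^sub>i) : x\<^sub>i\<^sub>+\<^sub>1) \<subseteq> (x\<^sub>1,\<dots>,x\<^sub>i)\<close> for all \<open>i\<close>.\<close>

definition weak_sequence :: "('a, 'b) ring_scheme \<Rightarrow> 'a set \<Rightarrow> 'a list \<Rightarrow> bool" where
  "weak_sequence A M xs \<longleftrightarrow>
     (\<forall>i<length xs. \<forall>z\<in>carrier A.
        z \<otimes>\<^bsub>A\<^esub> xs ! i \<in> Idl\<^bsub>A\<^esub> (set (take i xs)) \<longrightarrow>
        (\<forall>y\<in>M. y \<otimes>\<^bsub>A\<^esub> z \<in> Idl\<^bsub>A\<^esub> (set (take i xs))))"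

text \<open>
  A local ring is Buchsbaum if every system of parameters is a weak sequence.  The zero ring, which
  is the coordinate ring of the empty curve, has no maximal ideal and counts as Buchsbaum.
\<close>

definition buchsbaum_local :: "('a, 'b) ring_scheme \<Rightarrow> bool" where
  "buchsbaum_local A \<longleftrightarrow>
     (\<forall>M xs. maximalideal M A \<longrightarrow> system_of_parameters A M xs \<longrightarrow> weak_sequence A M xs)"

text \<open>
  A standard graded algebra \<open>R/I\<close> is Buchsbaum if its localisation at the irrelevant maximal ideal
  \<open>\<mm>\<close> is.  This localisation is \<open>R\<^sub>\<mm>/I R\<^sub>\<mm>\<close>, where \<open>R\<^sub>\<mm>\<close> is a subring of the fraction field.
\<close>

definition local_R4 :: "'k::field poly4 fract ring" where
  "local_R4 =
     \<lparr>carrier = {Fract f g | f g. g \<notin> irrelevant_ideal},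
      mult = (*), one = 1, zero = 0, add = (+)\<rparr>"

definition local_coordinate_ring :: "'k::field poly4 set \<Rightarrow> 'k poly4 fract set ring" where
  "local_coordinate_ring I = local_R4 Quot (Idl\<^bsub>local_R4\<^esub> ((\<lambda>f. Fract f 1) ` I))"

definition arithmetically_buchsbaum :: "'k::field poly4 set \<Rightarrow> bool" where
  "arithmetically_buchsbaum I \<longleftrightarrow> buchsbaum_local (local_coordinate_ring I)"

end

theory Submission
  imports Defs
begin

text \<open>
  The ideal is spanned by monomials, so its cohomology is graded by exponent vectors \<open>u\<close>.  Viewing
  the pairs \<open>{i, j}\<close> for which the monomial with exponent \<open>u\<close> is not in the localisation at \<open>x\<^sub>i x\<^sub>j\<close>
  as the edges of a graph on four points, the first cohomology in degree \<open>u\<close> is one-dimensional if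
  this graph is a perfect matching \<open>{W, - W}\<close>, and zero otherwise; multiplication by a variable
  is an isomorphism between two such degrees with the same matching.  Hence the variables annihilate
  the module if and only if no two of these degrees are adjacent.  In that case
  \<open>u\<close> has total degree \<open>a\<^sub>W + a\<^sub>-\<^sub>W - 2\<close>, and two different matchings would each have to exceed the
  other one in this degree; so only one matching and one total degree occur, which is the
  isomorphism with \<open>k\<^sup>m(t)\<close>.

  The coordinate ring has dimension two.  For parameters \<open>y\<^sub>1, y\<^sub>2\<close>, an element \<open>z\<close> with
  \<open>z y\<^sub>2 \<in> (y\<^sub>1)\<close> gives the section \<open>z / y\<^sub>1\<close> of the structure sheaf of the curve, and \<open>x\<^sub>i z \<in> (y\<^sub>1)\<close> if and only if
  \<open>x\<^sub>i\<close> annihilates its class in the first cohomology.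
\<close>

text \<open>The condition \<open>no_adjacent_gaps\<close>, on exponents alone, is the hinge: each
  side of the equivalence is compared with it. On the ring side the section \<open>z / y1\<close> is
  not homogeneous, so it is handled through all its Laurent coefficients at once. Extending it to a
  polynomial is then, for each exponent vector, the same question about values on four points as
  being a coboundary is for a Cech cocycle, and \<open>const_on_bad\<close> answers both. Every
  associated prime of the ideal is the prime of a line, so a first parameter, which avoids these
  primes, is a nonzerodivisor; only the second parameter can fail, and the first cohomology measures
  that failure. The Krull dimension is bounded above by counting: monomials outside the ideal grow
  quadratically with the degree, which excludes chains of four primes. Elements of the local ring
  are replaced by polynomials after clearing a denominator outside the maximal ideal; powers of line
  primes are primary, so this does not change the ideal.\<close>

abbreviation (input) "lookup \<equiv> Poly_Mapping.lookup"
abbreviation (input) "keys \<equiv> Poly_Mapping.keys"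
abbreviation (input) "single \<equiv> Poly_Mapping.single"

lemma UNIV_4: "(UNIV :: 4 set) = {0, 1, 2, 3}"
proof -
  have "card {0, 1, 2, 3 :: 4} = card (UNIV :: 4 set)" by simp
  then show ?thesis by (metis card_subset_eq finite subset_UNIV)
qed

lemma exhaust_4: "(i :: 4) = 0 \<or> i = 1 \<or> i = 2 \<or> i = 3"
  using UNIV_4 by auto

lemma card_2_subsets_4:
  "card (W :: 4 set) = 2 \<longleftrightarrow> W \<in> {{0,1}, {0,2}, {0,3}, {1,2}, {1,3}, {2,3}}"
proof
  assume "card W = 2"
  then obtain i j where "W = {i, j}" "i \<noteq> j" by (auto simp: card_2_iff)
  then show "W \<in> {{0,1}, {0,2}, {0,3}, {1,2}, {1,3}, {2,3}}"
    using exhaust_4[of i] exhaust_4[of j] by (auto simp: insert_commute)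
qed auto

lemma less_4: "(0::4) < 1 \<and> (0::4) < 2 \<and> (0::4) < 3 \<and> (1::4) < 2 \<and> (1::4) < 3 \<and> (2::4) < 3"
  by (simp add: less_bit0_def bit0.Rep_numeral bit0.Rep_0 bit0.Rep_1)

section \<open>Monomials and weights\<close>

lemma lookup_single_mult: "lookup (single k c * f) (k + m) = c * lookup f m"
  for k :: "'a :: cancel_comm_monoid_add" and f :: "'a \<Rightarrow>\<^sub>0 'b::comm_semiring_1"
  by (simp add: lookup_mult lookup_single when_mult)

lemma lookup_single_mult_eq_0:
  "(\<And>m'. m \<noteq> k + m') \<Longrightarrow> lookup (single k c * f) m = 0"
  for k :: "'a :: cancel_comm_monoid_add" and f :: "'a \<Rightarrow>\<^sub>0 'b::comm_semiring_1"
  by (simp add: lookup_mult lookup_single when_mult)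

lemma keysE_mult:
  assumes "m \<in> keys (f * g)"
  obtains a b where "m = a + b" "a \<in> keys f" "b \<in> keys g"
  using assms keys_mult[of f g] by blast

lemma poly_eq_sum_singles:
  fixes f :: "'a \<Rightarrow>\<^sub>0 'b::comm_monoid_add"
  shows   "f = (\<Sum>m\<in>keys f. single m (lookup f m))"
  by (rule poly_mapping_eqI) (auto simp: lookup_sum lookup_single when_def in_keys_iff)

definition wt :: "(4 \<Rightarrow> nat) \<Rightarrow> (4 \<Rightarrow>\<^sub>0 nat) \<Rightarrow> nat" where
  "wt w m = (\<Sum>i\<in>UNIV. w i * lookup m i)"

lemma wt_add: "wt w (m + n) = wt w m + wt w n"
  by (simp add: wt_def lookup_add algebra_simps sum.distrib)

lemma wt_single: "wt w (single i n) = w i * n"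
  by (simp add: wt_def lookup_single when_def if_distrib cong: if_cong)

lemma wt_zero [simp]: "wt w 0 = 0"
  by (simp add: wt_def)

text \<open>For \<open>w = pind V\<close> this is the \<open>d\<close>-th power of the prime
  generated by the variables in \<open>V\<close>. Other weights are allowed because a weight with
  the values \<open>n\<close>, 1 and 0 serves to show that a parameter cannot lie in the prime of a
  line.\<close>

definition wideal :: "(4 \<Rightarrow> nat) \<Rightarrow> nat \<Rightarrow> 'k::field poly4 set" where
  "wideal w d = {f. \<forall>m\<in>keys f. d \<le> wt w m}"

lemma wideal_lookup: "f \<in> wideal w d \<Longrightarrow> wt w m < d \<Longrightarrow> lookup f m = 0"
  unfolding wideal_def by (metis (no_types, lifting) in_keys_iff leD mem_Collect_eq)

lemma wideal_0 [simp]: "0 \<in> wideal w d"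
  by (simp add: wideal_def)

lemma wideal_add: "f \<in> wideal w d \<Longrightarrow> g \<in> wideal w d \<Longrightarrow> f + g \<in> wideal w d"
  unfolding wideal_def using keys_add[of f g] by blast

lemma wideal_minus: "f \<in> wideal w d \<Longrightarrow> - f \<in> wideal w d"
  by (simp add: wideal_def in_keys_iff)

lemma wideal_diff: "f \<in> wideal w d \<Longrightarrow> g \<in> wideal w d \<Longrightarrow> f - g \<in> wideal w d"
  using wideal_add[of f w d "- g"] wideal_minus[of g w d] by simp

lemma wideal_mult: "f \<in> wideal w d \<Longrightarrow> g \<in> wideal w e \<Longrightarrow> f * g \<in> wideal w (d + e)"
  unfolding wideal_def by (auto elim!: keysE_mult simp: wt_add add_mono)

lemma wideal_mono: "d \<le> e \<Longrightarrow> wideal w e \<subseteq> wideal w d"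
  by (force simp: wideal_def)

lemma wideal_zero_exp: "wideal w 0 = UNIV"
  by (simp add: wideal_def)

lemma wideal_mult_left: "f \<in> wideal w d \<Longrightarrow> g * f \<in> wideal w d"
  using wideal_mult[of g w 0 f d] by (simp add: wideal_zero_exp)

definition pfilter :: "((4 \<Rightarrow>\<^sub>0 nat) \<Rightarrow> bool) \<Rightarrow> 'k::field poly4 \<Rightarrow> 'k poly4" where
  "pfilter P f = Poly_Mapping.mapp (\<lambda>m c. c when P m) f"

lemma lookup_pfilter: "lookup (pfilter P f) m = (lookup f m when P m)"
  by (auto simp: pfilter_def lookup_mapp when_def in_keys_iff)

text \<open>The product of the parts of lowest weight does not vanish because the ring is a domain.\<close>

lemma wideal_cancel:
  assumes h: "h \<notin> wideal w 1" and hg: "h * g \<in> wideal w d"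
  shows "g \<in> wideal w d"
proof (rule ccontr)
  assume "g \<notin> wideal w d"
  then obtain m0 where m0: "m0 \<in> keys g" "wt w m0 < d"
    by (auto simp: wideal_def not_le)
  define e where "e = Min (wt w ` keys g)"
  have e_le: "e \<le> wt w m" if "m \<in> keys g" for m
    using that by (simp add: e_def)
  have "e \<in> wt w ` keys g"
    unfolding e_def using m0 by (intro Min_in) auto
  then obtain m1 where m1: "m1 \<in> keys g" "wt w m1 = e" by auto
  from h obtain k where k: "k \<in> keys h" "wt w k = 0"
    by (auto simp: wideal_def)
  define h0 where "h0 = pfilter (\<lambda>m. wt w m = 0) h"
  define g0 where "g0 = pfilter (\<lambda>m. wt w m = e) g"
  have "lookup h0 k \<noteq> 0" "lookup g0 m1 \<noteq> 0"
    using k m1 by (auto simp: h0_def g0_def lookup_pfilter in_keys_iff)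
  then have "h0 \<noteq> 0" "g0 \<noteq> 0" by auto
  then have "h0 * g0 \<noteq> 0" by simp
  then obtain m where m: "m \<in> keys (h0 * g0)"
    by (meson keys_eq_empty all_not_in_conv)
  then obtain a b where "m = a + b" "a \<in> keys h0" "b \<in> keys g0"
    by (rule keysE_mult)
  then have wm: "wt w m = e"
    by (auto simp: h0_def g0_def lookup_pfilter in_keys_iff wt_add when_def split: if_splits)
  have "g - g0 \<in> wideal w (e + 1)" unfolding wideal_def
    by (auto simp: in_keys_iff g0_def lookup_minus lookup_pfilter when_def Suc_le_eq
        intro!: le_neq_trans e_le split: if_splits)
  then have 1: "h0 * (g - g0) \<in> wideal w (e + 1)" by (rule wideal_mult_left)
  have "h - h0 \<in> wideal w 1" unfolding wideal_def
    by (auto simp: in_keys_iff h0_def lookup_minus lookup_pfilter when_def Suc_le_eq split: if_splits)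
  moreover have "g \<in> wideal w e" using e_le by (auto simp: wideal_def)
  ultimately have 2: "(h - h0) * g \<in> wideal w (e + 1)"
    using wideal_mult by fastforce
  have "h * g = h0 * g0 + (h0 * (g - g0) + (h - h0) * g)" by (simp add: algebra_simps)
  then have "lookup (h * g) m = lookup (h0 * g0) m"
    using wideal_lookup[OF wideal_add[OF 1 2], of m] wm by (simp add: lookup_add)
  then have "m \<in> keys (h * g)" using m by (simp add: in_keys_iff)
  then have "d \<le> e" using hg wm by (auto simp: wideal_def)
  with m0 e_le[OF m0(1)] show False by simp
qed

lemma wideal_power: "f \<notin> wideal w 1 \<Longrightarrow> f ^ n \<notin> wideal w 1"
proof (induction n)
  case 0
  then show ?case by (simp add: wideal_def)
next
  case (Suc n)
  then show ?case using wideal_cancel[of f w "f ^ n" 1] by auto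
qed

section \<open>Powers of line primes and their intersection\<close>

definition pind :: "4 set \<Rightarrow> 4 \<Rightarrow> nat" where
  "pind W i = of_bool (i \<in> W)"

lemma wt_pind: "wt (pind W) m = (\<Sum>i\<in>W. lookup m i)"
  by (simp add: wt_def pind_def of_bool_def sum.If_cases if_distrib[of "\<lambda>x. x * _"] cong: if_cong)

lemma mdeg_eq_wt: "mdeg m = wt (\<lambda>_. 1) m"
  by (simp add: mdeg_def wt_def)

text \<open>A pair \<open>W\<close> stands for the line on which the variables of \<open>W\<close>
  vanish, so \<open>W\<close> and \<open>- W\<close> are opposite lines. Indexing by sets treats the
  six exponents symmetrically.\<close>

definition tI :: "(4 set \<Rightarrow> nat) \<Rightarrow> 'k::field poly4 set" where
  "tI a = {f. \<forall>W. card W = 2 \<longrightarrow> f \<in> wideal (pind W) (a W)}"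

lemma tI_0 [simp]: "0 \<in> tI a"
  by (simp add: tI_def)

lemma tI_add: "f \<in> tI a \<Longrightarrow> g \<in> tI a \<Longrightarrow> f + g \<in> tI a"
  by (simp add: tI_def wideal_add)

lemma tI_diff: "f \<in> tI a \<Longrightarrow> g \<in> tI a \<Longrightarrow> f - g \<in> tI a"
  by (simp add: tI_def wideal_diff)

lemma tI_mult_left: "f \<in> tI a \<Longrightarrow> g * f \<in> tI a"
  by (simp add: tI_def wideal_mult_left)

lemma tI_mult_right: "f \<in> tI a \<Longrightarrow> f * g \<in> tI a"
  by (simp add: mult.commute[of f] tI_mult_left)

lemma tI_keys:
  "f \<in> tI a \<longleftrightarrow> (\<forall>m\<in>keys f. \<forall>W. card W = 2 \<longrightarrow> a W \<le> (\<Sum>i\<in>W. lookup m i))"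
  unfolding tI_def wideal_def wt_pind by blast

text \<open>Each power of a line prime is primary, so a polynomial outside all line primes that
  occur is a nonzerodivisor modulo the intersection. This is applied to parameters and to
  denominators of the local ring.\<close>

lemma tI_cancel:
  assumes "\<And>W. card W = 2 \<Longrightarrow> 0 < a W \<Longrightarrow> h \<notin> wideal (pind W) 1" and "h * g \<in> tI a"
  shows "g \<in> tI a"
  unfolding tI_def
proof (clarify)
  fix W :: "4 set" assume W: "card W = 2"
  show "g \<in> wideal (pind W) (a W)"
  proof (cases "a W = 0")
    case False
    then show ?thesis using assms W wideal_cancel[of h "pind W" g] by (auto simp: tI_def)
  qed (simp add: wideal_zero_exp)
qed

section \<open>Ideals of the polynomial ring\<close>

lemma R4_simps [simp]:
  "carrier R4 = UNIV" "x \<otimes>\<^bsub>R4\<^esub> y = x * y" "\<one>\<^bsub>R4\<^esub> = 1" "\<zero>\<^bsub>R4\<^esub> = 0" "x \<oplus>\<^bsub>R4\<^esub> y = x + y"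
  by (simp_all add: R4_def)

lemma R4_cring: "cring (R4 :: 'k::field poly4 ring)"
proof (rule cringI)
  show "abelian_group (R4 :: 'k poly4 ring)"
  proof (rule abelian_groupI)
    fix x :: "'k poly4" assume "x \<in> carrier R4"
    show "\<exists>y\<in>carrier R4. y \<oplus>\<^bsub>R4\<^esub> x = \<zero>\<^bsub>R4\<^esub>" by (rule bexI[of _ "- x"]) auto
  qed (auto simp: algebra_simps)
  show "Group.comm_monoid (R4 :: 'k poly4 ring)" by (rule comm_monoidI) (auto simp: algebra_simps)
qed (auto simp: algebra_simps)

lemma R4_ideal_iff:
  fixes I :: "'k::field poly4 set"
  shows "ideal I R4 \<longleftrightarrow> 0 \<in> I \<and> (\<forall>f\<in>I. \<forall>g\<in>I. f + g \<in> I) \<and> (\<forall>f\<in>I. \<forall>g. g * f \<in> I)"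
proof
  assume "ideal I R4"
  then interpret ideal I R4 .
  show "0 \<in> I \<and> (\<forall>f\<in>I. \<forall>g\<in>I. f + g \<in> I) \<and> (\<forall>f\<in>I. \<forall>g. g * f \<in> I)"
    using additive_subgroup.zero_closed[OF additive_subgroup_axioms]
      additive_subgroup.a_closed[OF additive_subgroup_axioms] I_l_closed by auto
next
  interpret R: cring "R4 :: 'k poly4 ring" by (rule R4_cring)
  assume *: "0 \<in> I \<and> (\<forall>f\<in>I. \<forall>g\<in>I. f + g \<in> I) \<and> (\<forall>f\<in>I. \<forall>g. g * f \<in> I)"
  have neg: "\<ominus>\<^bsub>R4\<^esub> x = - x" for x :: "'k poly4"
    by (rule R.minus_equality) auto
  show "ideal I R4"
  proof (rule idealI)
    show "ring (R4 :: 'k poly4 ring)" by (rule R.ring_axioms)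
    show "subgroup I (add_monoid R4)"
    proof (rule R.add.subgroupI)
      fix x assume "x \<in> I"
      then have "(- 1) * x \<in> I" using * by blast
      then show "\<ominus>\<^bsub>R4\<^esub> x \<in> I" by (simp add: neg)
    qed (use * in auto)
  qed (use * in \<open>auto simp: mult.commute\<close>)
qed

lemma wideal_ideal: "ideal (wideal w d) R4"
  by (auto simp: R4_ideal_iff wideal_add wideal_mult_left)

lemma Var_power: "Var i ^ n = single (single i n) 1"
proof (induction n)
  case (Suc n)
  then show ?case by (simp add: Var_def mult_single flip: single_add)
qed (simp add: single_one)

lemma Var_in_wideal: "Var i \<in> wideal w d \<longleftrightarrow> d \<le> w i"
  by (simp add: Var_def wideal_def wt_single)

lemma Var_pow_in_wideal: "Var i ^ n \<in> wideal w d \<longleftrightarrow> d \<le> w i * n"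
  by (simp add: Var_power wideal_def wt_single)

lemma wt_pind_pos: "0 < wt (pind W) m \<longleftrightarrow> (\<exists>i\<in>W. 0 < lookup m i)"
  by (auto simp: wt_pind sum_nonneg_eq_0_iff simp flip: neq0_conv)

lemma single_split:
  assumes "0 < lookup m i"
  shows "single m c
    = Var i * single (m - single i 1) (c :: 'k :: field)"
proof -
  have "single i 1 + (m - single i 1) = m"
    using assms by (intro poly_mapping_eqI) (auto simp: lookup_add lookup_minus lookup_single when_def)
  then show ?thesis by (simp add: Var_def mult_single)
qed

lemma sum_singles_closed:
  fixes f :: "'a \<Rightarrow>\<^sub>0 'b::comm_monoid_add"
  assumes "\<And>m. m \<in> keys f \<Longrightarrow> single m (lookup f m) \<in> J"
    and "0 \<in> J" "\<And>f g. f \<in> J \<Longrightarrow> g \<in> J \<Longrightarrow> f + g \<in> J"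
  shows "f \<in> J"
proof -
  have "(\<Sum>m\<in>A. single m (lookup f m)) \<in> J"
    if "finite A" "A \<subseteq> keys f" for A
    using that assms by (induction A rule: finite_induct) auto
  then show ?thesis using poly_eq_sum_singles[of f] by (metis finite_keys order_refl)
qed

lemma Idl_Var: "Idl\<^bsub>R4\<^esub> (Var ` V) = wideal (pind V) 1"
proof
  interpret R: cring "R4 :: 'a poly4 ring" by (rule R4_cring)
  show "Idl\<^bsub>R4\<^esub> (Var ` V) \<subseteq> (wideal (pind V) 1 :: 'a poly4 set)"
    by (rule R.genideal_minimal[OF wideal_ideal]) (auto simp: Var_in_wideal pind_def)
  have id: "ideal (Idl\<^bsub>R4\<^esub> (Var ` V)) (R4 :: 'a poly4 ring)" by (rule R.genideal_ideal) simp
  show "wideal (pind V) 1 \<subseteq> Idl\<^bsub>R4\<^esub> (Var ` V :: 'a poly4 set)" (is "_ \<subseteq> ?J")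
  proof
    fix f :: "'a poly4" assume f: "f \<in> wideal (pind V) 1"
    have "single m (lookup f m) \<in> ?J" if "m \<in> keys f" for m
    proof -
      from f that have "0 < wt (pind V) m" by (auto simp: wideal_def)
      then obtain i where i: "i \<in> V" "0 < lookup m i" by (auto simp: wt_pind_pos)
      have "Var i \<in> ?J" using R.genideal_self'[of "Var i"] R.genideal_self[of "Var ` V"] i by auto
      then show ?thesis using id unfolding R4_ideal_iff single_split[OF i(2)]
        by (metis mult.commute)
    qed
    then show "f \<in> ?J" using id unfolding R4_ideal_iff by (intro sum_singles_closed[of f ?J]) auto
  qed
qed

lemma irrelevant_ideal_eq: "irrelevant_ideal = wideal (pind UNIV) 1"
  by (simp add: irrelevant_ideal_def Idl_Var)

lemma line_ideal_eq: "line_ideal i j = wideal (pind {i, j}) 1"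
  using Idl_Var[of "{i, j}"] by (simp add: line_ideal_def)

text \<open>A monomial of degree at least \<open>Suc n\<close> in the variables of \<open>V\<close>
  contains one of them, and removing it leaves degree at least \<open>n\<close>; so each term is a
  product of an element of the prime and one of its \<open>n\<close>-th power.\<close>

lemma wideal_pind_power: "ideal_power R4 (wideal (pind V) 1) n = wideal (pind V) n"
proof (induction n)
  case 0
  then show ?case by (simp add: wideal_zero_exp)
next
  case (Suc n)
  have Suc': "ideal_power R4 (wideal (pind V) 1) (Suc n)
    = ideal_prod R4 (wideal (pind V) 1) (wideal (pind V) n :: 'a poly4 set)"
    by (simp only: ideal_power.simps Suc)
  show ?case
  proof
    have "x \<in> wideal (pind V) (Suc n)"
      if "x \<in> ideal_prod R4 (wideal (pind V) 1) (wideal (pind V) n)" for x :: "'a poly4"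
      using that
    proof induction
      case (prod f g)
      then show ?case using wideal_mult[of f _ 1 g n] by simp
    qed (simp add: wideal_add)
    then show "ideal_power R4 (wideal (pind V) 1) (Suc n) \<subseteq> (wideal (pind V) (Suc n) :: 'a poly4 set)"
      unfolding Suc' by blast
    show "wideal (pind V) (Suc n) \<subseteq> (ideal_power R4 (wideal (pind V) 1) (Suc n) :: 'a poly4 set)"
    proof
      fix f :: "'a poly4" assume f: "f \<in> wideal (pind V) (Suc n)"
      show "f \<in> ideal_power R4 (wideal (pind V) 1) (Suc n)"
      proof (rule sum_singles_closed)
        fix m assume "m \<in> keys f"
        then have m: "Suc n \<le> wt (pind V) m" using f by (auto simp: wideal_def)
        then have "0 < wt (pind V) m" by linarith
        then obtain i where i: "i \<in> V" "0 < lookup m i" by (auto simp: wt_pind_pos)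
        have "single i 1 + (m - single i 1) = m"
          using i by (intro poly_mapping_eqI) (auto simp: lookup_add lookup_minus lookup_single when_def)
        then have "wt (pind V) m = 1 + wt (pind V) (m - single i 1)"
          using i wt_add[of "pind V" "single i 1" "m - single i 1"]
          by (simp add: wt_single pind_def)
        then have "single (m - single i 1) (lookup f m) \<in> wideal (pind V) n"
          using m by (auto simp: wideal_def)
        moreover have "Var i \<in> wideal (pind V) 1" using i by (simp add: Var_in_wideal pind_def)
        ultimately show "single m (lookup f m) \<in> ideal_power R4 (wideal (pind V) 1) (Suc n)"
          using ideal_prod.prod[of "Var i" _ _ _ R4] unfolding Suc' single_split[OF i(2)] by auto
      next
        have "(0::'a poly4) * 0 \<in> ideal_prod R4 (wideal (pind V) 1) (wideal (pind V) n)"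
          using ideal_prod.prod[of 0 "wideal (pind V) 1" 0 "wideal (pind V) n" "R4 :: 'a poly4 ring"] by simp
        then show "(0 :: 'a poly4) \<in> ideal_power R4 (wideal (pind V) 1) (Suc n)" unfolding Suc' by (simp only: mult_zero_left)
      next
        fix f g :: "'a poly4"
        assume "f \<in> ideal_power R4 (wideal (pind V) 1) (Suc n)"
          "g \<in> ideal_power R4 (wideal (pind V) 1) (Suc n)"
        then show "f + g \<in> ideal_power R4 (wideal (pind V) 1) (Suc n)"
          unfolding Suc' using ideal_prod.sum[of f R4 _ _ g] by auto
      qed
    qed
  qed
qed

definition tet_exp :: "nat \<Rightarrow> nat \<Rightarrow> nat \<Rightarrow> nat \<Rightarrow> nat \<Rightarrow> nat \<Rightarrow> 4 set \<Rightarrow> nat" where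
  "tet_exp a1 a2 a3 a4 a5 a6 W =
     (if W = {0,1} then a1 else if W = {0,2} then a2 else if W = {0,3} then a3
      else if W = {1,2} then a4 else if W = {1,3} then a5 else a6)"

lemma tetrahedral_ideal_eq:
  "tetrahedral_ideal a1 a2 a3 a4 a5 a6 = tI (tet_exp a1 a2 a3 a4 a5 a6)"
  unfolding tetrahedral_ideal_def line_ideal_eq wideal_pind_power tI_def card_2_subsets_4
  by (simp add: tet_exp_def doubleton_eq_iff all_conj_distrib imp_disjL Collect_conj_eq Int_assoc)

section \<open>Coefficients at integral exponent vectors\<close>

definition mk :: "(4 \<Rightarrow> int) \<Rightarrow> (4 \<Rightarrow>\<^sub>0 nat)" where
  "mk v = Abs_poly_mapping (\<lambda>i. nat (v i))"

lemma lookup_mk [simp]: "lookup (mk v) i = nat (v i)"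
  by (simp add: mk_def)

definition expo :: "(4 \<Rightarrow>\<^sub>0 nat) \<Rightarrow> 4 \<Rightarrow> int" where
  "expo m i = int (lookup m i)"

lemma mk_expo [simp]: "mk (expo m) = m"
  by (rule poly_mapping_eqI) (simp add: expo_def)

lemma expo_mk: "(\<And>i. 0 \<le> v i) \<Longrightarrow> expo (mk v) = v"
  by (simp add: expo_def fun_eq_iff)

lemma expo_nonneg [simp]: "0 \<le> expo m i"
  by (simp add: expo_def)

lemma inj_expo: "inj expo"
  by (metis injI mk_expo)

text \<open>Coefficients are extended by zero to the whole integral lattice: multiplication by a
  monomial becomes a translation without side conditions, and localised elements can be described
  over the same index set.\<close>

definition ecoeff :: "'k::field poly4 \<Rightarrow> (4 \<Rightarrow> int) \<Rightarrow> 'k" where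
  "ecoeff f v = (if \<forall>i. 0 \<le> v i then lookup f (mk v) else 0)"

lemma ecoeff_expo [simp]: "ecoeff f (expo m) = lookup f m"
  by (simp add: ecoeff_def)

lemma ecoeff_nonneg: "ecoeff f v \<noteq> 0 \<Longrightarrow> 0 \<le> v i"
  by (metis ecoeff_def)

lemma ecoeff_neqD: "ecoeff f v \<noteq> 0 \<Longrightarrow> \<exists>m\<in>keys f. v = expo m"
  by (metis ecoeff_def expo_mk in_keys_iff)

lemma ecoeff_zero [simp]: "ecoeff 0 v = 0"
  by (simp add: ecoeff_def)

lemma ecoeff_add: "ecoeff (f + g) v = ecoeff f v + ecoeff g v"
  by (simp add: ecoeff_def lookup_add)

lemma ecoeff_diff: "ecoeff (f - g) v = ecoeff f v - ecoeff g v"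
  by (simp add: ecoeff_def lookup_minus)

lemma ecoeff_minus: "ecoeff (- f) v = - ecoeff f v"
  by (simp add: ecoeff_def)

lemma ecoeff_inject: "ecoeff f = ecoeff g \<longleftrightarrow> f = g"
proof
  assume "ecoeff f = ecoeff g"
  then have "lookup f m = lookup g m" for m by (metis ecoeff_expo)
  then show "f = g" by (rule poly_mapping_eqI)
qed simp

lemma finite_ecoeff: "finite {v. ecoeff f v \<noteq> 0}"
  by (rule finite_subset[of _ "expo ` keys f"]) (use ecoeff_neqD in auto)

lemma ecoeff_surj:
  assumes "finite {v. F v \<noteq> 0}" "\<And>v i. F v \<noteq> 0 \<Longrightarrow> 0 \<le> v i"
  obtains f where "ecoeff f = F"
proof
  have "finite {m. F (expo m) \<noteq> 0}"
    using finite_vimageI[OF assms(1) inj_expo] by (simp add: vimage_def)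
  then have "lookup (Abs_poly_mapping (\<lambda>m. F (expo m))) m = F (expo m)" for m
    by simp
  then show "ecoeff (Abs_poly_mapping (\<lambda>m. F (expo m))) = F"
    using assms(2) by (force simp: ecoeff_def expo_mk fun_eq_iff)
qed

lemma ecoeff_single_mult:
  "ecoeff (single m c * f) v = c * ecoeff f (\<lambda>i. v i - expo m i)"
proof (cases "\<forall>i. 0 \<le> v i - expo m i")
  case True
  have "mk v = m + mk (\<lambda>i. v i - expo m i)"
  proof (rule poly_mapping_eqI)
    fix i
    have "0 \<le> v i - int (lookup m i)" using True by (simp add: expo_def)
    then have "nat (v i) = lookup m i + nat (v i - int (lookup m i))"
      by linarith
    then show "lookup (mk v) i = lookup (m + mk (\<lambda>i. v i - expo m i)) i"
      by (simp add: lookup_add expo_def)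
  qed
  moreover have "\<forall>i. 0 \<le> v i"
    using True by (meson diff_ge_0_iff_ge expo_nonneg order_trans)
  ultimately show ?thesis using True by (simp add: ecoeff_def lookup_single_mult)
next
  case False
  have "lookup (single m c * f) (mk v) = 0" if "\<forall>i. 0 \<le> v i"
  proof (rule lookup_single_mult_eq_0)
    fix m' show "mk v \<noteq> m + m'"
    proof
      assume "mk v = m + m'"
      then have "nat (v i) = lookup m i + lookup m' i" for i
        by (metis lookup_mk lookup_add)
      then have "0 \<le> v i - int (lookup m i)" for i
        using that[rule_format, of i] by (metis diff_ge_0_iff_ge int_nat_eq le_add1 of_nat_mono)
      then have "\<forall>i. 0 \<le> v i - expo m i" by (simp add: expo_def)
      with False show False by blast
    qed
  qed
  with False show ?thesis by (auto simp: ecoeff_def)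
qed

lemma ecoeff_Var_pow: "ecoeff (Var k ^ n * f) v = ecoeff f (v(k := v k - int n))"
proof -
  have "(\<lambda>i. v i - expo (single k n) i) = v(k := v k - int n)"
    by (auto simp: expo_def lookup_single when_def)
  then show ?thesis by (simp add: Var_power ecoeff_single_mult)
qed

lemma ecoeff_Var: "ecoeff (Var k * f) v = ecoeff f (v(k := v k - 1))"
  using ecoeff_Var_pow[of k 1] by simp

lemma tI_ecoeff:
  "f \<in> tI a \<longleftrightarrow> (\<forall>v. ecoeff f v \<noteq> 0 \<longrightarrow> (\<forall>W. card W = 2 \<longrightarrow> int (a W) \<le> sum v W))"
proof
  assume f: "f \<in> tI a"
  show "\<forall>v. ecoeff f v \<noteq> 0 \<longrightarrow> (\<forall>W. card W = 2 \<longrightarrow> int (a W) \<le> sum v W)"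
  proof clarify
    fix v W assume "ecoeff f v \<noteq> 0" "card (W :: 4 set) = 2"
    then obtain m where "m \<in> keys f" "v = expo m" using ecoeff_neqD by blast
    then show "int (a W) \<le> sum v W" using f \<open>card W = 2\<close>
      by (simp add: tI_keys expo_def flip: of_nat_sum)
  qed
next
  assume *: "\<forall>v. ecoeff f v \<noteq> 0 \<longrightarrow> (\<forall>W. card W = 2 \<longrightarrow> int (a W) \<le> sum v W)"
  show "f \<in> tI a" unfolding tI_keys
  proof clarify
    fix m W assume "m \<in> keys f" "card (W :: 4 set) = 2"
    then have "int (a W) \<le> sum (expo m) W" using * by (simp add: in_keys_iff)
    then show "a W \<le> (\<Sum>i\<in>W. lookup m i)"
      by (simp add: expo_def flip: of_nat_sum)
  qed
qed

section \<open>The exponents supporting cohomology\<close>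

text \<open>\<open>good a u S\<close> states that the Laurent monomial with exponent \<open>u\<close> lies in the localisation of
  the ideal \<open>tI a\<close> at the product of the variables in \<open>S\<close>.\<close>

definition good :: "(4 set \<Rightarrow> nat) \<Rightarrow> (4 \<Rightarrow> int) \<Rightarrow> 4 set \<Rightarrow> bool" where
  "good a u S \<longleftrightarrow> (\<forall>i. i \<notin> S \<longrightarrow> 0 \<le> u i) \<and>
     (\<forall>V. card V = 2 \<longrightarrow> V \<inter> S = {} \<longrightarrow> int (a V) \<le> sum u V)"

text \<open>In degree \<open>u\<close> the first cohomology is one-dimensional if \<open>u\<close> satisfies the following condition
  for some \<open>W\<close>, and zero otherwise.\<close>

definition gap :: "(4 set \<Rightarrow> nat) \<Rightarrow> 4 set \<Rightarrow> (4 \<Rightarrow> int) \<Rightarrow> bool" where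
  "gap a W u \<longleftrightarrow> card W = 2 \<and> (\<forall>i. 0 \<le> u i) \<and> sum u W < int (a W) \<and> sum u (- W) < int (a (- W)) \<and>
     (\<forall>V. card V = 2 \<longrightarrow> V \<noteq> W \<longrightarrow> V \<noteq> - W \<longrightarrow> int (a V) \<le> sum u V)"

lemma good_mono: "good a u S \<Longrightarrow> S \<subseteq> T \<Longrightarrow> good a u T"
  unfolding good_def by blast

lemma good_mono_exp: "good a u S \<Longrightarrow> (\<And>i. u i \<le> v i) \<Longrightarrow> good a v S"
  unfolding good_def by (meson order_trans sum_mono)

lemma card_Compl_2: "card (W :: 4 set) = 2 \<Longrightarrow> card (- W) = 2"
  by (simp add: Compl_eq_Diff_UNIV card_Diff_subset)

text \<open>The only pair disjoint from \<open>S\<close> is \<open>- S\<close>, so the family of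
  inequalities shrinks to a single one.\<close>

lemma good_card_2:
  assumes "card S = 2"
  shows "good a u S \<longleftrightarrow> (\<forall>i. i \<notin> S \<longrightarrow> 0 \<le> u i) \<and> int (a (- S)) \<le> sum u (- S)"
proof -
  have "V = - S" if "card V = 2" "V \<inter> S = {}" for V
    using that card_Compl_2[OF assms] by (intro card_subset_eq) auto
  then show ?thesis unfolding good_def using card_Compl_2[OF assms] by (metis Compl_disjoint2)
qed

text \<open>A reason for \<open>{i}\<close> not to be good is a negative coordinate \<open>k\<close>
  or a violated pair \<open>V\<close>. Together with \<open>i\<close> it occupies at most three of
  the four points, so a free point \<open>j\<close> can be added without removing the
  reason.\<close>

lemma not_good_singleton:
  assumes "\<not> good a u {i}"
  obtains j where "j \<noteq> i" "\<not> good a u {i, j}"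
proof -
  have pick: "\<exists>j. j \<notin> A" if "card A < 4" for A :: "4 set"
  proof (rule ccontr)
    assume "\<nexists>j. j \<notin> A"
    then have "A = UNIV" by auto
    with that show False by simp
  qed
  consider k where "k \<noteq> i" "u k < 0" | V where "card V = 2" "i \<notin> V" "sum u V < int (a V)"
    using assms unfolding good_def by force
  then show ?thesis
  proof cases
    case 1
    have "card {i, k} < 4" by (simp add: card_insert_if)
    then obtain j where "j \<notin> {i, k}" using pick by blast
    then have "\<not> good a u {i, j}" using 1 unfolding good_def by force
    then show ?thesis using that \<open>j \<notin> {i, k}\<close> by blast
  next
    case 2
    then have "card (insert i V) < 4" by simp
    then obtain j where "j \<notin> insert i V" using pick by blast
    then have "V \<inter> {i, j} = {}" using 2 by auto
    then have "\<not> good a u {i, j}" using 2 unfolding good_def by (metis not_le)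
    then show ?thesis using that \<open>j \<notin> insert i V\<close> by blast
  qed
qed

lemma gap_good:
  assumes "card W = 2" "card S = 2" "gap a W u"
  shows "good a u S \<longleftrightarrow> S \<noteq> W \<and> S \<noteq> - W"
  using assms card_Compl_2[OF assms(2)] unfolding good_card_2[OF assms(2)] gap_def
  by (metis double_complement linorder_not_le)

text \<open>Goodness of a pair \<open>S\<close> tests the sum over \<open>- S\<close>, and the pairs
  other than \<open>W\<close> and \<open>- W\<close> are closed under complement; hence the
  inequalities can be read as a graph whose only edges, the pairs that are not good, are
  \<open>W\<close> and \<open>- W\<close>.\<close>

lemma gap_iff:
  assumes W: "card W = 2"
  shows "gap a W u \<longleftrightarrow> (\<forall>S. card S = 2 \<longrightarrow> (good a u S \<longleftrightarrow> S \<noteq> W \<and> S \<noteq> - W))" (is "_ \<longleftrightarrow> ?R")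
proof
  assume R: ?R
  have ge: "0 \<le> u i" for i
  proof -
    \<comment> \<open>Two of the four pairs that meet both \<open>W\<close> and \<open>- W\<close>
      avoid \<open>i\<close>; such a pair is good, which forces \<open>0 \<le> u i\<close>.\<close>
    obtain S where "card S = 2" "i \<notin> S" "S \<noteq> W" "S \<noteq> - W"
    proof -
      obtain p q where pq: "W = {p, q}" "p \<noteq> q" using W by (auto simp: card_2_iff)
      obtain r s where rs: "- W = {r, s}" "r \<noteq> s" using card_Compl_2[OF W] by (auto simp: card_2_iff)
      have "{p, q} \<inter> {r, s} = {}" "{p, q} \<union> {r, s} = UNIV" using pq rs by blast+
      then have "\<exists>S \<in> {{p, r}, {p, s}, {q, r}, {q, s}}. i \<notin> S"
        using pq(2) rs(2) by auto
      then obtain S where S: "S \<in> {{p, r}, {p, s}, {q, r}, {q, s}}" "i \<notin> S" by blast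
      have d: "p \<noteq> r" "p \<noteq> s" "q \<noteq> r" "q \<noteq> s" using \<open>{p, q} \<inter> {r, s} = {}\<close> by blast+
      from S have "card S = 2 \<and> S \<noteq> {p, q} \<and> S \<noteq> {r, s}"
        by (elim insertE emptyE) (use d pq(2) rs(2) in \<open>simp_all add: doubleton_eq_iff\<close>)
      then show ?thesis using that[of S] S(2) pq(1) rs(1) by simp
    qed
    then show ?thesis using R good_card_2[of S a u] by blast
  qed
  show "gap a W u" unfolding gap_def
  proof (intro conjI allI impI W ge)
    show "sum u W < int (a W)"
      using R[rule_format, OF card_Compl_2[OF W]] ge
      by (simp add: good_card_2[OF card_Compl_2[OF W]] not_le)
    show "sum u (- W) < int (a (- W))"
      using R[rule_format, OF W] ge by (simp add: good_card_2[OF W] not_le)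
    fix V :: "4 set" assume V: "card V = 2" "V \<noteq> W" "V \<noteq> - W"
    then show "int (a V) \<le> sum u V"
      using R[rule_format, OF card_Compl_2[OF V(1)]] good_card_2[OF card_Compl_2[OF V(1)]] by auto
  qed
qed (use gap_good assms in blast)

text \<open>View the pairs \<open>{i, j}\<close> that are not good as the edges of a graph on four points.  The points
  \<open>i\<close> for which \<open>{i}\<close> is not good are those on some edge, and two edges without a connection
  between them can only form a perfect matching, which is the exceptional case \<open>gap a W u\<close>.\<close>

lemma const_on_bad:
  assumes \<beta>: "\<And>i j. i \<noteq> j \<Longrightarrow> \<not> good a u {i, j} \<Longrightarrow> \<beta> i = \<beta> j"
    and gap: "\<And>W. gap a W u \<Longrightarrow> \<exists>i\<in>W. \<exists>j\<in>- W. \<beta> i = \<beta> j"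
    and i: "\<not> good a u {i}" and j: "\<not> good a u {j}"
  shows "\<beta> i = \<beta> j"
proof (rule ccontr)
  assume ne: "\<beta> i \<noteq> \<beta> j"
  obtain i' where i': "i' \<noteq> i" "\<not> good a u {i, i'}" using not_good_singleton[OF i] .
  obtain j' where j': "j' \<noteq> j" "\<not> good a u {j, j'}" using not_good_singleton[OF j] .
  have eq: "\<beta> i' = \<beta> i" "\<beta> j' = \<beta> j" using \<beta> i' j' by metis+
  then have dist: "i \<noteq> j" "i \<noteq> j'" "i' \<noteq> j" "i' \<noteq> j'" using ne by metis+
  have "card {i, i', j, j'} = 4" using dist i'(1) j'(1) by auto
  then have univ: "{i, i', j, j'} = UNIV" by (intro card_subset_eq) auto
  have compl: "- {i, i'} = {j, j'}" using univ dist i' j' by blast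
  have W: "card {i, i'} = 2" using i' by auto
  \<comment> \<open>Any pair other than the two edges joins points with different values of
    \<open>\<beta>\<close>, so by the edge hypothesis it is good.\<close>
  have "gap a {i, i'} u" unfolding gap_iff[OF W] compl
  proof (intro allI impI)
    fix S :: "4 set" assume S: "card S = 2"
    then obtain p q where pq: "S = {p, q}" "p \<noteq> q" by (auto simp: card_2_iff)
    have "p \<in> {i, i', j, j'}" "q \<in> {i, i', j, j'}" using univ by auto
    then have "S = {i, i'} \<or> S = {j, j'} \<or> \<beta> p \<noteq> \<beta> q"
      using pq eq ne by auto
    then have "S \<noteq> {i, i'} \<and> S \<noteq> {j, j'} \<longrightarrow> good a u S" using \<beta> pq by blast
    then show "good a u S \<longleftrightarrow> S \<noteq> {i, i'} \<and> S \<noteq> {j, j'}" using i' j' by blast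
  qed
  then obtain p q where "p \<in> {i, i'}" "q \<in> {j, j'}" "\<beta> p = \<beta> q"
    using gap[of "{i, i'}"] compl by blast
  then show False using eq ne by auto
qed

text \<open>Keeping the same \<open>W\<close> in both degrees loses nothing: raising an exponent
  preserves every inequality that holds, so a gap at the successor can only have the matching that
  \<open>u\<close> has. Between two such degrees \<open>Var i\<close> acts as an
  isomorphism.\<close>

definition no_adjacent_gaps :: "(4 set \<Rightarrow> nat) \<Rightarrow> bool" where
  "no_adjacent_gaps a \<longleftrightarrow> (\<forall>W u i. gap a W u \<longrightarrow> \<not> gap a W (u(i := u i + 1)))"

lemma gap_Compl: "gap a W u \<Longrightarrow> gap a (- W) u"
  using card_Compl_2 unfolding gap_def by (metis double_complement)

lemma sum_split_Compl: "sum u UNIV = sum u W + sum u (- W)" for u :: "4 \<Rightarrow> int"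
  using sum.union_disjoint[of W "- W" u] by simp

lemma sum_upd_add: "sum (u(i := u i + c)) V = sum u V + (if i \<in> V then c else 0)"
  for u :: "4 \<Rightarrow> int"
proof (cases "i \<in> V")
  case False
  then show ?thesis by (auto intro: sum.cong)
qed (simp add: sum.remove[of _ i])

text \<open>If the sum over \<open>W\<close> were smaller, raising an exponent in \<open>W\<close>
  would keep both defects and all other inequalities in force, giving an adjacent gap.\<close>

lemma gap_sum_eq:
  assumes B: "no_adjacent_gaps a" and g: "gap a W u"
  shows "sum u W = int (a W) - 1"
proof (rule ccontr)
  assume ne: "sum u W \<noteq> int (a W) - 1"
  have "card W = 2" using g by (simp add: gap_def)
  then obtain i where i: "i \<in> W" by fastforce
  have "gap a W (u(i := u i + 1))"
    using g ne i unfolding gap_def sum_upd_add by auto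
  with B g show False unfolding no_adjacent_gaps_def by blast
qed

lemma gap_degree:
  assumes B: "no_adjacent_gaps a" and g: "gap a W u"
  shows "sum u UNIV = int (a W) + int (a (- W)) - 2"
  using gap_sum_eq[OF assms] gap_sum_eq[OF B gap_Compl[OF g]] sum_split_Compl[of u W] by simp

text \<open>Two different pairings would each have to exceed the other one in degree.\<close>

lemma gap_unique:
  assumes B: "no_adjacent_gaps a" and g: "gap a W u" and g': "gap a W' u'"
  shows "W' = W \<or> W' = - W"
proof (rule ccontr)
  assume "\<not> (W' = W \<or> W' = - W)"
  then have ne: "W' \<noteq> W" "W' \<noteq> - W" "- W' \<noteq> W" "- W' \<noteq> - W" "W \<noteq> W'" "W \<noteq> - W'" "- W \<noteq> W'" "- W \<noteq> - W'"
    by auto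
  have c: "card W = 2" "card W' = 2" "card (- W) = 2" "card (- W') = 2"
    using g g' card_Compl_2 by (auto simp: gap_def)
  have ge: "\<forall>V. card V = 2 \<longrightarrow> V \<noteq> W \<longrightarrow> V \<noteq> - W \<longrightarrow> int (a V) \<le> sum u V"
    and ge': "\<forall>V. card V = 2 \<longrightarrow> V \<noteq> W' \<longrightarrow> V \<noteq> - W' \<longrightarrow> int (a V) \<le> sum u' V"
    using g g' by (simp_all add: gap_def)
  have "int (a W') \<le> sum u W'" "int (a (- W')) \<le> sum u (- W')"
    "int (a W) \<le> sum u' W" "int (a (- W)) \<le> sum u' (- W)"
    using ge[rule_format, OF c(2) ne(1,2)] ge[rule_format, OF c(4) ne(3,4)]
      ge'[rule_format, OF c(1) ne(5,6)] ge'[rule_format, OF c(3) ne(7,8)] by simp_all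
  then show False
    using gap_degree[OF B g] gap_degree[OF B g'] sum_split_Compl[of u W'] sum_split_Compl[of u' W] by simp
qed

lemma gap_degree_eq:
  assumes "no_adjacent_gaps a" "gap a W u" "gap a W' u'"
  shows "sum u UNIV = sum u' UNIV"
  using gap_degree[OF assms(1,2)] gap_degree[OF assms(1,3)] gap_unique[OF assms] by auto

text \<open>All gaps lie in one total degree, whatever their matchings, while lowering an exponent
  changes the degree. This is the form in which nonadjacency serves to extend sections.\<close>

lemma not_gap_pred:
  assumes "no_adjacent_gaps a" "gap a W u"
  shows "\<not> gap a W' (u(i := u i - 1))"
proof
  assume "gap a W' (u(i := u i - 1))"
  from gap_degree_eq[OF assms this] have "sum u UNIV = sum (u(i := u i - 1)) UNIV" .
  then show False by (simp add: sum.remove[of UNIV i])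
qed

section \<open>The weak sequence condition for polynomials\<close>

lemma Var_power_dvd:
  assumes "\<And>m. m \<in> keys f \<Longrightarrow> n \<le> lookup m k"
  shows "Var k ^ n dvd (f :: 'k::field poly4)"
proof -
  have "f \<in> {f. Var k ^ n dvd f}"
  proof (rule sum_singles_closed)
    fix m assume "m \<in> keys f"
    then have "single k n + (m - single k n) = m"
      using assms[of m]
      by (intro poly_mapping_eqI) (auto simp: lookup_add lookup_minus lookup_single when_def)
    then have "single m (lookup f m)
      = Var k ^ n * single (m - single k n) (lookup f m)"
      by (simp add: Var_power mult_single)
    then show "single m (lookup f m) \<in> {f. Var k ^ n dvd f}" by simp
  qed auto
  then show ?thesis by simp
qed

lemma wideal_pind_subset: "V \<subseteq> V' \<Longrightarrow> wideal (pind V) 1 \<subseteq> wideal (pind V') 1"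
proof -
  assume "V \<subseteq> V'"
  then have "wt (pind V) m \<le> wt (pind V') m" for m
    unfolding wt_pind by (intro sum_mono2) auto
  then show ?thesis unfolding wideal_def by (auto intro: order_trans)
qed

text \<open>A parameter lying in the ideal of one of the lines cannot be completed to a system of
  parameters: modulo that ideal, the second parameter would divide a power of each of the two
  remaining variables up to units.\<close>

lemma line_prime_contains_no_parameter:
  fixes y1 y2 :: "'k::field poly4"
  assumes V: "card V = 2" and kl: "k \<noteq> l" "k \<notin> V" "l \<notin> V"
    and y1: "y1 \<in> wideal (pind V) 1" and y2: "y2 \<in> wideal (pind UNIV) 1"
    and I: "I \<subseteq> wideal (pind V) 1"
    and k: "s * Var k ^ n - (f * y1 + g * y2) \<in> I" and s: "s \<notin> wideal (pind UNIV) 1"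
    and l: "s' * Var l ^ n' - (f' * y1 + g' * y2) \<in> I" and s': "s' \<notin> wideal (pind UNIV) 1"
  shows False
proof -
  let ?P = "wideal (pind V) 1 :: 'k poly4 set"
  have sub: "?P \<subseteq> wideal (pind UNIV) 1" by (rule wideal_pind_subset) simp
  have reduce: "s * x - g * y2 \<in> ?P" if "s * x - (f * y1 + g * y2) \<in> I" for s x f g
  proof -
    have "s * x - g * y2 = (s * x - (f * y1 + g * y2)) + f * y1" by simp
    also have "\<dots> \<in> ?P" using that I y1 by (intro wideal_add wideal_mult_left) auto
    finally show ?thesis .
  qed
  note k = reduce[OF k] and l = reduce[OF l]
  have n: "n \<noteq> 0"
  proof
    assume "n = 0"
    then have "s = (s * Var k ^ n - g * y2) + g * y2" by simp
    also have "\<dots> \<in> wideal (pind UNIV) 1"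
      using k y2 sub by (intro wideal_add wideal_mult_left) auto
    finally show False using s by simp
  qed
  let ?P' = "wideal (pind (insert k V)) 1 :: 'k poly4 set"
  \<comment> \<open>The relation for \<open>l\<close> enters only here: modulo the ideal of
    \<open>V\<close> and \<open>k\<close> it makes \<open>s' * Var l ^ n'\<close>, which is nonzero
    there, a multiple of \<open>y2\<close>.\<close>
  have y2': "y2 \<notin> ?P'"
  proof
    assume "y2 \<in> ?P'"
    moreover have "?P \<subseteq> ?P'" by (rule wideal_pind_subset) auto
    ultimately have "(s' * Var l ^ n' - g' * y2) + g' * y2 \<in> ?P'"
      using l by (intro wideal_add wideal_mult_left) auto
    then have "Var l ^ n' * s' \<in> ?P'" by (simp add: mult.commute)
    moreover have "Var l ^ n' \<notin> ?P'" using kl by (simp add: Var_pow_in_wideal pind_def)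
    ultimately have "s' \<in> ?P'" by (rule wideal_cancel[rotated])
    moreover have "?P' \<subseteq> wideal (pind UNIV) 1" by (rule wideal_pind_subset) simp
    ultimately show False using s' by auto
  qed
  \<comment> \<open>This weight gives \<open>Var k ^ n\<close> and every variable of
    \<open>V\<close> weight \<open>n\<close>, while \<open>y2\<close> keeps a term of weight 0;
    cancelling \<open>y2\<close> therefore puts \<open>g\<close> into weight
    \<open>n\<close>.\<close>
  define w where "w = (\<lambda>i. n * pind V i + pind {k} i)"
  have wt: "wt w m = n * wt (pind V) m + lookup m k" for m
  proof -
    have "wt w m = n * wt (pind V) m + wt (pind {k}) m"
      by (simp add: wt_def w_def algebra_simps sum.distrib sum_distrib_left)
    then show ?thesis by (simp add: wt_pind[of "{k}"])
  qed
  have Pw: "?P \<subseteq> wideal w n"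
  proof
    fix f :: "'k poly4" assume "f \<in> ?P"
    then show "f \<in> wideal w n" unfolding wideal_def wt
      by (auto simp: trans_le_add1)
  qed
  have "y2 * g \<in> wideal w n"
  proof -
    have "y2 * g = s * Var k ^ n - (s * Var k ^ n - g * y2)" by simp
    also have "\<dots> \<in> wideal w n"
    proof (rule wideal_diff)
      show "s * Var k ^ n \<in> wideal w n"
        by (rule wideal_mult_left) (simp add: Var_pow_in_wideal w_def pind_def)
      show "s * Var k ^ n - g * y2 \<in> wideal w n" using k Pw by blast
    qed
    finally show ?thesis .
  qed
  moreover have "y2 \<notin> wideal w 1"
  proof -
    obtain m where m: "m \<in> keys y2" "wt (pind (insert k V)) m = 0"
      using y2' by (auto simp: wideal_def)
    then have "lookup m i = 0" if "i \<in> insert k V" for i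
      using that unfolding wt_pind by (metis finite sum_eq_0_iff)
    then have "wt w m = 0" unfolding wt wt_pind by simp
    then show ?thesis unfolding wideal_def using m(1) by (auto intro!: bexI[of _ m])
  qed
  ultimately have gw: "g \<in> wideal w n" by (rule wideal_cancel[rotated])
  \<comment> \<open>\<open>g0\<close> is \<open>g\<close> modulo the prime of \<open>V\<close> and
    is divisible by \<open>Var k ^ n\<close>; dividing the relation for \<open>k\<close> by that
    power makes \<open>s\<close> a multiple of \<open>y2\<close> modulo this prime.\<close>
  define g0 where "g0 = pfilter (\<lambda>m. wt (pind V) m = 0) g"
  have "Var k ^ n dvd g0"
  proof (rule Var_power_dvd)
    fix m assume "m \<in> keys g0"
    then have "m \<in> keys g" "wt (pind V) m = 0"
      by (auto simp: g0_def in_keys_iff lookup_pfilter when_def split: if_splits)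
    then show "n \<le> lookup m k" using gw by (force simp: wideal_def wt)
  qed
  then obtain g1 where g1: "g0 = Var k ^ n * g1" by (auto simp: dvd_def)
  have gg0: "g - g0 \<in> ?P"
    by (auto simp: wideal_def in_keys_iff g0_def lookup_minus lookup_pfilter when_def Suc_le_eq split: if_splits)
  have "Var k ^ n * (s - g1 * y2) = (s * Var k ^ n - g * y2) + y2 * (g - g0)"
    unfolding g1 by (simp add: algebra_simps)
  also have "\<dots> \<in> ?P" using k gg0 by (intro wideal_add wideal_mult_left)
  finally have "Var k ^ n * (s - g1 * y2) \<in> ?P" .
  moreover have "Var k ^ n \<notin> ?P" using kl by (simp add: Var_pow_in_wideal pind_def)
  ultimately have "s - g1 * y2 \<in> ?P" by (rule wideal_cancel[rotated])
  then have "(s - g1 * y2) + g1 * y2 \<in> wideal (pind UNIV) 1"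
    using sub y2 by (intro wideal_add wideal_mult_left) auto
  then show False using s by simp
qed

text \<open>The hypothesis makes \<open>w k / Var k ^ N\<close> a section of the structure sheaf of the curve.  If the
  variables annihilate the first cohomology, then its multiple by \<open>Var l\<close> is the restriction
  of a polynomial \<open>g\<close>.\<close>

lemma global_section_lift:
  fixes w :: "4 \<Rightarrow> 'k::field poly4"
  assumes B: "no_adjacent_gaps a"
    and y1: "\<And>V. card V = 2 \<Longrightarrow> 0 < a V \<Longrightarrow> y1 \<notin> wideal (pind V) 1"
    and w: "\<And>k. Var k ^ N * z - y1 * w k \<in> tI a"
  shows "\<exists>g. Var l * z - y1 * g \<in> tI a"
proof -
  \<comment> \<open>\<open>\<phi> i\<close> lists the Laurent coefficients of
    \<open>w i / Var i ^ N\<close>, the local expression for \<open>z / y1\<close> on the chart of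
    \<open>i\<close>.\<close>
  define \<phi> where "\<phi> i u = ecoeff (w i) (u(i := u i + int N))" for i u
  have \<phi>_nz: "0 \<le> u j + (if j = i then int N else 0)" if "\<phi> i u \<noteq> 0" for i j u
    using ecoeff_nonneg[OF that[unfolded \<phi>_def], of j] by (auto split: if_splits)
  have cocycle: "\<phi> i u = \<phi> j u" if ij: "i \<noteq> j" and bad: "\<not> good a u {i, j}" for i j u
  proof (rule ccontr)
    assume ne: "\<phi> i u \<noteq> \<phi> j u"
    \<comment> \<open>Divided by \<open>(Var i * Var j) ^ N\<close>, this is the difference of the
      local expressions on two charts. It lies in the ideal because \<open>y1\<close> is a
      nonzerodivisor, so the expressions agree at every degree that is not good for
      \<open>{i, j}\<close>.\<close>
    define D where "D = Var j ^ N * w i - Var i ^ N * w j"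
    have "y1 * D = Var i ^ N * (Var j ^ N * z - y1 * w j) - Var j ^ N * (Var i ^ N * z - y1 * w i)"
      by (simp add: D_def algebra_simps)
    also have "\<dots> \<in> tI a" by (intro tI_diff tI_mult_left w)
    finally have "y1 * D \<in> tI a" .
    then have D: "D \<in> tI a" using tI_cancel[OF y1] by blast
    define v where "v = u(i := u i + int N, j := u j + int N)"
    have "ecoeff D v = \<phi> i u - \<phi> j u"
    proof -
      have "v(j := v j - int N) = u(i := u i + int N)" "v(i := v i - int N) = u(j := u j + int N)"
        using ij by (auto simp: v_def)
      then show ?thesis unfolding D_def ecoeff_diff ecoeff_Var_pow \<phi>_def by simp
    qed
    then have v: "ecoeff D v \<noteq> 0" using ne by simp
    have "good a u {i, j}" unfolding good_def
    proof (intro conjI allI impI)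
      fix k assume "k \<notin> {i, j}"
      then show "0 \<le> u k" using ecoeff_nonneg[OF v, of k] by (simp add: v_def)
    next
      fix V :: "4 set" assume V: "card V = 2" "V \<inter> {i, j} = {}"
      then have "sum v V = sum u V" by (intro sum.cong) (auto simp: v_def)
      then show "int (a V) \<le> sum u V" using D V v unfolding tI_ecoeff by metis
    qed
    with bad show False by simp
  qed
  define pr where "pr u = u(l := u l - 1)" for u :: "4 \<Rightarrow> int"
  have const: "\<phi> i (pr u) = \<phi> j (pr u)" if i: "\<not> good a u {i}" and j: "\<not> good a u {j}" for i j u
  proof -
    have bad: "\<not> good a (pr u) S" if "\<not> good a u S" for S
    proof -
      have "pr u i \<le> u i" for i by (simp add: pr_def)
      then show ?thesis using that good_mono_exp by blast
    qed
    \<comment> \<open>Badness passes from \<open>u\<close> to \<open>pr u\<close>. Hence the values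
      at \<open>pr u\<close> can be compared along the graph of \<open>u\<close> when
      \<open>u\<close> is not a gap, and along the graph of \<open>pr u\<close> otherwise, since
      then \<open>pr u\<close> is not a gap.\<close>
    show ?thesis
    proof (cases "\<exists>W. gap a W u")
      case False
      show ?thesis
      proof (rule const_on_bad[where a = a and u = "u" and \<beta> = "\<lambda>i. \<phi> i (pr u)"])
        fix i j :: 4 assume "i \<noteq> j" "\<not> good a (u) {i, j}"
        then show "\<phi> i (pr u) = \<phi> j (pr u)" using cocycle bad by blast
      next
        fix W assume "gap a W (u)"
        then show "\<exists>i\<in>W. \<exists>j\<in>- W. \<phi> i (pr u) = \<phi> j (pr u)" using False by blast
      qed (use i j bad in blast)+
    next
      case True
      then have no: "\<nexists>W. gap a W (pr u)" using not_gap_pred[OF B] by (auto simp: pr_def)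
      show ?thesis
      proof (rule const_on_bad[where a = a and u = "pr u" and \<beta> = "\<lambda>i. \<phi> i (pr u)"])
        fix i j :: 4 assume "i \<noteq> j" "\<not> good a (pr u) {i, j}"
        then show "\<phi> i (pr u) = \<phi> j (pr u)" using cocycle bad by blast
      next
        fix W assume "gap a W (pr u)"
        then show "\<exists>i\<in>W. \<exists>j\<in>- W. \<phi> i (pr u) = \<phi> j (pr u)" using no by blast
      qed (use i j bad in blast)+
    qed
  qed
  \<comment> \<open>The common value at the points that are not good; where all points are good
    every value is admissible, and zero keeps the support finite.\<close>
  define G where "G u = (if \<exists>i. \<not> good a u {i} then \<phi> (SOME i. \<not> good a u {i}) (pr u) else 0)" for u
  have G: "\<phi> i (pr u) = G u" if "\<not> good a u {i}" for i u
  proof -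
    have "\<not> good a u {SOME i. \<not> good a u {i}}" using that by (rule someI)
    then show ?thesis using that const[OF that] by (auto simp: G_def)
  qed
  have G_nonneg: "0 \<le> u k" if "G u \<noteq> 0" for u k
  proof (rule ccontr)
    assume "\<not> 0 \<le> u k"
    then have neg: "pr u k < 0" "u k < 0" by (auto simp: pr_def)
    obtain i :: 4 where i: "i \<noteq> k" using that[of 0] that[of 1] by (cases "k = 0") auto
    then have "\<not> good a u {i}" using neg unfolding good_def by force
    then have "\<phi> i (pr u) \<noteq> 0" using G that by metis
    then show False using \<phi>_nz[of i "pr u" k] i neg by simp
  qed
  have "finite {u. G u \<noteq> 0}"
  proof (rule finite_subset)
    have "inj (\<lambda>u. (pr u)(i := pr u i + int N))" for i
    proof (rule injI)
      fix u u' assume eq: "(pr u)(i := pr u i + int N) = (pr u')(i := pr u' i + int N)"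
      show "u = u'"
      proof
        fix x show "u x = u' x" using fun_cong[OF eq, of x] by (auto simp: pr_def split: if_splits)
      qed
    qed
    then have "finite ((\<lambda>u. (pr u)(i := pr u i + int N)) -` {v. ecoeff (w i) v \<noteq> 0})" for i
      by (intro finite_vimageI finite_ecoeff) auto
    then have "finite {u. \<phi> i (pr u) \<noteq> 0}" for i
      unfolding \<phi>_def vimage_def mem_Collect_eq by blast
    then show "finite (\<Union>i. {u. \<phi> i (pr u) \<noteq> 0})" by simp
    show "{u. G u \<noteq> 0} \<subseteq> (\<Union>i. {u. \<phi> i (pr u) \<noteq> 0})" by (auto simp: G_def split: if_splits)
  qed
  then obtain g where g: "ecoeff g = G" using ecoeff_surj[of G] G_nonneg by metis
  \<comment> \<open>This power of \<open>Var i\<close> satisfies all pairs that contain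
    \<open>i\<close>; for the remaining pairs goodness of \<open>{i}\<close> gives the
    inequality.\<close>
  define n where "n = Max (range a)"
  have n: "a V \<le> n" for V by (simp add: n_def)
  have loc: "Var i ^ n * (Var l * w i - Var i ^ N * g) \<in> tI a" for i
    unfolding tI_ecoeff
  proof (intro allI impI)
    fix v V assume v: "ecoeff (Var i ^ n * (Var l * w i - Var i ^ N * g)) v \<noteq> 0" and V: "card (V :: 4 set) = 2"
    define u where "u = v(i := v i - int n - int N)"
    have eq: "v(i := v i - int n, l := (v(i := v i - int n)) l - 1) = (pr u)(i := pr u i + int N)"
      by (auto simp: pr_def u_def fun_eq_iff)
    have "ecoeff (Var i ^ n * (Var l * w i - Var i ^ N * g)) v = \<phi> i (pr u) - G u"
      unfolding ecoeff_Var_pow ecoeff_diff ecoeff_Var eq \<phi>_def g by (simp add: u_def)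
    with v have ne: "\<phi> i (pr u) \<noteq> G u" by simp
    then have gd: "good a u {i}" using G by metis
    show "int (a V) \<le> sum v V"
    proof (cases "i \<in> V")
      case False
      then have "sum v V = sum u V" by (intro sum.cong) (auto simp: u_def)
      then show ?thesis using gd V False by (simp add: good_def)
    next
      case True
      have "0 \<le> u i + int N"
        using ne G_nonneg[of u i] \<phi>_nz[of i "pr u" i] by (fastforce simp: pr_def split: if_splits)
      then have "int n \<le> v i" by (simp add: u_def)
      moreover have "0 \<le> sum v (V - {i})"
        using gd by (intro sum_nonneg) (auto simp: good_def u_def)
      ultimately show ?thesis using True n[of V] by (simp add: sum.remove[of V i])
    qed
  qed
  have "Var l * z - y1 * g \<in> tI a"
    unfolding tI_def
  proof clarify
    fix V :: "4 set" assume V: "card V = 2"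
    then have "V \<noteq> UNIV" by auto
    \<comment> \<open>The line of \<open>V\<close> meets the chart of any \<open>i\<close> outside
      \<open>V\<close>, and there the power of \<open>Var i\<close> can be cancelled.\<close>
    then obtain i where i: "i \<notin> V" by blast
    have "Var i ^ (n + N) * (Var l * z - y1 * g)
      = Var i ^ n * Var l * (Var i ^ N * z - y1 * w i) + y1 * (Var i ^ n * (Var l * w i - Var i ^ N * g))"
      by (simp add: algebra_simps power_add)
    also have "\<dots> \<in> tI a" by (intro tI_add tI_mult_left w loc)
    finally have "Var i ^ (n + N) * (Var l * z - y1 * g) \<in> wideal (pind V) (a V)"
      using V by (simp add: tI_def)
    moreover have "Var i ^ (n + N) \<notin> wideal (pind V) 1"
      using i by (simp add: Var_pow_in_wideal pind_def)
    ultimately show "Var l * z - y1 * g \<in> wideal (pind V) (a V)"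
      by (rule wideal_cancel[rotated])
  qed
  then show ?thesis ..
qed

text \<open>With \<open>X i = Var i ^ n\<close> for large \<open>n\<close>, the elementary symmetric polynomials \<open>y2\<close> and \<open>y1\<close> of
  degree one and two in the \<open>X i\<close> are parameters annihilating the first cohomology, and \<open>z\<close> is \<open>y1\<close> times the section
  that equals the monomial with exponent \<open>u\<close> on one pair of opposite lines and \<open>0\<close> elsewhere.\<close>

lemma adjacent_gaps_obstruction:
  assumes g: "gap a W u" and g': "gap a W (u(i := u i + 1))"
  obtains y1 y2 z :: "'k::field poly4" and N where
    "y1 \<in> wideal (pind UNIV) 1" "y2 \<in> wideal (pind UNIV) 1"
    "\<And>k. \<exists>f g. Var k ^ N - (f * y1 + g * y2) \<in> tI a"
    "\<exists>f. z * y2 - f * y1 \<in> tI a"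
    "\<And>s f. s \<notin> wideal (pind UNIV) 1 \<Longrightarrow> s * (Var i * z) - f * y1 \<notin> tI a"
proof -
  have W: "card W = 2" using g by (simp add: gap_def)
  obtain p q where pq: "W = {p, q}" "p \<noteq> q" using W by (auto simp: card_2_iff)
  obtain r s where rs: "- W = {r, s}" "r \<noteq> s" using card_Compl_2[OF W] by (auto simp: card_2_iff)
  have "{p, q} \<inter> {r, s} = {}" and univ: "{p, q} \<union> {r, s} = UNIV" using pq rs by blast+
  then have d: "p \<noteq> r" "p \<noteq> s" "q \<noteq> r" "q \<noteq> s" by blast+
  \<comment> \<open>At least every exponent, so that \<open>X k\<close> lies in the ideal of each
    line whose pair contains \<open>k\<close>; the summand 1 makes it positive, so that
    \<open>X k\<close> lies in the maximal ideal.\<close>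
  define n where "n = Max (range a) + 1"
  have n: "a V \<le> n" for V by (simp add: n_def le_Suc_eq)
  have n0: "0 < n" by (simp add: n_def)
  define X :: "4 \<Rightarrow> 'k poly4" where "X i = Var i ^ n" for i
  have X_in: "X k \<in> wideal (pind V) (a V)" if "k \<in> V" for k V
    using that n by (simp add: X_def Var_pow_in_wideal pind_def)
  have X_m: "X k \<in> wideal (pind UNIV) 1" for k
    using n0 by (simp add: X_def Var_pow_in_wideal pind_def)
  have meet: "k \<in> V \<or> l \<in> V \<or> m \<in> V"
    if "card V = 2" "k \<noteq> l" "k \<noteq> m" "l \<noteq> m" for V and k l m :: 4
  proof (rule ccontr)
    assume "\<not> (k \<in> V \<or> l \<in> V \<or> m \<in> V)"
    then have "{k, l, m} \<subseteq> - V" by auto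
    then have "card {k, l, m} \<le> card (- V)" by (intro card_mono) auto
    then show False using that card_Compl_2[OF that(1)] by simp
  qed
  have trip: "X k * X l * X m \<in> tI a" if "k \<noteq> l" "k \<noteq> m" "l \<noteq> m" for k l m
    unfolding tI_def
  proof clarify
    fix V :: "4 set" assume "card V = 2"
    from meet[OF this that] show "X k * X l * X m \<in> wideal (pind V) (a V)"
    proof (elim disjE)
      assume "k \<in> V"
      then have "(X l * X m) * X k \<in> wideal (pind V) (a V)" by (intro wideal_mult_left X_in)
      then show ?thesis by (simp add: algebra_simps)
    next
      assume "l \<in> V"
      then have "(X k * X m) * X l \<in> wideal (pind V) (a V)" by (intro wideal_mult_left X_in)
      then show ?thesis by (simp add: algebra_simps)
    next
      assume "m \<in> V"
      then show ?thesis by (intro wideal_mult_left X_in)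
    qed
  qed
  define U :: "'k poly4" where "U = single (mk u) 1"
  have u0: "0 \<le> u k" for k using g by (simp add: gap_def)
  have wt_u: "int (wt (pind V) (mk u)) = sum u V" for V
    using u0 by (simp add: wt_pind)
  \<comment> \<open>A pair that avoids both \<open>k\<close> and \<open>l\<close> is neither
    \<open>W\<close> nor \<open>- W\<close>, and for such pairs \<open>U\<close> itself lies in the
    ideal.\<close>
  have mixed: "U * (X k * X l) \<in> tI a" if kl: "k \<in> W" "l \<in> - W" for k l
    unfolding tI_def
  proof clarify
    fix V :: "4 set" assume V: "card V = 2"
    consider "k \<in> V" | "l \<in> V" | "V \<noteq> W" "V \<noteq> - W" using kl by blast
    then show "U * (X k * X l) \<in> wideal (pind V) (a V)"
    proof cases
      case 1
      then have "(U * X l) * X k \<in> wideal (pind V) (a V)" by (intro wideal_mult_left X_in)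
      then show ?thesis by (simp add: algebra_simps)
    next
      case 2
      then have "(U * X k) * X l \<in> wideal (pind V) (a V)" by (intro wideal_mult_left X_in)
      then show ?thesis by (simp add: algebra_simps)
    next
      case 3
      then have "int (a V) \<le> sum u V" using g V by (simp add: gap_def)
      then have "U \<in> wideal (pind V) (a V)"
        unfolding wt_u[symmetric] by (simp add: U_def wideal_def)
      then have "(X k * X l) * U \<in> wideal (pind V) (a V)" by (rule wideal_mult_left)
      then show ?thesis by (simp add: algebra_simps)
    qed
  qed
  define y2 where "y2 = X p + X q + X r + X s"
  define y1 where "y1 = X p * X q + X p * X r + X p * X s + X q * X r + X q * X s + X r * X s"
  \<comment> \<open>On the line of \<open>- W\<close> the polynomial \<open>y1\<close> reduces to
    \<open>X p * X q\<close>, so \<open>z\<close> is \<open>U * y1\<close> there; on the line of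
    \<open>W\<close> it is zero.\<close>
  define z where "z = U * (X p * X q)"
  show ?thesis
  proof (rule that)
    show "y1 \<in> wideal (pind UNIV) 1" "y2 \<in> wideal (pind UNIV) 1"
      unfolding y1_def y2_def by (intro wideal_add wideal_mult_left X_m)+
    \<comment> \<open>Evaluate the product of all \<open>T - X i\<close> at \<open>T = X k\<close>
      and divide by \<open>X k\<close>: what remains of the cube are the triple products containing
      \<open>X k\<close>, which lie in the ideal.\<close>
    show "\<exists>f g. Var k ^ (n * 3) - (f * y1 + g * y2) \<in> tI a" for k
    proof -
      have *: "Var k ^ (n * 3) = X k * X k * X k"
        by (simp add: X_def power_mult power3_eq_cube)
      note t = tI_add[OF tI_add, OF trip trip trip]
      have k: "k \<in> {p, q, r, s}" using univ by auto
      have "Var k ^ (n * 3) - ((- X k) * y1 + (X k * X k) * y2) \<in> tI a"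
        using k
      proof (elim insertE emptyE)
        assume "k = p"
        then have "Var k ^ (n * 3) - ((- X k) * y1 + (X k * X k) * y2)
          = X p * X q * X r + X p * X q * X s + X p * X r * X s"
          unfolding * y1_def y2_def by (simp add: algebra_simps)
        then show ?thesis using d pq(2) rs(2) t[of p q r p q s p r s] by simp
      next
        assume "k = q"
        then have "Var k ^ (n * 3) - ((- X k) * y1 + (X k * X k) * y2)
          = X q * X p * X r + X q * X p * X s + X q * X r * X s"
          unfolding * y1_def y2_def by (simp add: algebra_simps)
        then show ?thesis using d pq(2) rs(2) t[of q p r q p s q r s] by simp
      next
        assume "k = r"
        then have "Var k ^ (n * 3) - ((- X k) * y1 + (X k * X k) * y2)
          = X p * X q * X r + X p * X r * X s + X q * X r * X s"
          unfolding * y1_def y2_def by (simp add: algebra_simps)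
        then show ?thesis using d pq(2) rs(2) t[of p q r p r s q r s] by simp
      next
        assume "k = s"
        then have "Var k ^ (n * 3) - ((- X k) * y1 + (X k * X k) * y2)
          = X p * X q * X s + X p * X r * X s + X q * X r * X s"
          unfolding * y1_def y2_def by (simp add: algebra_simps)
        then show ?thesis using d pq(2) rs(2) t[of p q s p r s q r s] by simp
      qed
      then show ?thesis by blast
    qed
    \<comment> \<open>After multiplication by \<open>U\<close> the mixed products lie in the ideal,
      so \<open>z * y2\<close> and \<open>U * (X p + X q) * y1\<close> both reduce to
      \<open>U * X p * X q * (X p + X q)\<close>.\<close>
    show "\<exists>f. z * y2 - f * y1 \<in> tI a"
    proof
      define A where "A = U * (X p * X r)"
      define B where "B = U * (X p * X s)"
      define C where "C = U * (X q * X r)"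
      define D where "D = U * (X q * X s)"
      have in_I: "A \<in> tI a" "B \<in> tI a" "C \<in> tI a" "D \<in> tI a"
        unfolding A_def B_def C_def D_def by (rule mixed; use pq rs in simp)+
      have "z * y2 - (U * (X p + X q)) * y1
        = (X q * A + X q * B) - ((X p + X q) * (A + B + C + D) + X s * A + X s * C)"
        unfolding z_def y1_def y2_def A_def B_def C_def D_def by (simp add: algebra_simps)
      also have "\<dots> \<in> tI a" by (intro tI_diff tI_add tI_mult_left in_I)
      finally show "z * y2 - (U * (X p + X q)) * y1 \<in> tI a" .
    qed
    show "c * (Var i * z) - f * y1 \<notin> tI a" if c: "c \<notin> wideal (pind UNIV) 1" for c f
    proof
      assume I: "c * (Var i * z) - f * y1 \<in> tI a"
      define v where "v = mk u + single i 1"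
      define M :: "'k poly4" where "M = single v 1"
      have M: "Var i * U = M" by (simp add: M_def U_def Var_def mult_single v_def add.commute)
      have wt_v: "int (wt (pind V) v) = sum (u(i := u i + 1)) V" for V
        unfolding sum_upd_add v_def wt_add by (simp add: wt_u wt_single pind_def)
      have wW: "wt (pind W) v < a W" "wt (pind (- W)) v < a (- W)"
        using g' by (auto simp: gap_def wt_v simp flip: of_nat_less_iff[where 'a = int])
      \<comment> \<open>Restricting the relation to the line of \<open>W\<close> kills
        \<open>z\<close> and leaves \<open>X r * X s * f\<close>; restricting it to that of
        \<open>- W\<close> leaves \<open>X p * X q * (c * M - f)\<close>. Both inequalities fail at
        \<open>v\<close>, so the coefficients there of \<open>f\<close> and of \<open>c * M\<close>
        vanish, and with them the constant term of \<open>c\<close>.\<close>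
      have "X r * X s * f \<in> wideal (pind W) (a W)"
      proof -
        have "X r * X s * f = c * M * (X q * X p) - f * ((X q + X r + X s) * X p + (X r + X s) * X q)
            - (c * (Var i * z) - f * y1)"
          unfolding M[symmetric] z_def y1_def by (simp add: algebra_simps)
        also have "\<dots> \<in> wideal (pind W) (a W)"
        proof (rule wideal_diff, rule wideal_diff)
          have "p \<in> W" "q \<in> W" using pq by auto
          then show "c * M * (X q * X p) \<in> wideal (pind W) (a W)"
            "f * ((X q + X r + X s) * X p + (X r + X s) * X q) \<in> wideal (pind W) (a W)"
            by (blast intro: wideal_mult_left wideal_add X_in)+
          show "c * (Var i * z) - f * y1 \<in> wideal (pind W) (a W)" using I W by (simp add: tI_def)
        qed
        finally show ?thesis .
      qed
      moreover have "X k \<notin> wideal (pind V) 1" if "k \<notin> V" for k V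
        using that by (simp add: X_def Var_pow_in_wideal pind_def)
      then have "X k * h \<in> wideal (pind V) d \<Longrightarrow> h \<in> wideal (pind V) d" if "k \<notin> V" for k V h d
        using that wideal_cancel by blast
      note X_cancel = this
      ultimately have "f \<in> wideal (pind W) (a W)"
        using X_cancel[of r W "X s * f"] X_cancel[of s W f] d pq by (simp add: mult.assoc)
      then have fv: "lookup f v = 0" using wW by (intro wideal_lookup)
      have "X p * (X q * (c * M - f)) \<in> wideal (pind (- W)) (a (- W))"
      proof -
        have "X p * (X q * (c * M - f))
          = f * ((X p + X q + X s) * X r + (X p + X q) * X s) + (c * (Var i * z) - f * y1)"
          unfolding M[symmetric] z_def y1_def by (simp add: algebra_simps)
        also have "\<dots> \<in> wideal (pind (- W)) (a (- W))"
        proof (rule wideal_add)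
          have "r \<in> - W" "s \<in> - W" using rs by auto
          then show "f * ((X p + X q + X s) * X r + (X p + X q) * X s) \<in> wideal (pind (- W)) (a (- W))"
            by (blast intro: wideal_mult_left wideal_add X_in)
          show "c * (Var i * z) - f * y1 \<in> wideal (pind (- W)) (a (- W))"
            using I card_Compl_2[OF W] by (simp add: tI_def)
        qed
        finally show ?thesis .
      qed
      then have "c * M - f \<in> wideal (pind (- W)) (a (- W))"
        using X_cancel[of q "- W" "c * M - f"] X_cancel[of p "- W" "X q * (c * M - f)"] pq by simp
      then have "lookup (c * M - f) v = 0" using wW by (intro wideal_lookup)
      moreover have "lookup (M * c) (v + 0) = lookup c 0"
        unfolding M_def by (subst lookup_single_mult) simp
      ultimately have "lookup c 0 = 0" using fv by (simp add: lookup_minus mult.commute)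
      moreover have "lookup c 0 \<noteq> 0"
      proof -
        obtain m where "m \<in> keys c" "wt (pind UNIV) m = 0"
          using c by (auto simp: wideal_def)
        moreover from this(2) have "m = 0"
          unfolding wt_pind by (intro poly_mapping_eqI) simp
        ultimately show ?thesis by (simp add: in_keys_iff)
      qed
      ultimately show False by simp
    qed
  qed
qed

section \<open>Chains of primes containing the ideal\<close>

text \<open>Gaussian elimination: a vector \<open>x0\<close> with nonzero entry at \<open>b\<close>
  is the pivot that clears coordinate \<open>b\<close> from the others, after which \<open>A\<close>
  and \<open>B\<close> have each lost an element.\<close>

lemma linear_dependence:
  fixes M :: "'a \<Rightarrow> 'b \<Rightarrow> 'k::field"
  assumes "finite B" "finite A" "card B < card A"
  shows "\<exists>c. (\<exists>x\<in>A. c x \<noteq> 0) \<and> (\<forall>b\<in>B. (\<Sum>x\<in>A. c x * M x b) = 0)"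
  using assms
proof (induction B arbitrary: A M rule: finite_induct)
  case empty
  then obtain x where "x \<in> A" by fastforce
  then show ?case by (intro exI[of _ "\<lambda>_. 1"]) auto
next
  case (insert b B)
  show ?case
  proof (cases "\<exists>x\<in>A. M x b \<noteq> 0")
    case False
    have "card B < card A" using insert by simp
    from insert.IH[OF \<open>finite A\<close> this, of M] show ?thesis using False by auto
  next
    case True
    then obtain x0 where x0: "x0 \<in> A" "M x0 b \<noteq> 0" by blast
    define M' where "M' x y = M x y - M x b / M x0 b * M x0 y" for x y
    have "card B < card (A - {x0})" using insert x0 by simp
    from insert.IH[OF _ this, of M'] obtain c
      where c: "\<exists>x\<in>A - {x0}. c x \<noteq> 0" "\<And>y. y \<in> B \<Longrightarrow> (\<Sum>x\<in>A - {x0}. c x * M' x y) = 0"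
      using insert by auto
    define e where "e = - (\<Sum>x\<in>A - {x0}. c x * M x b / M x0 b)"
    define c' where "c' = c(x0 := e)"
    have split: "(\<Sum>x\<in>A. c' x * M x y) = e * M x0 y + (\<Sum>x\<in>A - {x0}. c x * M x y)" for y
    proof -
      have "(\<Sum>x\<in>A. c' x * M x y) = c' x0 * M x0 y + (\<Sum>x\<in>A - {x0}. c' x * M x y)"
        using insert x0 by (simp add: sum.remove)
      also have "(\<Sum>x\<in>A - {x0}. c' x * M x y) = (\<Sum>x\<in>A - {x0}. c x * M x y)"
        by (intro sum.cong) (auto simp: c'_def)
      finally show ?thesis by (simp add: c'_def)
    qed
    have eq: "(\<Sum>x\<in>A. c' x * M x y) = (\<Sum>x\<in>A - {x0}. c x * M' x y)" for y
      unfolding split e_def M'_def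
      by (simp add: sum_distrib_left sum_subtractf algebra_simps)
    have "(\<Sum>x\<in>A. c' x * M x b) = 0" unfolding eq M'_def using x0 by simp
    then have "\<forall>y\<in>insert b B. (\<Sum>x\<in>A. c' x * M x y) = 0" using c(2) eq by auto
    moreover have "\<exists>x\<in>A. c' x \<noteq> 0" using c(1) by (auto simp: c'_def)
    ultimately show ?thesis by blast
  qed
qed

section \<open>Monomials outside the ideal and algebraic dependence\<close>

definition degree_le :: "nat \<Rightarrow> 'k::field poly4 \<Rightarrow> bool" where
  "degree_le D f \<longleftrightarrow> (\<forall>m\<in>keys f. wt (\<lambda>_. 1) m \<le> D)"

lemma degree_le_mult: "degree_le D f \<Longrightarrow> degree_le E g \<Longrightarrow> degree_le (D + E) (f * g)"
  unfolding degree_le_def by (auto elim!: keysE_mult simp: wt_add add_mono)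

lemma degree_le_power: "degree_le D f \<Longrightarrow> degree_le (n * D) (f ^ n)"
  by (induction n) (auto simp: degree_le_mult, simp add: degree_le_def)

lemma degree_le_mono: "degree_le D f \<Longrightarrow> D \<le> E \<Longrightarrow> degree_le E f"
  unfolding degree_le_def by (meson order_trans)

lemma degree_le_ex: "\<exists>D. degree_le D f"
  unfolding degree_le_def by (rule exI[of _ "Max (wt (\<lambda>_. 1) ` keys f)"]) auto

text \<open>Outside the ideal some pair \<open>W\<close> has both exponents below \<open>n\<close>,
  and the other two are at most \<open>N\<close>. The factor 16 bounds the number of pairs crudely
  by the number of all subsets of the four points.\<close>

lemma card_standard_monomials:
  assumes a: "\<And>W. a W \<le> n"
  shows "finite {m. wt (\<lambda>_. 1) m \<le> N \<and> (\<exists>W. card W = 2 \<and> wt (pind W) m < a W)}"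
    and "card {m. wt (\<lambda>_. 1) m \<le> N \<and> (\<exists>W. card W = 2 \<and> wt (pind W) m < a W)} \<le> 16 * (n\<^sup>2 * (N + 1)\<^sup>2)"
proof -
  let ?B = "{m. wt (\<lambda>_. 1) m \<le> N \<and> (\<exists>W. card W = 2 \<and> wt (pind W) m < a W)}"
  define S where "S W k = (if k \<in> W then {..<n} else {..N})" for W :: "4 set" and k
  define C where "C W = {m :: 4 \<Rightarrow>\<^sub>0 nat. \<forall>k. lookup m k \<in> S W k}" for W
  have inj: "inj_on lookup (C W)" for W
    by (auto simp: inj_on_def poly_mapping_eqI)
  have sub: "lookup ` C W \<subseteq> PiE UNIV (S W)" for W
    by (auto simp: C_def PiE_def)
  have fin: "finite (PiE UNIV (S W))" for W by (rule finite_PiE) (auto simp: S_def)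
  have finC: "finite (C W)" for W using finite_imageD[OF finite_subset[OF sub fin] inj] .
  have cardC: "card (C W) \<le> n\<^sup>2 * (N + 1)\<^sup>2" if "card W = 2" for W
  proof -
    have "card (C W) = card (lookup ` C W)" using inj by (simp add: card_image)
    also have "\<dots> \<le> card (PiE UNIV (S W))" by (rule card_mono[OF fin sub])
    also have "\<dots> = (\<Prod>k\<in>UNIV. card (S W k))" by (simp add: card_PiE)
    also have "\<dots> = (\<Prod>k\<in>UNIV. if k \<in> W then n else N + 1)" by (intro prod.cong) (auto simp: S_def)
    also have "\<dots> = n ^ card W * (N + 1) ^ card (- W)"
      by (simp add: prod.If_cases Collect_neg_eq)
    finally show ?thesis using that card_Compl_2[OF that] by simp
  qed
  have BC: "?B \<subseteq> (\<Union>W\<in>{W. card W = 2}. C W)"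
  proof clarify
    fix m and W :: "4 set" assume m: "wt (\<lambda>_. 1) m \<le> N" and W: "card W = 2" "wt (pind W) m < a W"
    have "lookup m k \<in> S W k" for k
    proof (cases "k \<in> W")
      case True
      then have "lookup m k \<le> wt (pind W) m" unfolding wt_pind by (intro member_le_sum) auto
      then show ?thesis using W a[of W] True by (simp add: S_def)
    next
      case False
      have "lookup m k \<le> wt (\<lambda>_. 1) m"
        unfolding wt_def by (simp, intro member_le_sum) auto
      then show ?thesis using m False by (simp add: S_def)
    qed
    then show "m \<in> (\<Union>W\<in>{W. card W = 2}. C W)" using W by (auto simp: C_def)
  qed
  have finU: "finite (\<Union>W\<in>{W. card W = 2}. C W)" using finC by auto
  show "finite ?B" using finite_subset[OF BC finU] .
  have "card ?B \<le> card (\<Union>W\<in>{W. card W = 2}. C W)" by (rule card_mono[OF finU BC])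
  also have "\<dots> \<le> (\<Sum>W\<in>{W. card W = 2}. card (C W))" by (rule card_UN_le) simp
  also have "\<dots> \<le> (\<Sum>W\<in>{W :: 4 set. card W = 2}. n\<^sup>2 * (N + 1)\<^sup>2)" using cardC by (intro sum_mono) blast
  also have "\<dots> = card {W :: 4 set. card W = 2} * (n\<^sup>2 * (N + 1)\<^sup>2)" by simp
  also have "card {W :: 4 set. card W = 2} \<le> card (Pow (UNIV :: 4 set))" by (intro card_mono) auto
  also have "card (Pow (UNIV :: 4 set)) = 16" by (simp add: card_Pow)
  finally show "card ?B \<le> 16 * (n\<^sup>2 * (N + 1)\<^sup>2)" by simp
qed

text \<open>The monomials outside the ideal grow only quadratically with the degree, so that the cubically
  many monomials in three polynomials are linearly dependent modulo the ideal.\<close>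

lemma algebraic_dependence:
  fixes f0 f1 f2 :: "'k::field poly4"
  obtains E :: nat and c :: "nat \<Rightarrow> nat \<Rightarrow> nat \<Rightarrow> 'k" where
    "\<exists>k<E. \<exists>l<E. \<exists>m<E. c k l m \<noteq> 0"
    "(\<Sum>k<E. f0 ^ k * (\<Sum>l<E. f1 ^ l * (\<Sum>m<E. f2 ^ m * single 0 (c k l m)))) \<in> tI a"
proof -
  obtain D0 D1 D2 where "degree_le D0 f0" "degree_le D1 f1" "degree_le D2 f2" using degree_le_ex by metis
  then obtain D where D: "degree_le D f0" "degree_le D f1" "degree_le D f2"
    using degree_le_mono[of _ _ "D0 + D1 + D2"] by (metis le_add1 le_add2 trans_le_add1)
  define n where "n = Max (range a)"
  have n: "a W \<le> n" for W by (simp add: n_def)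
  \<comment> \<open>The choice makes \<open>E ^ 3\<close> exceed the number of monomials outside the
    ideal: since \<open>N + 1 \<le> (3 * D + 1) * E\<close>, that number is at most
    \<open>(E - 1) * E ^ 2\<close>.\<close>
  define E where "E = 16 * n\<^sup>2 * (3 * D + 1)\<^sup>2 + 1"
  define N where "N = 3 * (E * D)"
  define B where "B = {m. wt (\<lambda>_. 1) m \<le> N \<and> (\<exists>W. card W = 2 \<and> wt (pind W) m < a W)}"
  define A where "A = {..<E} \<times> {..<E} \<times> {..<E}"
  define F where "F = (\<lambda>(k, l, m). f0 ^ k * (f1 ^ l * f2 ^ m))"
  have "N + 1 \<le> (3 * D + 1) * E" by (simp add: N_def E_def algebra_simps)
  then have "(N + 1)\<^sup>2 \<le> ((3 * D + 1) * E)\<^sup>2" by (rule power_mono) simp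
  then have "16 * (n\<^sup>2 * (N + 1)\<^sup>2) \<le> 16 * (n\<^sup>2 * ((3 * D + 1) * E)\<^sup>2)" by simp
  also have "\<dots> = (16 * n\<^sup>2 * (3 * D + 1)\<^sup>2) * E\<^sup>2" unfolding power_mult_distrib by (simp only: mult_ac)
  also have "\<dots> < E * E\<^sup>2" by (intro mult_strict_right_mono) (simp_all add: E_def)
  also have "\<dots> = card A" by (simp add: A_def card_cartesian_product power2_eq_square)
  finally have "card B < card A" using card_standard_monomials(2)[of a n N, OF n] by (simp add: B_def)
  moreover have "finite B" unfolding B_def by (rule card_standard_monomials(1)[of a n N, OF n])
  ultimately obtain c where c: "\<exists>x\<in>A. c x \<noteq> 0"
    "\<And>b. b \<in> B \<Longrightarrow> (\<Sum>x\<in>A. c x * lookup (F x) b) = 0"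
    using linear_dependence[of B A "\<lambda>x b. lookup (F x) b"] by (auto simp: A_def)
  define P where "P = (\<Sum>x\<in>A. single 0 (c x) * F x)"
  have lookup_P: "lookup P b = (\<Sum>x\<in>A. c x * lookup (F x) b)" for b
  proof -
    have "lookup (single 0 d * g) b = d * lookup g b"
      for d and g :: "'k poly4" using lookup_single_mult[of 0 d g b] by simp
    then show ?thesis unfolding P_def lookup_sum by simp
  qed
  have "P \<in> tI a"
    unfolding tI_def wideal_def
  proof clarify
    fix W m assume W: "card (W :: 4 set) = 2" and m: "m \<in> keys P"
    have "degree_le N (F x)" if "x \<in> A" for x
    proof -
      obtain k l m where x: "x = (k, l, m)" by (cases x)
      have "k * D \<le> E * D" "l * D \<le> E * D" "m * D \<le> E * D" using that by (auto simp: A_def x)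
      then have "k * D + (l * D + m * D) \<le> N" unfolding N_def by linarith
      moreover have "degree_le (k * D + (l * D + m * D)) (F x)"
        unfolding F_def x by (auto intro: degree_le_mult degree_le_power D)
      ultimately show ?thesis by (rule degree_le_mono[rotated])
    qed
    moreover have "\<exists>x\<in>A. m \<in> keys (F x)"
    proof (rule ccontr)
      assume "\<not> ?thesis"
      then have "lookup P m = 0"
        unfolding lookup_P by (intro sum.neutral) (auto simp: in_keys_iff)
      with m show False by (simp add: in_keys_iff)
    qed
    ultimately have "wt (\<lambda>_. 1) m \<le> N" by (auto simp: degree_le_def)
    then have "\<not> wt (pind W) m < a W" using c(2)[of m] W m by (auto simp: B_def in_keys_iff lookup_P)
    then show "a W \<le> wt (pind W) m" by simp
  qed
  \<comment> \<open>Nested by powers of \<open>f0\<close>, then \<open>f1\<close>, then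
    \<open>f2\<close>, the relation can be taken apart one polynomial at a time along a chain of
    primes.\<close>
  moreover have "P = (\<Sum>k<E. f0 ^ k * (\<Sum>l<E. f1 ^ l * (\<Sum>m<E. f2 ^ m * single 0 (c (k, l, m)))))"
    unfolding P_def A_def F_def
    by (simp add: sum.cartesian_product' sum_distrib_left algebra_simps)
  moreover have "\<exists>k<E. \<exists>l<E. \<exists>m<E. c (k, l, m) \<noteq> 0" using c(1) by (auto simp: A_def)
  ultimately show ?thesis using that[of E "\<lambda>k l m. c (k, l, m)"] by simp
qed

definition prime_set :: "'k::field poly4 set \<Rightarrow> bool" where
  "prime_set P \<longleftrightarrow> 1 \<notin> P \<and> (\<forall>f\<in>P. \<forall>g\<in>P. f + g \<in> P) \<and> (\<forall>f\<in>P. \<forall>g. g * f \<in> P) \<and>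
     (\<forall>f g. f * g \<in> P \<longrightarrow> f \<in> P \<or> g \<in> P)"

lemma prime_set_power: "prime_set P \<Longrightarrow> f ^ n \<in> P \<Longrightarrow> f \<in> P"
proof (induction n)
  case (Suc n)
  then have "f \<in> P \<or> f ^ n \<in> P" unfolding prime_set_def power_Suc by blast
  with Suc show ?case by blast
qed (simp add: prime_set_def)

text \<open>Below \<open>k0\<close> nothing remains, so \<open>f ^ k0\<close> factors out; the prime
  \<open>P\<close> does not contain it, and the cofactor differs from \<open>g k0\<close> by a
  multiple of \<open>f\<close>, which lies in \<open>Q\<close>.\<close>

lemma least_coefficient:
  assumes P: "prime_set P" and Q: "prime_set Q" and PQ: "P \<subseteq> Q" and f: "f \<notin> P" "f \<in> Q"
    and sum: "(\<Sum>k<E. f ^ k * g k) \<in> P" and k0: "k0 < E" "\<And>k. k < k0 \<Longrightarrow> g k = 0"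
  shows "g k0 \<in> Q"
proof -
  define h where "h = (\<Sum>k\<in>{k0<..<E}. f ^ (k - k0 - 1) * g k)"
  have "(\<Sum>k<E. f ^ k * g k) = (\<Sum>k\<in>insert k0 {k0<..<E}. f ^ k * g k)"
    using k0 by (intro sum.mono_neutral_right) (auto simp: not_less)
  also have "\<dots> = f ^ k0 * g k0 + (\<Sum>k\<in>{k0<..<E}. f ^ k * g k)" by simp
  also have "(\<Sum>k\<in>{k0<..<E}. f ^ k * g k) = (\<Sum>k\<in>{k0<..<E}. f ^ k0 * f * (f ^ (k - k0 - 1) * g k))"
  proof (intro sum.cong refl)
    fix k assume "k \<in> {k0<..<E}"
    then have "k = k0 + 1 + (k - k0 - 1)" by auto
    then have "f ^ k = f ^ k0 * f * f ^ (k - k0 - 1)"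
      by (metis power_add power_one_right)
    then show "f ^ k * g k = f ^ k0 * f * (f ^ (k - k0 - 1) * g k)" by (simp add: mult.assoc)
  qed
  also have "f ^ k0 * g k0 + \<dots> = f ^ k0 * (g k0 + h * f)"
    by (simp add: h_def algebra_simps sum_distrib_left)
  finally have "f ^ k0 * (g k0 + h * f) \<in> P" using sum by simp
  moreover have "f ^ k0 \<notin> P" using prime_set_power[OF P] f by blast
  ultimately have "g k0 + h * f \<in> Q" using P PQ unfolding prime_set_def by blast
  moreover have "(- h) * f \<in> Q" using Q f unfolding prime_set_def by blast
  ultimately have "(g k0 + h * f) + (- h) * f \<in> Q" using Q unfolding prime_set_def by blast
  then show ?thesis by simp
qed

text \<open>Elements \<open>f0\<close>, \<open>f1\<close>, \<open>f2\<close> of the successive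
  differences satisfy a relation modulo the ideal. Its lexicographically least nonzero coefficient
  is isolated by passing through \<open>P1\<close>, \<open>P2\<close> and \<open>P3\<close>, so
  \<open>P3\<close> would contain a nonzero constant.\<close>

lemma no_prime_chain:
  fixes P0 P1 P2 P3 :: "'k::field poly4 set"
  assumes pr: "prime_set P0" "prime_set P1" "prime_set P2" "prime_set P3"
    and sub: "tI a \<subseteq> P0" and chain: "P0 \<subset> P1" "P1 \<subset> P2" "P2 \<subset> P3"
  shows False
proof -
  obtain f0 f1 f2 where f: "f0 \<in> P1" "f0 \<notin> P0" "f1 \<in> P2" "f1 \<notin> P1" "f2 \<in> P3" "f2 \<notin> P2"
    using chain by blast
  obtain E c where c: "\<exists>k<E. \<exists>l<E. \<exists>m<E. c k l m \<noteq> (0::'k)"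
    and dep: "(\<Sum>k<E. f0 ^ k * (\<Sum>l<E. f1 ^ l * (\<Sum>m<E. f2 ^ m * single 0 (c k l m)))) \<in> tI a"
    by (rule algebraic_dependence)
  define k where "k = (LEAST k. k < E \<and> (\<exists>l<E. \<exists>m<E. c k l m \<noteq> 0))"
  have k: "k < E" "\<exists>l<E. \<exists>m<E. c k l m \<noteq> 0" and k': "\<And>j. j < k \<Longrightarrow> \<not> (j < E \<and> (\<exists>l<E. \<exists>m<E. c j l m \<noteq> 0))"
    using LeastI_ex[of "\<lambda>k. k < E \<and> (\<exists>l<E. \<exists>m<E. c k l m \<noteq> 0)"] c not_less_Least
    unfolding k_def by blast+
  define l where "l = (LEAST l. l < E \<and> (\<exists>m<E. c k l m \<noteq> 0))"
  have l: "l < E" "\<exists>m<E. c k l m \<noteq> 0" and l': "\<And>j. j < l \<Longrightarrow> \<not> (j < E \<and> (\<exists>m<E. c k j m \<noteq> 0))"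
    using LeastI_ex[of "\<lambda>l. l < E \<and> (\<exists>m<E. c k l m \<noteq> 0)"] k not_less_Least
    unfolding l_def by blast+
  define m where "m = (LEAST m. m < E \<and> c k l m \<noteq> 0)"
  have m: "m < E" "c k l m \<noteq> 0" and m': "\<And>j. j < m \<Longrightarrow> \<not> (j < E \<and> c k l j \<noteq> 0)"
    using LeastI_ex[of "\<lambda>m. m < E \<and> c k l m \<noteq> 0"] l not_less_Least
    unfolding m_def by blast+
  have "(\<Sum>l<E. f1 ^ l * (\<Sum>m<E. f2 ^ m * single 0 (c k l m))) \<in> P1"
    by (rule least_coefficient[OF pr(1,2) _ f(2,1) subsetD[OF sub dep] k(1)])
      (use chain k' k in \<open>auto intro!: sum.neutral\<close>)
  then have "(\<Sum>m<E. f2 ^ m * single 0 (c k l m)) \<in> P2"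
    by (rule least_coefficient[OF pr(2,3) _ f(4,3) _ l(1), rotated])
      (use chain l' l in \<open>auto intro!: sum.neutral\<close>)
  then have "single 0 (c k l m) \<in> P3"
    by (rule least_coefficient[OF pr(3,4) _ f(6,5) _ m(1), rotated])
      (use chain m' m in auto)
  then have "single 0 (inverse (c k l m)) * single 0 (c k l m) \<in> P3"
    using pr(4) unfolding prime_set_def by blast
  then show False using m pr(4) by (simp add: mult_single prime_set_def)
qed

section \<open>The local coordinate ring\<close>

abbreviation mm :: "'k::field poly4 set" where
  "mm \<equiv> wideal (pind UNIV) 1"

lemma mm_mult: "f \<notin> mm \<Longrightarrow> g \<notin> mm \<Longrightarrow> f * g \<notin> mm"
  using wideal_cancel by blast

lemma one_notin_wideal: "(1 :: 'k::field poly4) \<notin> wideal w (Suc d)"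
  by (simp add: wideal_def)

lemma wideal_pind_mm: "wideal (pind V) 1 \<subseteq> mm"
  by (rule wideal_pind_subset) simp

lemma wideal_prime: "prime_set (wideal (pind V) 1)"
  unfolding prime_set_def using wideal_cancel
  by (auto simp: one_notin_wideal intro: wideal_add wideal_mult_left)

lemma tI_cancel_unit: "g \<notin> mm \<Longrightarrow> g * f \<in> tI a \<Longrightarrow> f \<in> tI a"
  using tI_cancel[of a g f] wideal_pind_mm by blast

lemma tI_subset: "card V = 2 \<Longrightarrow> 0 < a V \<Longrightarrow> tI a \<subseteq> wideal (pind V) 1"
  unfolding tI_def using wideal_mono[of 1 "a V" "pind V"] by auto

lemma tI_trivial: "(\<And>V. card V = 2 \<Longrightarrow> a V = 0) \<Longrightarrow> tI a = UNIV"
  by (simp add: tI_def wideal_zero_exp)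

text \<open>This keeps of the local coordinate ring what the ring argument uses: every element is a
  polynomial divided by a unit, and \<open>T\<close> has kernel \<open>tI a\<close>. Statements
  about elements thereby become statements about polynomials with a multiplier outside
  \<open>mm\<close>.\<close>

locale local_quotient = cring A for A (structure) +
  fixes T :: "'k::field poly4 \<Rightarrow> 'a" and a :: "4 set \<Rightarrow> nat"
  assumes T_hom: "T \<in> ring_hom R4 A"
    and frac: "Y \<in> carrier A \<Longrightarrow> \<exists>f g. g \<notin> mm \<and> T g \<otimes> Y = T f"
    and T_unit: "g \<notin> mm \<Longrightarrow> T g \<in> Units A"
    and T_zero_iff: "T f = \<zero> \<longleftrightarrow> f \<in> tI a"
begin

lemma T_closed [simp]: "T f \<in> carrier A"
  using T_hom by (auto simp: ring_hom_def)

lemma T_add: "T (f + g) = T f \<oplus> T g"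
  using T_hom by (auto simp: ring_hom_def)

lemma T_mult: "T (f * g) = T f \<otimes> T g"
  using T_hom by (auto simp: ring_hom_def)

lemma T_one: "T 1 = \<one>"
  using T_hom by (auto simp: ring_hom_def)

lemma T_0: "T 0 = \<zero>"
  by (simp add: T_zero_iff)

lemma T_eq_iff: "T f = T g \<longleftrightarrow> f - g \<in> tI a"
proof -
  have "T f = T (f - g) \<oplus> T g" by (simp flip: T_add)
  then show ?thesis using add.right_cancel[of "T g" "T (f - g)" \<zero>] T_zero_iff by auto
qed

lemma T_pow: "T (f ^ n) = T f [^] n"
  by (induction n) (simp_all add: T_one T_mult nat_pow_Suc2 mult.commute m_comm)

lemma cancel_unit:
  assumes Q: "ideal Q A" and g: "g \<notin> mm" and X: "X \<in> carrier A" and "T g \<otimes> X \<in> Q"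
  shows "X \<in> Q"
proof -
  have u: "T g \<in> Units A" using T_unit[OF g] .
  have "inv T g \<otimes> (T g \<otimes> X) \<in> Q"
    using ideal.I_l_closed[OF Q assms(4), of "inv T g"] u by simp
  moreover have "inv T g \<otimes> (T g \<otimes> X) = X"
    using u X by (simp add: m_assoc[symmetric])
  ultimately show ?thesis by simp
qed

text \<open>The extension of an ideal to the localisation, with denominators moved to the other side
  so that no fractions appear.\<close>

definition extend :: "'k poly4 set \<Rightarrow> 'a set" where
  "extend J = {X \<in> carrier A. \<exists>s h. s \<notin> mm \<and> h \<in> J \<and> T s \<otimes> X = T h}"

lemma T_in_extend: "f \<in> J \<Longrightarrow> T f \<in> extend J"
  unfolding extend_def using one_notin_wideal[of "pind UNIV" 0]
  by (intro CollectI conjI exI[of _ 1] exI[of _ f]) (simp_all add: T_one)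

lemma extend_ideal:
  assumes J: "ideal J R4"
  shows "ideal (extend J) A"
proof (rule idealI)
  show "ring A" by (rule ring_axioms)
  have l: "X \<otimes> Y \<in> extend J" if Y: "Y \<in> extend J" and X: "X \<in> carrier A" for X Y
  proof -
    obtain s h where s: "s \<notin> mm" "h \<in> J" "T s \<otimes> Y = T h" and Yc: "Y \<in> carrier A"
      using Y unfolding extend_def by auto
    obtain f g where g: "g \<notin> mm" "T g \<otimes> X = T f" using frac[OF X] by auto
    have "T (g * s) \<otimes> (X \<otimes> Y) = (T g \<otimes> X) \<otimes> (T s \<otimes> Y)"
      using X Yc by (simp add: T_mult m_ac)
    also have "\<dots> = T (f * h)" using s g by (simp add: T_mult)
    finally have "T (g * s) \<otimes> (X \<otimes> Y) = T (f * h)" .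
    moreover have "f * h \<in> J" using J s unfolding R4_ideal_iff by blast
    moreover have "g * s \<notin> mm" using mm_mult g s by blast
    ultimately show ?thesis unfolding extend_def using X Yc by blast
  qed
  show "subgroup (extend J) (add_monoid A)"
  proof (rule add.subgroupI)
    show "extend J \<subseteq> carrier A" by (auto simp: extend_def)
    show "extend J \<noteq> {}" using T_in_extend J unfolding R4_ideal_iff by blast
    show "\<ominus> X \<in> extend J" if X: "X \<in> extend J" for X
    proof -
      have "X \<in> carrier A" using X by (auto simp: extend_def)
      then have "(\<ominus> \<one>) \<otimes> X = \<ominus> X" by (simp add: l_minus)
      with l[OF X, of "\<ominus> \<one>"] show ?thesis by simp
    qed
    show "X \<oplus> Y \<in> extend J" if X: "X \<in> extend J" and Y: "Y \<in> extend J" for X Y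
    proof -
      obtain s h where s: "s \<notin> mm" "h \<in> J" "T s \<otimes> X = T h" and Xc: "X \<in> carrier A"
        using X unfolding extend_def by auto
      obtain s' h' where s': "s' \<notin> mm" "h' \<in> J" "T s' \<otimes> Y = T h'" and Yc: "Y \<in> carrier A"
        using Y unfolding extend_def by auto
      have "T (s * s') \<otimes> (X \<oplus> Y) = T s' \<otimes> (T s \<otimes> X) \<oplus> T s \<otimes> (T s' \<otimes> Y)"
        using Xc Yc by (simp add: T_mult r_distr m_ac)
      also have "\<dots> = T (s' * h + s * h')" using s s' by (simp add: T_mult T_add)
      finally have "T (s * s') \<otimes> (X \<oplus> Y) = T (s' * h + s * h')" .
      moreover have "s' * h + s * h' \<in> J" using J s s' unfolding R4_ideal_iff by blast
      moreover have "s * s' \<notin> mm" using mm_mult s s' by blast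
      ultimately show ?thesis unfolding extend_def using Xc Yc by blast
    qed
  qed
  show "X \<otimes> Y \<in> extend J" if "Y \<in> extend J" "X \<in> carrier A" for X Y using l[OF that] .
  show "Y \<otimes> X \<in> extend J" if "Y \<in> extend J" "X \<in> carrier A" for X Y
  proof -
    have "Y \<in> carrier A" using that by (auto simp: extend_def)
    then show ?thesis using l[OF that] that by (simp add: m_comm)
  qed
qed

text \<open>Clearing denominators multiplies numerators by elements outside \<open>mm\<close>;
  membership in a prime contained in \<open>mm\<close> is unaffected by this, so any numerator
  decides it.\<close>

lemma extend_prime_iff:
  assumes J: "prime_set J" "J \<subseteq> mm" "tI a \<subseteq> J" and X: "X \<in> carrier A"
    and g: "g \<notin> mm" "T g \<otimes> X = T f"
  shows "X \<in> extend J \<longleftrightarrow> f \<in> J"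
proof
  assume "X \<in> extend J"
  then obtain s h where s: "s \<notin> mm" "h \<in> J" "T s \<otimes> X = T h" unfolding extend_def by auto
  have "T (s * f) = T s \<otimes> (T g \<otimes> X)" using g by (simp add: T_mult)
  also have "\<dots> = T g \<otimes> (T s \<otimes> X)" using X by (simp add: m_ac)
  also have "\<dots> = T (g * h)" using s by (simp add: T_mult)
  finally have "s * f - g * h \<in> J" using J(3) T_eq_iff by auto
  moreover have "g * h \<in> J" using J(1) s unfolding prime_set_def by blast
  ultimately have "(s * f - g * h) + g * h \<in> J" using J(1) unfolding prime_set_def by blast
  then have "s * f \<in> J" by simp
  then show "f \<in> J" using J(1,2) s(1) unfolding prime_set_def by blast
qed (use g X in \<open>auto simp: extend_def\<close>)

lemma extend_primeideal:
  assumes "tI a \<subseteq> (wideal (pind V) 1 :: 'k poly4 set)"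
  shows "primeideal (extend (wideal (pind V) 1)) A"
proof (rule primeidealI)
  note iff = extend_prime_iff[OF wideal_prime wideal_pind_mm assms]
  show "ideal (extend (wideal (pind V) 1)) A" by (rule extend_ideal[OF wideal_ideal])
  show "cring A" by (rule is_cring)
  show "carrier A \<noteq> extend (wideal (pind V) 1)"
    using iff[of \<one> 1 1] one_notin_wideal[of _ 0] by (auto simp: T_one)
  show "X \<in> extend (wideal (pind V) 1) \<or> Y \<in> extend (wideal (pind V) 1)"
    if XY: "X \<in> carrier A" "Y \<in> carrier A" "X \<otimes> Y \<in> extend (wideal (pind V) 1)" for X Y
  proof -
    obtain f g where g: "g \<notin> mm" "T g \<otimes> X = T f" using frac[OF XY(1)] by auto
    obtain f' g' where g': "g' \<notin> mm" "T g' \<otimes> Y = T f'" using frac[OF XY(2)] by auto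
    have "T (g * g') \<otimes> (X \<otimes> Y) = (T g \<otimes> X) \<otimes> (T g' \<otimes> Y)"
      using XY by (simp add: T_mult m_ac)
    then have "T (g * g') \<otimes> (X \<otimes> Y) = T (f * f')" using g g' by (simp add: T_mult)
    then have "f * f' \<in> wideal (pind V) 1"
      using iff[of "X \<otimes> Y" "g * g'" "f * f'"] XY mm_mult[OF g(1) g'(1)] by simp
    then have "f \<in> wideal (pind V) 1 \<or> f' \<in> wideal (pind V) 1"
      using wideal_prime[of V] unfolding prime_set_def by blast
    then show ?thesis using iff XY g g' by blast
  qed
qed

lemma extend_strict:
  assumes "tI a \<subseteq> (wideal (pind V) 1 :: 'k poly4 set)" "V \<subset> V'"
  shows "extend (wideal (pind V) 1) \<subset> extend (wideal (pind V') 1)"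
proof -
  have sub: "wideal (pind V) 1 \<subseteq> wideal (pind V') 1" using assms(2) by (intro wideal_pind_subset) auto
  obtain k where k: "k \<in> V'" "k \<notin> V" using assms(2) by blast
  have "Var k \<in> wideal (pind V') 1" "Var k \<notin> wideal (pind V) 1"
    using k by (simp_all add: Var_in_wideal pind_def)
  then have "T (Var k) \<in> extend (wideal (pind V') 1)" "T (Var k) \<notin> extend (wideal (pind V) 1)"
    using extend_prime_iff[OF wideal_prime wideal_pind_mm assms(1), of "T (Var k)" 1 "Var k"]
      one_notin_wideal[of _ 0] T_in_extend by (auto simp: T_one)
  moreover have "extend (wideal (pind V) 1) \<subseteq> extend (wideal (pind V') 1)"
    using sub unfolding extend_def by blast
  ultimately show ?thesis by blast
qed

section \<open>Contraction of primes, the dimension and the maximal ideal\<close>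

definition contract :: "'a set \<Rightarrow> 'k poly4 set" where
  "contract Q = {f. T f \<in> Q}"

lemma contract_prime:
  assumes "primeideal Q A"
  shows "prime_set (contract Q)" "tI a \<subseteq> contract Q"
proof -
  interpret Q: primeideal Q A by fact
  show "prime_set (contract Q)"
    unfolding prime_set_def contract_def
    using Q.I_notcarr Q.one_imp_carrier Q.I_prime Q.I_l_closed
      additive_subgroup.a_closed[OF Q.additive_subgroup_axioms]
    by (auto simp: T_one T_add T_mult)
  show "tI a \<subseteq> contract Q"
    using additive_subgroup.zero_closed[OF Q.additive_subgroup_axioms] T_zero_iff
    unfolding contract_def by (metis mem_Collect_eq subsetI)
qed

lemma contract_strict:
  assumes "ideal Q A" "ideal Q' A" "Q \<subset> Q'"
  shows "contract Q \<subset> contract Q'"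
proof -
  obtain X where X: "X \<in> Q'" "X \<notin> Q" using assms by blast
  then have Xc: "X \<in> carrier A" using ideal.Icarr[OF assms(2)] by blast
  obtain f g where g: "g \<notin> mm" "T g \<otimes> X = T f" using frac[OF Xc] by auto
  have "T f \<in> Q'" using ideal.I_l_closed[OF assms(2) X(1), of "T g"] g by simp
  moreover have "T f \<notin> Q" using cancel_unit[OF assms(1) g(1) Xc] g X by auto
  ultimately show ?thesis using assms(3) unfolding contract_def by blast
qed

text \<open>Four primes in a chain would contract to a chain excluded by
  \<open>no_prime_chain\<close>. For the lower bound there are the primes of a line with positive
  exponent and of a coordinate point on it, and the maximal ideal.\<close>

lemma krull_dim_2:
  assumes "card W = 2" "0 < a W"
  shows "krull_dim A = 2"
proof (rule antisym)
  show "krull_dim A \<le> 2" unfolding krull_dim_def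
  proof (rule SUP_least, clarify)
    fix Ps assume Ps: "Ps \<noteq> []" "prime_chain A Ps"
    have "length Ps < 4"
    proof (rule ccontr)
      assume "\<not> length Ps < 4"
      then have len: "3 < length Ps" by simp
      have pr: "primeideal (Ps ! i) A" if "i \<le> 3" for i
        using Ps that len by (auto simp: prime_chain_def)
      have ch: "Ps ! i \<subset> Ps ! Suc i" if "i < 3" for i
        using Ps that len unfolding prime_chain_def by (auto simp: sorted_wrt_iff_nth_less)
      have str: "contract (Ps ! i) \<subset> contract (Ps ! Suc i)" if "i < 3" for i
        using that by (intro contract_strict ch primeideal.axioms(1) pr) auto
      show False
        by (rule no_prime_chain[of "contract (Ps ! 0)" "contract (Ps ! Suc 0)"
              "contract (Ps ! Suc (Suc 0))" "contract (Ps ! Suc (Suc (Suc 0)))" a])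
          (auto intro!: contract_prime pr str)
    qed
    then have "length Ps - 1 \<le> 2" by simp
    then show "enat (length Ps - 1) \<le> 2" by (metis enat_ord_simps(1) numeral_eq_enat)
  qed
  have "W \<noteq> UNIV" using assms by auto
  then obtain k where k: "k \<notin> W" by blast
  let ?V = "insert k W"
  have "card ?V = 3" using assms k by simp
  have V: "?V \<noteq> UNIV"
  proof
    assume e: "?V = UNIV"
    have "card ?V = 4" unfolding e by simp
    with \<open>card ?V = 3\<close> show False by simp
  qed
  let ?Ps = "[extend (wideal (pind W) 1), extend (wideal (pind ?V) 1), extend mm]"
  have sub: "tI a \<subseteq> wideal (pind V') 1" if "W \<subseteq> V'" for V'
    using tI_subset[of W a] assms wideal_pind_subset[OF that] by blast
  have pr: "primeideal (extend (wideal (pind V') 1)) A" if "W \<subseteq> V'" for V'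
    by (rule extend_primeideal[OF sub[OF that]])
  have 1: "extend (wideal (pind W) 1) \<subset> extend (wideal (pind ?V) 1)"
    using k by (intro extend_strict sub) auto
  have 2: "extend (wideal (pind ?V) 1) \<subset> extend mm"
    using V by (intro extend_strict sub) auto
  have "prime_chain A ?Ps"
    unfolding prime_chain_def
    using pr[of W] pr[of ?V] pr[of UNIV] 1 2 psubset_trans[OF 1 2]
    by (simp del: One_nat_def add: subset_insertI)
  then have "?Ps \<in> {Ps. Ps \<noteq> [] \<and> prime_chain A Ps}" by blast
  from SUP_upper[OF this, of "\<lambda>Ps. enat (length Ps - 1)"]
  have "enat 2 \<le> krull_dim A" unfolding krull_dim_def by (simp add: numeral_2_eq_2)
  then show "2 \<le> krull_dim A" by (simp add: numeral_eq_enat)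
qed

lemma extend_mm_maximal:
  assumes "tI a \<subseteq> (mm :: 'k poly4 set)"
  shows "maximalideal (extend mm) A"
proof (rule maximalidealI)
  show "ideal (extend mm) A" by (rule extend_ideal[OF wideal_ideal])
  show "carrier A \<noteq> extend mm"
    using primeideal.I_notcarr[OF extend_primeideal[of UNIV]] assms by simp
  fix J assume J: "ideal J A" "extend mm \<subseteq> J" "J \<subseteq> carrier A"
  show "J = extend mm \<or> J = carrier A"
  proof (rule disjCI)
    assume "J \<noteq> carrier A"
    have "X \<in> extend mm" if X: "X \<in> J" for X
    proof (rule ccontr)
      assume n: "X \<notin> extend mm"
      have Xc: "X \<in> carrier A" using J X by blast
      obtain f g where g: "g \<notin> mm" "T g \<otimes> X = T f" using frac[OF Xc] by auto
      have f: "f \<notin> mm" using n g Xc unfolding extend_def by blast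
      have "T g \<otimes> X \<in> J" using ideal.I_l_closed[OF J(1) X, of "T g"] by simp
      then have "T f \<otimes> \<one> \<in> J" using g by simp
      then have "\<one> \<in> J" using cancel_unit[OF J(1) f one_closed] by blast
      then show False using ideal.one_imp_carrier[OF J(1)] \<open>J \<noteq> carrier A\<close> by simp
    qed
    then show "J = extend mm" using J by blast
  qed
qed

lemma maximalideal_eq:
  assumes M: "maximalideal M A" and sub: "tI a \<subseteq> (mm :: 'k poly4 set)"
  shows "M = extend mm"
proof -
  interpret M: maximalideal M A by fact
  have "M \<subseteq> extend mm"
  proof
    fix X assume X: "X \<in> M"
    have Xc: "X \<in> carrier A" using X by (rule M.Icarr)
    obtain f g where g: "g \<notin> mm" "T g \<otimes> X = T f" using frac[OF Xc] by auto
    have "f \<in> mm"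
    proof (rule ccontr)
      assume f: "f \<notin> mm"
      have "T f \<otimes> \<one> \<in> M" using g M.I_l_closed[OF X, of "T g"] by simp
      then have "\<one> \<in> M" using cancel_unit[OF M.ideal_axioms f one_closed] by blast
      then show False using M.one_imp_carrier M.I_notcarr by simp
    qed
    then show "X \<in> extend mm" using g Xc unfolding extend_def by blast
  qed
  moreover have "extend mm \<subseteq> carrier A" by (auto simp: extend_def)
  ultimately have "extend mm = M \<or> extend mm = carrier A"
    using M.I_maximal[OF extend_ideal[OF wideal_ideal]] by blast
  then show ?thesis using maximalideal.I_notcarr[OF extend_mm_maximal[OF sub]] by blast
qed

section \<open>Parameter ideals and the weak sequence condition\<close>

lemma pair_ideal: "ideal {f * y1 + g * y2 | f g. True} R4" for y1 y2 :: "'k poly4"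
  unfolding R4_ideal_iff
proof (intro conjI ballI allI)
  show "0 \<in> {f * y1 + g * y2 | f g. True}" by (auto intro!: exI[of _ 0])
  fix x assume "x \<in> {f * y1 + g * y2 | f g. True}"
  then obtain f g where x: "x = f * y1 + g * y2" by blast
  show "h * x \<in> {f * y1 + g * y2 | f g. True}" for h
  proof -
    have "h * x = (h * f) * y1 + (h * g) * y2" by (simp add: x algebra_simps)
    then show ?thesis by blast
  qed
  fix y assume "y \<in> {f * y1 + g * y2 | f g. True}"
  then obtain f' g' where y: "y = f' * y1 + g' * y2" by blast
  have "x + y = (f + f') * y1 + (g + g') * y2" by (simp add: x y algebra_simps)
  then show "x + y \<in> {f * y1 + g * y2 | f g. True}" by blast
qed

lemma Idl_pair:
  assumes Y: "Y1 \<in> carrier A" "Y2 \<in> carrier A"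
    and g: "g1 \<notin> mm" "T g1 \<otimes> Y1 = T y1" "g2 \<notin> mm" "T g2 \<otimes> Y2 = T y2"
  shows "Idl\<^bsub>A\<^esub> {Y1, Y2} = extend {f * y1 + g * y2 | f g. True}" (is "_ = extend ?J")
proof
  have "y1 \<in> ?J" "y2 \<in> ?J"
    using mult_1[of y1] mult_1[of y2] mult_zero_left add_0_left add_0_right by (metis (mono_tags, lifting) mem_Collect_eq)+
  then have "Y1 \<in> extend ?J" "Y2 \<in> extend ?J" unfolding extend_def using Y g by blast+
  then show "Idl\<^bsub>A\<^esub> {Y1, Y2} \<subseteq> extend ?J"
    by (intro genideal_minimal extend_ideal pair_ideal) auto
  have id: "ideal (Idl\<^bsub>A\<^esub> {Y1, Y2}) A" by (rule genideal_ideal) (use Y in auto)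
  have Y_in: "Y1 \<in> Idl\<^bsub>A\<^esub> {Y1, Y2}" "Y2 \<in> Idl\<^bsub>A\<^esub> {Y1, Y2}"
    using genideal_self[of "{Y1, Y2}"] Y by auto
  show "extend ?J \<subseteq> Idl\<^bsub>A\<^esub> {Y1, Y2}"
  proof
    fix X assume "X \<in> extend ?J"
    then obtain s f g where s: "s \<notin> mm" "T s \<otimes> X = T (f * y1 + g * y2)" and X: "X \<in> carrier A"
      unfolding extend_def by blast
    have "T y1 \<in> Idl\<^bsub>A\<^esub> {Y1, Y2}" "T y2 \<in> Idl\<^bsub>A\<^esub> {Y1, Y2}"
      using ideal.I_l_closed[OF id Y_in(1), of "T g1"] ideal.I_l_closed[OF id Y_in(2), of "T g2"] g by simp_all
    then have "T f \<otimes> T y1 \<oplus> T g \<otimes> T y2 \<in> Idl\<^bsub>A\<^esub> {Y1, Y2}"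
      using ideal.I_l_closed[OF id] additive_subgroup.a_closed[OF ideal.axioms(1)[OF id]] by simp
    then have "T s \<otimes> X \<in> Idl\<^bsub>A\<^esub> {Y1, Y2}" by (simp add: s T_mult T_add)
    then show "X \<in> Idl\<^bsub>A\<^esub> {Y1, Y2}" using cancel_unit[OF id s(1) X] by blast
  qed
qed

text \<open>The form with second generator zero lets \<open>T_in_extend_pair\<close> serve for one
  generator as well as for two.\<close>

lemma Idl_single:
  assumes Y: "Y1 \<in> carrier A" and g: "g1 \<notin> mm" "T g1 \<otimes> Y1 = T y1"
  shows "Idl\<^bsub>A\<^esub> {Y1} = extend {f * y1 + g * 0 | f g. True}"
proof -
  have "Idl\<^bsub>A\<^esub> {Y1, \<zero>} = extend {f * y1 + g * 0 | f g. True}"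
    by (rule Idl_pair[OF Y _ g, of _ 1]) (use one_notin_wideal[of "pind UNIV" 0] in \<open>auto simp: T_0 T_one\<close>)
  moreover have "Idl\<^bsub>A\<^esub> {Y1, \<zero>} = Idl\<^bsub>A\<^esub> {Y1}"
  proof
    have id: "ideal (Idl\<^bsub>A\<^esub> {Y1}) A" by (rule genideal_ideal) (use Y in auto)
    then show "Idl\<^bsub>A\<^esub> {Y1, \<zero>} \<subseteq> Idl\<^bsub>A\<^esub> {Y1}"
      using genideal_self[of "{Y1}"] Y additive_subgroup.zero_closed[OF ideal.axioms(1)[OF id]]
      by (intro genideal_minimal) auto
    show "Idl\<^bsub>A\<^esub> {Y1} \<subseteq> Idl\<^bsub>A\<^esub> {Y1, \<zero>}" by (rule subset_Idl_subset) (use Y in auto)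
  qed
  ultimately show ?thesis by simp
qed

lemma T_in_extend_pair:
  "T x \<in> extend {f * y1 + g * y2 | f g. True} \<longleftrightarrow> (\<exists>s f g. s \<notin> mm \<and> s * x - (f * y1 + g * y2) \<in> tI a)"
  unfolding extend_def by (auto simp: T_eq_iff simp flip: T_mult)

text \<open>The polynomials \<open>y1\<close>, \<open>y2\<close> of
  \<open>adjacent_gaps_obstruction\<close> give a system of parameters, since powers of all
  variables lie in their ideal, and \<open>z\<close> violates the weak sequence condition at the
  second entry.\<close>

lemma no_adjacent_gaps_if_buchsbaum:
  assumes W: "card W = 2" "0 < a W" and bb: "buchsbaum_local A"
  shows "no_adjacent_gaps a"
  unfolding no_adjacent_gaps_def
proof (intro allI impI notI)
  fix V u i assume g: "gap a V u" "gap a V (u(i := u i + 1))"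
  obtain y1 y2 z :: "'k poly4" and N where
    y: "y1 \<in> mm" "y2 \<in> mm"
    and N: "\<And>k. \<exists>f g. Var k ^ N - (f * y1 + g * y2) \<in> tI a"
    and zy: "\<exists>f. z * y2 - f * y1 \<in> tI a"
    and no: "\<And>s f. s \<notin> mm \<Longrightarrow> s * (Var i * z) - f * y1 \<notin> tI a"
    by (rule adjacent_gaps_obstruction[OF g]) blast
  have 1: "(1 :: 'k poly4) \<notin> mm" by (rule one_notin_wideal[of _ 0, simplified One_nat_def[symmetric]])
  have sub: "tI a \<subseteq> (mm :: 'k poly4 set)" using tI_subset[of W a, OF W] wideal_pind_mm by blast
  let ?J = "{f * y1 + g * y2 | f g. True}"
  have Idl2: "Idl\<^bsub>A\<^esub> {T y1, T y2} = extend ?J"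
    by (rule Idl_pair[OF _ _ 1 _ 1]) (simp_all add: T_one)
  have Idl1: "Idl\<^bsub>A\<^esub> {T y1} = extend {f * y1 + g * 0 | f g. True}"
    by (rule Idl_single[OF _ 1]) (simp_all add: T_one)
  \<comment> \<open>Pigeonhole: a monomial of degree at least \<open>4 * N\<close> in four variables
    has an exponent of at least \<open>N\<close>.\<close>
  have power_in: "f ^ (4 * N) \<in> {h. T h \<in> extend ?J}" if f: "f \<in> mm" for f
  proof (rule sum_singles_closed)
    have id: "ideal (extend ?J) A" by (rule extend_ideal[OF pair_ideal])
    show "0 \<in> {h. T h \<in> extend ?J}"
      using additive_subgroup.zero_closed[OF ideal.axioms(1)[OF id]] by (simp add: T_0)
    show "g + h \<in> {h. T h \<in> extend ?J}"
      if "g \<in> {h. T h \<in> extend ?J}" "h \<in> {h. T h \<in> extend ?J}" for g h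
      using that additive_subgroup.a_closed[OF ideal.axioms(1)[OF id]] by (simp add: T_add)
    fix m assume m: "m \<in> keys (f ^ (4 * N))"
    have "f ^ n \<in> wideal (pind UNIV) n" for n
      by (induction n) (use f wideal_mult[of f _ 1] in \<open>auto simp: wideal_zero_exp\<close>)
    then have "4 * N \<le> wt (pind UNIV) m" using m by (auto simp: wideal_def)
    then have "4 * N \<le> (\<Sum>k\<in>UNIV. lookup m k)" by (simp add: wt_pind)
    moreover have "\<exists>k. N \<le> lookup m k"
    proof (cases "N = 0")
      case False
      show ?thesis
      proof (rule ccontr)
        assume "\<not> ?thesis"
        then have "(\<Sum>k\<in>UNIV. lookup m k) < (\<Sum>k\<in>(UNIV :: 4 set). N)"
          by (intro sum_strict_mono) (auto simp: not_le)
        with calculation show False by simp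
      qed
    qed simp
    then obtain k where "N \<le> lookup m k" by blast
    then have "Var k ^ N dvd single m (lookup (f ^ (4 * N)) m)"
      using m by (intro Var_power_dvd) (auto simp: in_keys_iff)
    then obtain h where h: "single m (lookup (f ^ (4 * N)) m) = Var k ^ N * h"
      by (auto simp: dvd_def)
    have "T (Var k ^ N) \<in> extend ?J"
      unfolding T_in_extend_pair using N[of k] 1 by (metis mult_1)
    then have "T (h * Var k ^ N) \<in> extend ?J"
      using ideal.I_l_closed[OF id] by (simp add: T_mult)
    then show "single m (lookup (f ^ (4 * N)) m) \<in> {h. T h \<in> extend ?J}"
      unfolding h by (simp add: mult.commute)
  qed
  have sop: "system_of_parameters A (extend mm) [T y1, T y2]"
    unfolding system_of_parameters_def
  proof (intro conjI ballI)
    show "set [T y1, T y2] \<subseteq> extend mm" using y T_in_extend by simp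
    show "enat (length [T y1, T y2]) = krull_dim A"
      using krull_dim_2[OF W] by (simp add: numeral_eq_enat numeral_2_eq_2)
    fix Y assume Y: "Y \<in> extend mm"
    then obtain g f where g: "g \<notin> mm" "f \<in> mm" "T g \<otimes> Y = T f" and Yc: "Y \<in> carrier A"
      unfolding extend_def by blast
    have "T (g ^ (4 * N)) \<otimes> Y [^] (4 * N) = (T g \<otimes> Y) [^] (4 * N)"
      using Yc by (simp add: T_pow nat_pow_distrib)
    also have "\<dots> = T (f ^ (4 * N))" by (simp only: g T_pow)
    finally have "T (g ^ (4 * N)) \<otimes> Y [^] (4 * N) \<in> extend ?J"
      using power_in[OF g(2)] by simp
    then have "Y [^] (4 * N) \<in> extend ?J"
      using cancel_unit[OF extend_ideal[OF pair_ideal] wideal_power[OF g(1)]] Yc by simp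
    then show "\<exists>n :: nat. Y [^] n \<in> Idl\<^bsub>A\<^esub> (set [T y1, T y2])" using Idl2 by auto
  qed
  have "weak_sequence A (extend mm) [T y1, T y2]"
    using bb extend_mm_maximal[OF sub] sop unfolding buchsbaum_local_def by blast
  then have "T z \<otimes> T y2 \<in> Idl\<^bsub>A\<^esub> {T y1} \<Longrightarrow> T (Var i) \<otimes> T z \<in> Idl\<^bsub>A\<^esub> {T y1}"
    using T_in_extend[of "Var i" mm]
    unfolding weak_sequence_def by (auto dest!: spec[of _ 1] simp: Var_in_wideal pind_def)
  moreover have "T z \<otimes> T y2 \<in> Idl\<^bsub>A\<^esub> {T y1}"
    unfolding Idl1 T_mult[symmetric] T_in_extend_pair using zy 1 by (metis mult_1 mult_zero_right add_0_right)
  ultimately have "T (Var i * z) \<in> extend {f * y1 + g * 0 | f g. True}"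
    using Idl1 by (simp add: T_mult)
  then show False unfolding T_in_extend_pair using no by auto
qed

text \<open>The first parameter is a nonzerodivisor because it avoids the line primes. For the
  second, \<open>z / y1\<close> becomes a section on every chart, and
  \<open>global_section_lift\<close> puts its multiples by the variables into the local
  ring.\<close>

lemma buchsbaum_if_no_adjacent_gaps:
  assumes W: "card W = 2" "0 < a W" and B: "no_adjacent_gaps a"
  shows "buchsbaum_local A"
  unfolding buchsbaum_local_def
proof (intro allI impI)
  fix M Ys assume M: "maximalideal M A" and sop: "system_of_parameters A M Ys"
  have sub: "tI a \<subseteq> (mm :: 'k poly4 set)" using tI_subset[of W a, OF W] wideal_pind_mm by blast
  have M_eq: "M = extend mm" by (rule maximalideal_eq[OF M sub])
  have "length Ys = 2"
    using sop krull_dim_2[OF W] unfolding system_of_parameters_def by (simp add: numeral_eq_enat)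
  then obtain Y1 Y2 where Ys: "Ys = [Y1, Y2]"
    by (metis (no_types, lifting) One_nat_def Suc_1 length_0_conv length_Suc_conv)
  have "Y1 \<in> extend mm" "Y2 \<in> extend mm"
    using sop unfolding system_of_parameters_def Ys M_eq by auto
  then obtain g1 y1 g2 y2 where g: "g1 \<notin> mm" "T g1 \<otimes> Y1 = T y1" "g2 \<notin> mm" "T g2 \<otimes> Y2 = T y2"
    and y: "y1 \<in> mm" "y2 \<in> mm" and Yc: "Y1 \<in> carrier A" "Y2 \<in> carrier A"
    unfolding extend_def by blast
  have "\<exists>s n f h. s \<notin> mm \<and> s * Var k ^ n - (f * y1 + h * y2) \<in> tI a" for k
  proof -
    have "Var k \<in> (mm :: 'k poly4 set)" by (simp add: Var_in_wideal pind_def)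
    then have "T (Var k) \<in> M" unfolding M_eq by (rule T_in_extend)
    then obtain n :: nat where "T (Var k) [^] n \<in> Idl\<^bsub>A\<^esub> {Y1, Y2}"
      using sop unfolding system_of_parameters_def Ys by auto
    then show ?thesis
      unfolding Idl_pair[OF Yc g] T_pow[symmetric] T_in_extend_pair by blast
  qed
  then obtain s n f h where s: "\<And>k. s k \<notin> mm"
    and sn: "\<And>k. s k * Var k ^ n k - (f k * y1 + h k * y2) \<in> tI a" by metis
  have y1: "y1 \<notin> wideal (pind V) 1" if V: "card V = 2" "0 < a V" for V
  proof
    assume *: "y1 \<in> wideal (pind V) 1"
    obtain k l where kl: "- V = {k, l}" "k \<noteq> l" using card_Compl_2[OF V(1)] by (auto simp: card_2_iff)
    then have "k \<notin> V" "l \<notin> V" by auto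
    from line_prime_contains_no_parameter[OF V(1) kl(2) this * y(2) tI_subset[of V a, OF V] sn s sn s]
    show False .
  qed
  show "weak_sequence A M Ys"
    unfolding weak_sequence_def
  proof (intro allI impI ballI)
    fix i z x assume i: "i < length Ys" and z: "z \<in> carrier A"
      and zi: "z \<otimes> Ys ! i \<in> Idl\<^bsub>A\<^esub> (set (take i Ys))" and x: "x \<in> M"
    obtain g0 z0 where z0: "g0 \<notin> mm" "T g0 \<otimes> z = T z0" using frac[OF z] by blast
    obtain gx x0 where x0: "gx \<notin> mm" "x0 \<in> mm" "T gx \<otimes> x = T x0" and xc: "x \<in> carrier A"
      using x unfolding M_eq extend_def by blast
    consider "i = 0" | "i = 1" using i Ys by fastforce
    then show "x \<otimes> z \<in> Idl\<^bsub>A\<^esub> (set (take i Ys))"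
    proof cases
      case 1
      have "Idl\<^bsub>A\<^esub> {} \<subseteq> {\<zero>}" by (rule genideal_minimal[OF zeroideal]) simp
      then have "z \<otimes> Y1 = \<zero>" using zi 1 Ys by auto
      then have "T g0 \<otimes> T g1 \<otimes> (z \<otimes> Y1) = \<zero>" by simp
      then have "(T g0 \<otimes> z) \<otimes> (T g1 \<otimes> Y1) = \<zero>" using z Yc by (simp add: m_ac)
      then have "y1 * z0 \<in> tI a" by (simp add: z0 g T_zero_iff mult.commute flip: T_mult)
      then have "z0 \<in> tI a" using tI_cancel[OF y1] by blast
      then have "T g0 \<otimes> z \<in> {\<zero>}" using z0 T_zero_iff by simp
      then have "z = \<zero>" using cancel_unit[OF zeroideal z0(1) z] by simp
      moreover have "ideal (Idl\<^bsub>A\<^esub> {}) A" by (rule genideal_ideal) simp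
      ultimately show ?thesis using 1 xc additive_subgroup.zero_closed[OF ideal.axioms(1)] by auto
    next
      case 2
      let ?K = "extend {f * y1 + g * 0 | f g. True}"
      have idK: "ideal ?K A" by (rule extend_ideal[OF pair_ideal])
      have Idl1: "Idl\<^bsub>A\<^esub> (set (take i Ys)) = ?K" using 2 Ys Idl_single[OF Yc(1) g(1,2)] by simp
      have "T g2 \<otimes> T g0 \<otimes> (z \<otimes> Y2) \<in> ?K"
        using zi 2 Ys ideal.I_l_closed[OF idK] unfolding Idl1 by simp
      moreover have "T g2 \<otimes> T g0 \<otimes> (z \<otimes> Y2) = (T g0 \<otimes> z) \<otimes> (T g2 \<otimes> Y2)"
        using z Yc by (simp add: m_ac)
      ultimately have "T (z0 * y2) \<in> ?K" by (simp add: T_mult z0 g)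
      then obtain t p where t: "t \<notin> mm" "t * (z0 * y2) - p * y1 \<in> tI a"
        unfolding T_in_extend_pair by auto
      \<comment> \<open>One multiplier \<open>S\<close> and one exponent \<open>N\<close> serve all
        four charts; \<open>S\<close> stays outside \<open>mm\<close> because \<open>mm\<close> is
        prime.\<close>
      define S where "S = (\<Prod>k\<in>UNIV. s k)"
      have "(\<Prod>k\<in>B. s k) \<notin> mm" for B
        by (induction B rule: infinite_finite_induct)
          (use s mm_mult one_notin_wideal[of _ 0] in auto)
      then have S: "S \<notin> mm" by (simp add: S_def)
      define N where "N = Max (range n)"
      have "\<exists>w. Var k ^ N * (S * t * z0) - y1 * w \<in> tI a" for k
      proof -
        have "s k dvd S" unfolding S_def by (rule dvd_prodI) auto
        then obtain S' where S': "S = s k * S'" by (auto simp: dvd_def)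
        have "n k \<le> N" by (simp add: N_def)
        then have vN: "(Var k :: 'k poly4) ^ N = Var k ^ n k * Var k ^ (N - n k)" by (simp flip: power_add)
        \<comment> \<open>Multiply the relation for \<open>s k * Var k ^ n k\<close> by
          \<open>t * z0\<close> and replace \<open>t * z0 * y2\<close> by \<open>p * y1\<close>:
          modulo the ideal the result is a multiple of \<open>y1\<close>.\<close>
        have "Var k ^ N * (S * t * z0) - y1 * (Var k ^ (N - n k) * S' * (t * z0 * f k + h k * p))
          = (Var k ^ (N - n k) * S' * t * z0) * (s k * Var k ^ n k - (f k * y1 + h k * y2))
            + (Var k ^ (N - n k) * S' * h k) * (t * (z0 * y2) - p * y1)"
          unfolding S' vN by (simp add: algebra_simps)
        also have "\<dots> \<in> tI a" by (intro tI_add tI_mult_left sn t)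
        finally show ?thesis by blast
      qed
      then obtain w where w: "\<And>k. Var k ^ N * (S * t * z0) - y1 * w k \<in> tI a" by metis
      have lift: "T (Var l) \<otimes> T (S * t * z0) \<in> ?K" for l
      proof -
        obtain q where "Var l * (S * t * z0) - y1 * q \<in> tI a"
          using global_section_lift[OF B y1 w] by blast
        then have "1 * (Var l * (S * t * z0)) - (q * y1 + 0 * 0) \<in> tI a" by (simp add: mult.commute)
        then show ?thesis unfolding T_mult[symmetric] T_in_extend_pair
          using one_notin_wideal[of "pind UNIV" 0] by (metis One_nat_def)
      qed
      define Q where "Q = {q. T q \<otimes> T (S * t * z0) \<in> ?K}"
      have "ideal Q R4"
        unfolding R4_ideal_iff Q_def
        using additive_subgroup.zero_closed[OF ideal.axioms(1)[OF idK]]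
          additive_subgroup.a_closed[OF ideal.axioms(1)[OF idK]] ideal.I_l_closed[OF idK]
        by (auto simp: T_0 T_add T_mult l_distr m_assoc)
      moreover have "Var ` UNIV \<subseteq> Q" using lift by (auto simp: Q_def)
      ultimately have "mm \<subseteq> Q"
        using ring.genideal_minimal[OF cring.axioms(1)[OF R4_cring]] Idl_Var[of UNIV] by blast
      then have x0Q: "T x0 \<otimes> T (S * t * z0) \<in> ?K" using x0 by (auto simp: Q_def)
      have "T (gx * (S * t * g0)) \<otimes> (x \<otimes> z) = (T gx \<otimes> x) \<otimes> (T (S * t) \<otimes> (T g0 \<otimes> z))"
        using xc z by (simp add: T_mult m_ac)
      also have "\<dots> \<in> ?K" using x0Q by (simp add: x0 z0 T_mult m_assoc)
      finally have "x \<otimes> z \<in> ?K"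
        using cancel_unit[OF idK mm_mult[OF x0(1) mm_mult[OF mm_mult[OF S t(1)] z0(1)]]] xc z by simp
      then show ?thesis using Idl1 by simp
    qed
  qed
qed

end

lemma buchsbaum_local_trivial:
  assumes "ring A" "\<one>\<^bsub>A\<^esub> = \<zero>\<^bsub>A\<^esub>"
  shows "buchsbaum_local A"
  unfolding buchsbaum_local_def
proof (intro allI impI)
  fix M xs assume "maximalideal M A"
  then interpret M: maximalideal M A .
  have "\<one>\<^bsub>A\<^esub> \<in> M"
    using assms(2) additive_subgroup.zero_closed[OF M.additive_subgroup_axioms] by simp
  then have "M = carrier A" by (rule M.one_imp_carrier)
  then show "weak_sequence A M xs" using M.I_notcarr by simp
qed

lemma no_adjacent_gaps_trivial:
  assumes "\<And>W. card W = 2 \<Longrightarrow> a W = 0"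
  shows "no_adjacent_gaps a"
  unfolding no_adjacent_gaps_def
proof (intro allI impI)
  fix W u i assume g: "gap a W u"
  then have "0 \<le> sum u W" by (intro sum_nonneg) (simp add: gap_def)
  then show "\<not> gap a W (u(i := u i + 1))" using g assms[of W] by (simp add: gap_def)
qed

subsection \<open>Its construction as a quotient of a localisation\<close>

lemma local_R4_simps:
  "x \<otimes>\<^bsub>local_R4\<^esub> y = x * y" "\<one>\<^bsub>local_R4\<^esub> = 1" "\<zero>\<^bsub>local_R4\<^esub> = 0" "x \<oplus>\<^bsub>local_R4\<^esub> y = x + y"
  by (simp_all add: local_R4_def)

lemma local_R4_carrier: "carrier local_R4 = {Fract f g | f g. g \<notin> mm}"
  by (simp add: local_R4_def irrelevant_ideal_eq)

lemma notin_mm_nonzero: "g \<notin> mm \<Longrightarrow> g \<noteq> 0"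
  by auto

lemma one_notin_mm: "1 \<notin> mm"
  using one_notin_wideal[of _ 0] by simp

lemma Fract_in_local: "g \<notin> mm \<Longrightarrow> Fract f g \<in> carrier local_R4"
  unfolding local_R4_carrier by blast

lemma local_R4_cring: "cring (local_R4 :: 'k::field poly4 fract ring)"
proof -
  have add: "x + y \<in> carrier local_R4" and mult: "x * y \<in> carrier local_R4"
    if xy: "x \<in> carrier local_R4" "y \<in> carrier local_R4" for x y :: "'k poly4 fract"
  proof -
    obtain f g f' g' where *: "x = Fract f g" "g \<notin> mm" "y = Fract f' g'" "g' \<notin> mm"
      using xy unfolding local_R4_carrier by blast
    then show "x + y \<in> carrier local_R4" "x * y \<in> carrier local_R4"
      using mm_mult[of g g'] by (simp_all add: notin_mm_nonzero Fract_in_local)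
  qed
  have zero: "0 \<in> carrier local_R4" and one: "1 \<in> carrier local_R4"
    unfolding Zero_fract_def One_fract_def by (rule Fract_in_local[OF one_notin_mm])+
  show ?thesis
  proof (rule cringI)
    show "abelian_group (local_R4 :: 'k poly4 fract ring)"
    proof (rule abelian_groupI)
      fix x :: "'k poly4 fract" assume "x \<in> carrier local_R4"
      then obtain f g where "x = Fract f g" "g \<notin> mm" unfolding local_R4_carrier by blast
      then have "- x \<in> carrier local_R4" by (simp add: Fract_in_local)
      then show "\<exists>y\<in>carrier local_R4. y \<oplus>\<^bsub>local_R4\<^esub> x = \<zero>\<^bsub>local_R4\<^esub>"
        by (rule bexI[rotated]) (simp add: local_R4_simps)
    qed (use add zero in \<open>auto simp: local_R4_simps algebra_simps\<close>)
    show "Group.comm_monoid (local_R4 :: 'k poly4 fract ring)"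
      by (rule comm_monoidI) (use mult one in \<open>auto simp: local_R4_simps algebra_simps\<close>)
  qed (auto simp: local_R4_simps algebra_simps)
qed

abbreviation local_tI :: "(4 set \<Rightarrow> nat) \<Rightarrow> 'k::field poly4 fract set" where
  "local_tI a \<equiv> Idl\<^bsub>local_R4\<^esub> ((\<lambda>f. Fract f 1) ` tI a)"

lemma local_tI_ideal: "ideal (local_tI a) local_R4"
  by (rule ring.genideal_ideal[OF cring.axioms(1)[OF local_R4_cring]])
    (use Fract_in_local one_notin_mm in blast)

text \<open>The extended ideal consists of fractions with numerator in \<open>tI a\<close>; a
  denominator outside \<open>mm\<close> avoids all line primes, so it can be cancelled from a
  polynomial.\<close>

lemma Fract_in_local_tI: "Fract f 1 \<in> local_tI a \<longleftrightarrow> f \<in> tI a"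
proof
  interpret R: cring "local_R4 :: 'a poly4 fract ring" by (rule local_R4_cring)
  assume "f \<in> tI a"
  then show "Fract f 1 \<in> local_tI a"
    using R.genideal_self[of "(\<lambda>f. Fract f 1) ` tI a"] Fract_in_local[OF one_notin_mm] by blast
next
  interpret R: cring "local_R4 :: 'a poly4 fract ring" by (rule local_R4_cring)
  define K where "K = {Fract f g | f g. f \<in> tI a \<and> g \<notin> (mm :: 'a poly4 set)}"
  have "ideal K local_R4"
  proof (rule idealI)
    show "ring (local_R4 :: 'a poly4 fract ring)" by (rule R.ring_axioms)
    have l: "x * y \<in> K" if xy: "x \<in> carrier local_R4" "y \<in> K" for x y
    proof -
      obtain f g f' g' where *: "x = Fract f g" "g \<notin> mm" "y = Fract f' g'" "g' \<notin> mm" "f' \<in> tI a"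
        using xy unfolding local_R4_carrier K_def by blast
      then have "x * y = Fract (f * f') (g * g')" by simp
      then show ?thesis using mm_mult * tI_mult_left unfolding K_def by blast
    qed
    then show "x \<otimes>\<^bsub>local_R4\<^esub> y \<in> K" "y \<otimes>\<^bsub>local_R4\<^esub> x \<in> K" if "y \<in> K" "x \<in> carrier local_R4" for x y
      using that by (auto simp: local_R4_simps mult.commute)
    show "subgroup K (add_monoid local_R4)"
    proof (rule R.add.subgroupI)
      show "K \<subseteq> carrier local_R4" unfolding K_def local_R4_carrier by blast
      show "K \<noteq> {}" unfolding K_def using one_notin_mm tI_0 by blast
      fix x assume x: "x \<in> K"
      then have xc: "x \<in> carrier local_R4" unfolding K_def local_R4_carrier by blast
      have "\<ominus>\<^bsub>local_R4\<^esub> \<one>\<^bsub>local_R4\<^esub> \<otimes>\<^bsub>local_R4\<^esub> x = \<ominus>\<^bsub>local_R4\<^esub> x"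
        using xc by (simp add: R.l_minus)
      then show "\<ominus>\<^bsub>local_R4\<^esub> x \<in> K"
        using l[of "\<ominus>\<^bsub>local_R4\<^esub> \<one>\<^bsub>local_R4\<^esub>" x] x by (simp add: local_R4_simps(1))
      fix y assume y: "y \<in> K"
      obtain f g f' g' where *: "x = Fract f g" "g \<notin> mm" "f \<in> tI a" "y = Fract f' g'" "g' \<notin> mm" "f' \<in> tI a"
        using x y unfolding K_def by blast
      then have "x + y = Fract (f * g' + f' * g) (g * g')" by (simp add: notin_mm_nonzero)
      moreover have "f * g' + f' * g \<in> tI a" using * by (intro tI_add tI_mult_right)
      ultimately have "x + y \<in> K" using mm_mult[OF *(2,5)] unfolding K_def by blast
      then show "x \<oplus>\<^bsub>local_R4\<^esub> y \<in> K" by (simp add: local_R4_simps)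
    qed
  qed
  moreover have "(\<lambda>f. Fract f 1) ` tI a \<subseteq> K" unfolding K_def using one_notin_mm by blast
  ultimately have "local_tI a \<subseteq> K" by (rule R.genideal_minimal)
  moreover assume "Fract f 1 \<in> local_tI a"
  ultimately obtain f' g' where "Fract f 1 = Fract f' g'" "g' \<notin> mm" "f' \<in> tI a" unfolding K_def by blast
  then have "g' * f \<in> tI a" by (simp add: eq_fract notin_mm_nonzero mult.commute)
  then show "f \<in> tI a" using tI_cancel_unit \<open>g' \<notin> mm\<close> by blast
qed

lemma local_quotient_coordinate_ring:
  "local_quotient (local_coordinate_ring (tI a)) (\<lambda>f. local_tI a +>\<^bsub>local_R4\<^esub> Fract f 1) a"
proof -
  interpret R: cring "local_R4 :: 'a poly4 fract ring" by (rule local_R4_cring)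
  interpret J: ideal "local_tI a :: 'a poly4 fract set" local_R4 by (rule local_tI_ideal)
  let ?A = "local_coordinate_ring (tI a) :: 'a poly4 fract set ring"
  let ?\<pi> = "\<lambda>x. local_tI a +>\<^bsub>local_R4\<^esub> x"
  have A: "?A = local_R4 Quot local_tI a" by (simp add: local_coordinate_ring_def)
  have hom: "?\<pi> \<in> ring_hom local_R4 ?A" unfolding A by (rule J.rcos_ring_hom)
  interpret A: cring ?A unfolding A by (rule J.quotient_is_cring[OF R.is_cring])
  have mult: "?\<pi> x \<otimes>\<^bsub>?A\<^esub> ?\<pi> y = ?\<pi> (x * y)"
    if "x \<in> carrier local_R4" "y \<in> carrier local_R4" for x y
    using ring_hom_mult[OF hom that] by (simp add: local_R4_simps)
  have one: "?\<pi> 1 = \<one>\<^bsub>?A\<^esub>" using ring_hom_one[OF hom] by (simp add: local_R4_simps)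
  have closed: "?\<pi> x \<in> carrier ?A" if "x \<in> carrier local_R4" for x
    using ring_hom_closed[OF hom that] .
  show ?thesis
  proof (rule local_quotient.intro[OF A.is_cring], rule local_quotient_axioms.intro)
    show "(\<lambda>f. ?\<pi> (Fract f 1)) \<in> ring_hom R4 ?A"
    proof (rule ring_hom_memI)
      fix f g :: "'a poly4"
      note c = Fract_in_local[OF one_notin_mm]
      show "?\<pi> (Fract f 1) \<in> carrier ?A" by (intro closed c)
      show "?\<pi> (Fract (f \<otimes>\<^bsub>R4\<^esub> g) 1) = ?\<pi> (Fract f 1) \<otimes>\<^bsub>?A\<^esub> ?\<pi> (Fract g 1)"
        by (simp add: mult c)
      show "?\<pi> (Fract (f \<oplus>\<^bsub>R4\<^esub> g) 1) = ?\<pi> (Fract f 1) \<oplus>\<^bsub>?A\<^esub> ?\<pi> (Fract g 1)"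
        using ring_hom_add[OF hom c c, of f g] by (simp add: local_R4_simps)
    qed (simp add: one flip: One_fract_def)
  next
    fix Y assume "Y \<in> carrier ?A"
    then obtain q where q: "q \<in> carrier local_R4" "Y = ?\<pi> q"
      unfolding A FactRing_def A_RCOSETS_def' by auto
    then obtain f g where fg: "q = Fract f g" "g \<notin> mm" unfolding local_R4_carrier by blast
    then have "?\<pi> (Fract g 1) \<otimes>\<^bsub>?A\<^esub> Y = ?\<pi> (Fract f 1)"
      using mult[OF Fract_in_local[OF one_notin_mm] q(1), of g] q
        mult_fract_cancel[OF notin_mm_nonzero, of g f 1] by simp
    then show "\<exists>f g. g \<notin> mm \<and> ?\<pi> (Fract g 1) \<otimes>\<^bsub>?A\<^esub> Y = ?\<pi> (Fract f 1)" using fg by blast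
  next
    fix g :: "'a poly4" assume g: "g \<notin> mm"
    have c: "Fract g 1 \<in> carrier local_R4" "Fract 1 g \<in> carrier local_R4"
      using Fract_in_local g one_notin_mm by blast+
    have "Fract g 1 * Fract 1 g = 1" using g notin_mm_nonzero[OF g] by (simp add: One_fract_def eq_fract)
    then have "?\<pi> (Fract g 1) \<otimes>\<^bsub>?A\<^esub> ?\<pi> (Fract 1 g) = \<one>\<^bsub>?A\<^esub>" using mult[OF c] one by simp
    then show "?\<pi> (Fract g 1) \<in> Units ?A"
      using closed[OF c(1)] closed[OF c(2)] A.m_comm unfolding Units_def by auto
  next
    fix f :: "'a poly4"
    have "\<zero>\<^bsub>?A\<^esub> = local_tI a" by (simp add: A FactRing_def)
    moreover have "?\<pi> (Fract f 1) = local_tI a \<longleftrightarrow> Fract f 1 \<in> local_tI a"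
      using J.a_rcos_const J.rcos_const_imp_mem Fract_in_local[OF one_notin_mm] by metis
    ultimately show "?\<pi> (Fract f 1) = \<zero>\<^bsub>?A\<^esub> \<longleftrightarrow> f \<in> tI a" using Fract_in_local_tI by metis
  qed
qed

theorem arithmetically_buchsbaum_iff:
  "arithmetically_buchsbaum (tI a :: 'k::field poly4 set) \<longleftrightarrow> no_adjacent_gaps a"
proof -
  interpret L: local_quotient "local_coordinate_ring (tI a :: 'k poly4 set)"
    "\<lambda>f. local_tI a +>\<^bsub>local_R4\<^esub> Fract f 1" a
    by (rule local_quotient_coordinate_ring)
  show ?thesis
  proof (cases "\<exists>W. card W = 2 \<and> 0 < a W")
    case True
    then show ?thesis unfolding arithmetically_buchsbaum_def
      using L.no_adjacent_gaps_if_buchsbaum L.buchsbaum_if_no_adjacent_gaps by blast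
  next
    case False
    \<comment> \<open>All exponents vanish: the curve is empty and its coordinate ring is the zero
      ring, so both sides hold.\<close>
    then have "a W = 0" if "card W = 2" for W using that by auto
    moreover from this have "1 \<in> (tI a :: 'k poly4 set)" by (simp add: tI_trivial)
    then have "\<one>\<^bsub>local_coordinate_ring (tI a :: 'k poly4 set)\<^esub> = \<zero>\<^bsub>local_coordinate_ring (tI a :: 'k poly4 set)\<^esub>"
      using L.T_zero_iff L.T_one by metis
    ultimately show ?thesis
      unfolding arithmetically_buchsbaum_def
      using buchsbaum_local_trivial[OF L.ring_axioms] no_adjacent_gaps_trivial by blast
  qed
qed

section \<open>Laurent coefficients of sections\<close>

definition shift :: "4 set \<Rightarrow> nat \<Rightarrow> 4 \<Rightarrow> int" where
  "shift S n i = (if i \<in> S then int n else 0)"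

lemma var_prod_power:
  "var_prod S ^ n = (single (mk (shift S n)) 1 :: 'k::field poly4)"
proof -
  have "(\<Prod>i\<in>S. Var i ^ n) = (single (mk (shift S n)) 1 :: 'k poly4)" if "finite S" for S
    using that
  proof (induction S rule: finite_induct)
    case empty
    have "mk (shift {} n) = 0" by (rule poly_mapping_eqI) (simp add: shift_def)
    then show ?case by simp
  next
    case (insert i S)
    have "single i n + mk (shift S n) = mk (shift (insert i S) n)"
      using insert by (intro poly_mapping_eqI) (auto simp: lookup_add shift_def lookup_single when_def)
    with insert show ?case by (simp add: Var_power mult_single)
  qed
  then show ?thesis by (simp add: var_prod_def prod_power_distrib)
qed

lemma var_prod_nonzero: "var_prod S ^ n \<noteq> (0 :: 'k::field poly4)"
  unfolding var_prod_power by (metis lookup_single_eq lookup_zero zero_neq_one)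

lemma ecoeff_var_prod_mult: "ecoeff (var_prod S ^ n * f) v = ecoeff f (\<lambda>i. v i - shift S n i)"
  unfolding var_prod_power ecoeff_single_mult by (simp add: expo_mk shift_def)

abbreviation xall :: "'k::field poly4" where
  "xall \<equiv> var_prod UNIV"

lemma shift_UNIV [simp]: "shift UNIV n i = int n"
  by (simp add: shift_def)

definition laurent :: "'k::field poly4 fract set" where
  "laurent = {Fract f (xall ^ n) | f n. True}"

text \<open>A representation is chosen here; \<open>lc_Fract\<close> shows that all representations
  give the same coefficients.\<close>

definition lc :: "'k::field poly4 fract \<Rightarrow> (4 \<Rightarrow> int) \<Rightarrow> 'k" where
  "lc q = (SOME F. \<exists>f n. q = Fract f (xall ^ n) \<and> F = (\<lambda>u. ecoeff f (\<lambda>i. u i + int n)))"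

lemma lc_Fract: "lc (Fract f (xall ^ n)) u = ecoeff f (\<lambda>i. u i + int n)"
proof -
  let ?P = "\<lambda>F. \<exists>g m. Fract f (xall ^ n) = Fract g (xall ^ m) \<and> F = (\<lambda>u. ecoeff g (\<lambda>i. u i + int m))"
  have "\<exists>F. ?P F" by blast
  then have "?P (lc (Fract f (xall ^ n)))" unfolding lc_def by (rule someI_ex)
  then obtain g m where eq: "Fract f (xall ^ n) = Fract g (xall ^ m)"
    and l: "lc (Fract f (xall ^ n)) = (\<lambda>u. ecoeff g (\<lambda>i. u i + int m))" by blast
  have eq': "xall ^ n * g = xall ^ m * f" using eq unfolding eq_fract(1)[OF var_prod_nonzero var_prod_nonzero] by (simp only: mult.commute)
  have "ecoeff g (\<lambda>i. u i + int m) = ecoeff (xall ^ n * g) (\<lambda>i. u i + int m + int n)"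
    unfolding ecoeff_var_prod_mult by simp
  also have "\<dots> = ecoeff f (\<lambda>i. u i + int n)"
    unfolding eq' ecoeff_var_prod_mult by (simp add: algebra_simps)
  finally show ?thesis unfolding l .
qed

lemma laurentE:
  assumes "q \<in> laurent"
  obtains f n where "q = Fract f (xall ^ n)"
  using assms unfolding laurent_def by blast

lemma laurentI: "Fract f (xall ^ n) \<in> laurent"
  unfolding laurent_def by blast

lemma Fract_var_prod: "Fract f (var_prod S ^ n) = Fract (var_prod (- S) ^ n * f) (xall ^ n)"
proof -
  have "xall = var_prod S * (var_prod (- S) :: 'a poly4)"
    unfolding var_prod_def using prod.union_disjoint[of S "- S" Var] by simp
  then have "xall ^ n = var_prod S ^ n * (var_prod (- S) ^ n :: 'a poly4)"
    by (simp add: power_mult_distrib)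
  then show ?thesis unfolding eq_fract(1)[OF var_prod_nonzero var_prod_nonzero] by (simp only: mult_ac)
qed

lemma Fract_var_prod_laurent: "Fract f (var_prod S ^ n) \<in> laurent"
  by (subst Fract_var_prod) (rule laurentI)

lemma lc_Fract_var_prod: "lc (Fract f (var_prod S ^ n)) u = ecoeff f (\<lambda>i. u i + shift S n i)"
proof -
  have "lc (Fract f (var_prod S ^ n)) u = ecoeff (var_prod (- S) ^ n * f) (\<lambda>i. u i + int n)"
    by (subst Fract_var_prod) (rule lc_Fract)
  also have "\<dots> = ecoeff f (\<lambda>i. u i + shift S n i)"
    unfolding ecoeff_var_prod_mult by (rule arg_cong[of _ _ "ecoeff f"]) (auto simp: shift_def)
  finally show ?thesis .
qed

lemma zero_eq_Fract: "(0 :: 'k::field poly4 fract) = Fract 0 (xall ^ 0)"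
  by (simp add: Zero_fract_def)

lemma laurent_zero: "0 \<in> laurent"
  by (subst zero_eq_Fract) (rule laurentI)

lemma lc_zero [simp]: "lc 0 u = 0"
  by (subst zero_eq_Fract) (simp only: lc_Fract ecoeff_zero)

lemma lc_inject:
  assumes "q \<in> laurent" "r \<in> laurent" "\<And>u. lc q u = lc r u"
  shows "q = r"
proof -
  obtain f n where q: "q = Fract f (xall ^ n)" using assms(1) by (rule laurentE)
  obtain g m where r: "r = Fract g (xall ^ m)" using assms(2) by (rule laurentE)
  have "ecoeff (xall ^ m * f) = ecoeff (xall ^ n * g)"
  proof
    fix v
    show "ecoeff (xall ^ m * f) v = ecoeff (xall ^ n * g) v"
      using assms(3)[of "\<lambda>i. v i - int n - int m"]
      unfolding q r lc_Fract ecoeff_var_prod_mult by (simp add: algebra_simps)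
  qed
  then show ?thesis
    unfolding ecoeff_inject q r eq_fract(1)[OF var_prod_nonzero var_prod_nonzero] by (simp only: mult.commute)
qed

lemma laurent_add: "q \<in> laurent \<Longrightarrow> r \<in> laurent \<Longrightarrow> q + r \<in> laurent"
  and lc_add: "q \<in> laurent \<Longrightarrow> r \<in> laurent \<Longrightarrow> lc (q + r) u = lc q u + lc r u"
proof -
  assume "q \<in> laurent" "r \<in> laurent"
  then obtain f n g m where q: "q = Fract f (xall ^ n)" and r: "r = Fract g (xall ^ m)"
    by (meson laurentE)
  have s: "q + r = Fract (xall ^ m * f + xall ^ n * g) (xall ^ (n + m))"
    unfolding q r add_fract[OF var_prod_nonzero var_prod_nonzero] power_add by (simp only: mult.commute)
  show "q + r \<in> laurent" unfolding s by (rule laurentI)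
  show "lc (q + r) u = lc q u + lc r u"
    unfolding s lc_Fract ecoeff_add ecoeff_var_prod_mult by (simp add: q r lc_Fract)
qed

lemma laurent_minus: "q \<in> laurent \<Longrightarrow> - q \<in> laurent"
  and lc_minus: "q \<in> laurent \<Longrightarrow> lc (- q) u = - lc q u"
proof -
  assume "q \<in> laurent"
  then obtain f n where q: "q = Fract f (xall ^ n)" by (rule laurentE)
  show "- q \<in> laurent" "lc (- q) u = - lc q u"
    unfolding q by (simp_all add: laurentI lc_Fract ecoeff_minus)
qed

lemma laurent_diff: "q \<in> laurent \<Longrightarrow> r \<in> laurent \<Longrightarrow> q - r \<in> laurent"
  and lc_diff: "q \<in> laurent \<Longrightarrow> r \<in> laurent \<Longrightarrow> lc (q - r) u = lc q u - lc r u"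
  using laurent_add[of q "- r"] lc_add[of q "- r"] by (simp_all add: laurent_minus lc_minus)

lemma lc_Var_mult: "q \<in> laurent \<Longrightarrow> lc (Fract (Var k) 1 * q) u = lc q (u(k := u k - 1))"
proof -
  assume "q \<in> laurent"
  then obtain f n where q: "q = Fract f (xall ^ n)" by (rule laurentE)
  have "(\<lambda>i. u i + int n)(k := u k + int n - 1) = (\<lambda>i. (u(k := u k - 1)) i + int n)"
    by (auto simp: fun_eq_iff)
  then show ?thesis by (simp only: q mult_fract mult_1_left lc_Fract ecoeff_Var)
qed

lemma lc_const_mult: "q \<in> laurent \<Longrightarrow> lc (Fract (single 0 c) 1 * q) u = c * lc q u"
proof -
  assume "q \<in> laurent"
  then obtain f n where q: "q = Fract f (xall ^ n)" by (rule laurentE)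
  show ?thesis by (simp add: q mult_fract lc_Fract ecoeff_single_mult expo_def)
qed

lemma finite_lc: "q \<in> laurent \<Longrightarrow> finite {u. lc q u \<noteq> 0}"
proof -
  assume "q \<in> laurent"
  then obtain f n where q: "q = Fract f (xall ^ n)" by (rule laurentE)
  have "finite ((\<lambda>u i. u i + int n) -` {v. ecoeff f v \<noteq> 0})"
    by (intro finite_vimageI finite_ecoeff) (auto simp: inj_def fun_eq_iff)
  then show ?thesis unfolding q lc_Fract vimage_def by simp
qed

lemma laurent_ex_Fract:
  fixes F :: "(4 \<Rightarrow> int) \<Rightarrow> 'k::field"
  assumes fin: "finite {u. F u \<noteq> 0}" and pos: "\<And>u i. F u \<noteq> 0 \<Longrightarrow> 0 \<le> u i + shift S N i"
  obtains f where "ecoeff f = (\<lambda>v. F (\<lambda>i. v i - shift S N i))"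
    "\<And>u. lc (Fract f (var_prod S ^ N)) u = F u"
proof -
  have "finite ((\<lambda>v i. v i - shift S N i) -` {u. F u \<noteq> 0})"
    by (intro finite_vimageI fin) (auto simp: inj_def fun_eq_iff)
  then have "finite {v. F (\<lambda>i. v i - shift S N i) \<noteq> 0}" by (simp add: vimage_def)
  moreover have "0 \<le> v i" if "F (\<lambda>i. v i - shift S N i) \<noteq> 0" for v i
    using pos[OF that, of i] by simp
  ultimately obtain f where f: "ecoeff f = (\<lambda>v. F (\<lambda>i. v i - shift S N i))"
    by (rule ecoeff_surj)
  moreover have "lc (Fract f (var_prod S ^ N)) u = F u" for u
    unfolding lc_Fract_var_prod f by simp
  ultimately show ?thesis using that by blast
qed

lemma laurent_ex:
  fixes F :: "(4 \<Rightarrow> int) \<Rightarrow> 'k::field"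
  assumes fin: "finite {u. F u \<noteq> 0}"
  obtains q where "q \<in> laurent" "\<And>u. lc q u = F u"
proof -
  define N where "N = Max (insert 0 ((\<lambda>(u, i). nat (- u i)) ` ({u. F u \<noteq> 0} \<times> UNIV)))"
  have "0 \<le> u i + shift UNIV N i" if "F u \<noteq> 0" for u i
  proof -
    have "(\<lambda>(u, i). nat (- u i)) (u, i) \<in> (\<lambda>(u, i). nat (- u i)) ` ({u. F u \<noteq> 0} \<times> UNIV)"
      by (rule imageI) (use that in simp)
    then have "nat (- u i) \<le> N" unfolding N_def using fin by (intro Max_ge) auto
    then show ?thesis by simp
  qed
  then obtain f where "\<And>u. lc (Fract f (xall ^ N)) u = F u"
    using laurent_ex_Fract[OF fin, of UNIV N] by blast
  then show ?thesis using that laurentI by blast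
qed

lemma homogeneous_ecoeff: "homogeneous n f \<longleftrightarrow> (\<forall>v. ecoeff f v \<noteq> 0 \<longrightarrow> sum v UNIV = n)"
proof
  assume h: "homogeneous n f"
  show "\<forall>v. ecoeff f v \<noteq> 0 \<longrightarrow> sum v UNIV = n"
  proof clarify
    fix v assume "ecoeff f v \<noteq> 0"
    then obtain m where "m \<in> keys f" "v = expo m" using ecoeff_neqD by blast
    then show "sum v UNIV = n" using h by (simp add: homogeneous_def mdeg_def expo_def)
  qed
next
  assume *: "\<forall>v. ecoeff f v \<noteq> 0 \<longrightarrow> sum v UNIV = n"
  show "homogeneous n f" unfolding homogeneous_def
  proof
    fix m assume "m \<in> keys f"
    then have "sum (expo m) UNIV = n" using * by (simp add: in_keys_iff)
    then show "int (mdeg m) = n" by (simp add: mdeg_def expo_def)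
  qed
qed

lemma sum_shift: "sum (shift S n) V = int (n * card (V \<inter> S))"
  by (simp add: shift_def sum.If_cases)

text \<open>Ideal, grading and localisation are all compatible with monomials, so a section is
  tested one exponent vector at a time, and all cohomological questions split accordingly.\<close>

lemma sections_iff:
  "q \<in> sections (tI a) j S \<longleftrightarrow> q \<in> laurent \<and> (\<forall>u. lc q u \<noteq> 0 \<longrightarrow> sum u UNIV = j \<and> good a u S)"
proof
  assume "q \<in> sections (tI a) j S"
  then obtain f n where q: "q = Fract f (var_prod S ^ n)" and f: "f \<in> tI a"
    and hom: "homogeneous (j + int (n * card S)) f" unfolding sections_def by blast
  have "sum u UNIV = j \<and> good a u S" if u: "lc q u \<noteq> 0" for u
  proof -
    have e: "ecoeff f (\<lambda>i. u i + shift S n i) \<noteq> 0" using u by (simp add: q lc_Fract_var_prod)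
    have "sum (\<lambda>i. u i + shift S n i) UNIV = j + int (n * card S)"
      using hom e unfolding homogeneous_ecoeff by blast
    then have "sum u UNIV = j" by (simp add: sum.distrib sum_shift)
    moreover have "good a u S" unfolding good_def
    proof (intro conjI allI impI)
      fix i assume "i \<notin> S"
      then show "0 \<le> u i" using ecoeff_nonneg[OF e, of i] by (simp add: shift_def)
    next
      fix V :: "4 set" assume V: "card V = 2" "V \<inter> S = {}"
      then have "int (a V) \<le> sum (\<lambda>i. u i + shift S n i) V" using f e unfolding tI_ecoeff by blast
      then show "int (a V) \<le> sum u V" using V by (simp add: sum.distrib sum_shift)
    qed
    ultimately show ?thesis ..
  qed
  then show "q \<in> laurent \<and> (\<forall>u. lc q u \<noteq> 0 \<longrightarrow> sum u UNIV = j \<and> good a u S)"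
    using Fract_var_prod_laurent q by blast
next
  assume q: "q \<in> laurent \<and> (\<forall>u. lc q u \<noteq> 0 \<longrightarrow> sum u UNIV = j \<and> good a u S)"
  then obtain f0 n0 where f0: "q = Fract f0 (xall ^ n0)" by (meson laurentE)
  define n where "n = Max (range a)"
  have n: "a V \<le> n" for V by (simp add: n_def)
  \<comment> \<open>\<open>n0\<close> clears the poles, and the further \<open>n\<close> raises
    every exponent in \<open>S\<close> to at least \<open>n\<close>, which satisfies each pair
    meeting \<open>S\<close>.\<close>
  define N where "N = n0 + n"
  have ge: "0 \<le> u i + int n0" if "lc q u \<noteq> 0" for u i
    using ecoeff_nonneg[OF that[unfolded f0 lc_Fract], of i] by simp
  have pos: "0 \<le> u i + shift S N i" if "lc q u \<noteq> 0" for u i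
    using ge[OF that, of i] q that by (auto simp: shift_def N_def good_def)
  obtain f where f: "ecoeff f = (\<lambda>v. lc q (\<lambda>i. v i - shift S N i))"
    "\<And>u. lc (Fract f (var_prod S ^ N)) u = lc q u"
    using laurent_ex_Fract[of "lc q" S N] finite_lc q pos by blast
  have qf: "q = Fract f (var_prod S ^ N)"
    by (rule lc_inject) (use q f Fract_var_prod_laurent in auto)
  have "f \<in> tI a" unfolding tI_ecoeff
  proof (intro allI impI)
    fix v V assume v: "ecoeff f v \<noteq> 0" and V: "card (V :: 4 set) = 2"
    define u where "u = (\<lambda>i. v i - shift S N i)"
    have u: "lc q u \<noteq> 0" using v by (simp add: f u_def)
    show "int (a V) \<le> sum v V"
    proof (cases "V \<inter> S = {}")
      case True
      then have "int (a V) \<le> sum u V" using q u V unfolding good_def by blast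
      then show ?thesis using True by (simp add: u_def sum_subtractf sum_shift)
    next
      case False
      then obtain i where i: "i \<in> V" "i \<in> S" by blast
      have "int n \<le> v i" using ge[OF u, of i] i by (simp add: u_def shift_def N_def)
      moreover have "0 \<le> sum v (V - {i})" using ecoeff_nonneg[OF v] by (intro sum_nonneg) blast
      ultimately show ?thesis using i n[of V] by (simp add: sum.remove[of V i])
    qed
  qed
  moreover have "homogeneous (j + int (N * card S)) f"
    unfolding homogeneous_ecoeff
  proof (intro allI impI)
    fix v assume v: "ecoeff f v \<noteq> 0"
    then have "sum (\<lambda>i. v i - shift S N i) UNIV = j" using q by (simp add: f)
    then show "sum v UNIV = j + int (N * card S)" by (simp add: sum_subtractf sum_shift)
  qed
  ultimately show "q \<in> sections (tI a) j S" unfolding sections_def qf by blast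
qed

lemma homogeneous_mult:
  assumes "homogeneous n f" "homogeneous m g"
  shows "homogeneous (n + m) (f * g)"
  using assms unfolding homogeneous_def
  by (auto elim!: keysE_mult simp: mdeg_eq_wt wt_add)

lemma sections_mult:
  assumes "homogeneous n r" "q \<in> sections (tI a) (j - n) S"
  shows "Fract r 1 * q \<in> sections (tI a) j S"
proof -
  obtain f N where q: "q = Fract f (var_prod S ^ N)" "f \<in> tI a" "homogeneous (j - n + int (N * card S)) f"
    using assms(2) unfolding sections_def by blast
  have "homogeneous (j + int (N * card S)) (r * f)"
    using homogeneous_mult[OF assms(1) q(3)] by (simp add: algebra_simps)
  moreover have "Fract r 1 * q = Fract (r * f) (var_prod S ^ N)" by (simp add: q)
  ultimately show ?thesis unfolding sections_def using tI_mult_left[OF q(2)] by blast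
qed

declare One_nat_def [simp del]

section \<open>Cech cohomology of the ideal sheaf\<close>

lemma card_2_lessE:
  assumes "card (S :: 4 set) = 2"
  obtains i j where "S = {i, j}" "i < j"
proof -
  obtain i j where "S = {i, j}" "i \<noteq> j" using assms by (auto simp: card_2_iff)
  then show ?thesis using that[of i j] that[of j i] by (cases i j rule: linorder_cases) (auto simp: insert_commute)
qed

lemma card_3_lessE:
  assumes "card (S :: 4 set) = 3"
  obtains i j k where "S = {i, j, k}" "i < j" "j < k"
proof -
  have fin: "finite S" and ne: "S \<noteq> {}" using assms by auto
  define i where "i = Min S"
  have i: "i \<in> S" "\<And>x. x \<in> S \<Longrightarrow> i \<le> x" using fin ne by (auto simp: i_def)
  have "card (S - {i}) = 2" using assms i by simp
  then obtain j k where jk: "S - {i} = {j, k}" "j < k" by (rule card_2_lessE)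
  then have "S = {i, j, k}" "i < j" using i by (auto simp: order_less_le)
  then show ?thesis using that jk by blast
qed

lemma cech_d_pair:
  assumes "i < j"
  shows "cech_d c {i, j} = c {j} - c {i}"
proof -
  have *: "{l \<in> {i, j}. l < i} = {}" "{l \<in> {i, j}. l < j} = {i}" "{i, j} - {i} = {j}" "{i, j} - {j} = {i}"
    using assms by auto
  have "cech_d c {i, j} = (- 1) ^ card {l \<in> {i, j}. l < i} * c ({i, j} - {i})
      + (- 1) ^ card {l \<in> {i, j}. l < j} * c ({i, j} - {j})"
    using assms unfolding cech_d_def by (subst sum.insert) auto
  then show ?thesis unfolding * by simp
qed

lemma cech_d_triple:
  assumes "i < j" "j < k"
  shows "cech_d c {i, j, k} = c {j, k} - c {i, k} + c {i, j}"
proof -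
  have ik: "i < k" using assms by simp
  have *: "{l \<in> {i, j, k}. l < i} = {}" "{l \<in> {i, j, k}. l < j} = {i}" "{l \<in> {i, j, k}. l < k} = {i, j}"
    "{i, j, k} - {i} = {j, k}" "{i, j, k} - {j} = {i, k}" "{i, j, k} - {k} = {i, j}"
    using assms ik by auto
  have "cech_d c {i, j, k} = (- 1) ^ card {l \<in> {i, j, k}. l < i} * c ({i, j, k} - {i})
      + ((- 1) ^ card {l \<in> {i, j, k}. l < j} * c ({i, j, k} - {j})
      + (- 1) ^ card {l \<in> {i, j, k}. l < k} * c ({i, j, k} - {k}))"
    using assms ik unfolding cech_d_def by (subst sum.insert, simp, force, subst sum.insert) auto
  moreover have "card {i, j} = 2" using assms by simp
  ultimately show ?thesis unfolding * by simp
qed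

lemma cech_d_add: "cech_d (\<lambda>S. c S + c' S) = (\<lambda>S. cech_d c S + cech_d c' S)"
  by (simp add: cech_d_def algebra_simps sum.distrib)

lemma cech_d_mult: "cech_d (\<lambda>S. r * c S) = (\<lambda>S. r * cech_d c S)"
  by (simp add: cech_d_def algebra_simps sum_distrib_left)

lemma cech_d_minus: "cech_d (\<lambda>S. - c S) = (\<lambda>S. - cech_d c S)"
  using cech_d_mult[of "- 1" c] by simp

lemma cech_d_zero: "cech_d (\<lambda>S. 0) = (\<lambda>S. 0)"
  by (simp add: cech_d_def)

text \<open>Cochains are padded by zeros at sets of the wrong size, so the differential has to
  respect the padding.\<close>

lemma cech_d_eq_0:
  assumes "\<And>S. card S \<noteq> n \<Longrightarrow> c S = 0" "card S \<noteq> Suc n"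
  shows "cech_d c S = 0"
proof -
  have "c (S - {i}) = 0" if "i \<in> S" for i
  proof (rule assms(1))
    have "Suc (card (S - {i})) = card S" by (rule card_Suc_Diff1) (use that in auto)
    then show "card (S - {i}) \<noteq> n" using assms(2) by auto
  qed
  then show ?thesis by (simp add: cech_d_def)
qed

lemma cech_d_cech_d:
  assumes c: "\<And>S. card S \<noteq> 1 \<Longrightarrow> c S = 0"
  shows "cech_d (cech_d c) = (\<lambda>S. 0)"
proof
  fix S :: "4 set"
  have d: "cech_d c S = 0" if "card S \<noteq> 2" for S using cech_d_eq_0[of 1 c S] c that by simp
  show "cech_d (cech_d c) S = 0"
  proof (cases "card S = 3")
    case True
    then obtain i j k where ijk: "S = {i, j, k}" "i < j" "j < k" by (rule card_3_lessE)
    then show ?thesis using cech_d_pair[of i k c] by (simp add: cech_d_triple cech_d_pair)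
  next
    case False
    then show ?thesis using cech_d_eq_0[of 2 "cech_d c" S] d by simp
  qed
qed

section \<open>Homogeneous parts of polynomials\<close>

lemma lookup_hom_part: "lookup (hom_part n f) m = (lookup f m when mdeg m = n)"
  by (auto simp: hom_part_def lookup_sum lookup_single when_def in_keys_iff sum.delta)

lemma homogeneous_hom_part: "homogeneous (int n) (hom_part n f)"
  by (auto simp: homogeneous_def in_keys_iff lookup_hom_part when_def split: if_splits)

lemma mdeg_0_iff: "mdeg m = 0 \<longleftrightarrow> m = 0"
  by (auto simp: mdeg_def poly_mapping_eq_iff fun_eq_iff)

lemma hom_part_0: "hom_part 0 f = single 0 (lookup f 0)"
  by (rule poly_mapping_eqI) (auto simp: lookup_hom_part lookup_single when_def mdeg_0_iff)

lemma finite_hom_part: "finite {n. hom_part n f \<noteq> 0}"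
proof (rule finite_subset)
  show "{n. hom_part n f \<noteq> 0} \<subseteq> mdeg ` keys f"
  proof clarify
    fix n assume "hom_part n f \<noteq> 0"
    then obtain m where "lookup (hom_part n f) m \<noteq> 0" by (metis lookup_zero poly_mapping_eqI)
    then show "n \<in> mdeg ` keys f"
      by (auto simp: lookup_hom_part when_def in_keys_iff split: if_splits)
  qed
qed simp

lemma homogeneous_Var: "homogeneous 1 (Var i)"
  by (simp add: homogeneous_def Var_def mdeg_eq_wt wt_single)

lemma hom_part_Var: "hom_part n (Var i :: 'k::field poly4) = (if n = 1 then Var i else 0)"
proof (rule poly_mapping_eqI)
  fix m
  have "mdeg m = 1" if "lookup (Var i :: 'k poly4) m \<noteq> 0"
  proof -
    have "m \<in> keys (Var i :: 'k poly4)" using that by (simp add: in_keys_iff)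
    then have "int (mdeg m) = 1" using homogeneous_Var[of i] unfolding homogeneous_def by blast
    then show ?thesis by simp
  qed
  then show "lookup (hom_part n (Var i :: 'k poly4)) m = lookup (if n = 1 then Var i else 0) m"
    by (auto simp: lookup_hom_part when_def)
qed

text \<open>One of \<open>W\<close> and \<open>- W\<close> avoids \<open>i\<close>, and its
  inequality fails. Sections on single charts thus have no coefficient at a gap, so the coefficients
  of a cocycle there depend only on its class.\<close>

lemma gap_not_good_singleton: "gap a W u \<Longrightarrow> \<not> good a u {i}"
proof
  assume g: "gap a W u" and "good a u {i}"
  have "card W = 2" "card (- W) = 2" using g card_Compl_2 by (auto simp: gap_def)
  moreover have "W \<inter> {i} = {} \<or> - W \<inter> {i} = {}" by blast
  ultimately show False using g \<open>good a u {i}\<close> unfolding gap_def good_def by (metis not_le)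
qed

section \<open>The residue field as a module\<close>

text \<open>The cosets of the maximal ideal are the fibres of the constant coefficient, so scalars
  parametrise the residue field.\<close>

definition res :: "'k::field \<Rightarrow> 'k poly4 set" where
  "res x = {f. lookup f 0 = x}"

lemma mm_iff: "f \<in> mm \<longleftrightarrow> lookup f 0 = 0"
proof
  assume "lookup f 0 = 0"
  then have "m \<noteq> 0" if "m \<in> keys f" for m using that by (auto simp: in_keys_iff)
  then have "wt (pind UNIV) m \<noteq> 0" if "m \<in> keys f" for m
    using that unfolding wt_pind by (auto simp: poly_mapping_eq_iff fun_eq_iff)
  then show "f \<in> mm" by (auto simp: wideal_def Suc_le_eq One_nat_def)
qed (auto intro: wideal_lookup)

lemma coset_eq_res: "irrelevant_ideal +>\<^bsub>R4\<^esub> f = res (lookup f 0)"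
proof -
  have "g \<in> res (lookup f 0) \<longleftrightarrow> (\<exists>h\<in>mm. g = h + f)" for g
  proof
    assume "g \<in> res (lookup f 0)"
    then show "\<exists>h\<in>mm. g = h + f"
      by (intro bexI[of _ "g - f"]) (simp_all add: mm_iff res_def lookup_minus)
  qed (auto simp: mm_iff res_def lookup_add)
  then show ?thesis by (auto simp: a_r_coset_def' irrelevant_ideal_eq)
qed

lemma lookup_mult_0:
  fixes f g :: "'k::field poly4"
  shows "lookup (f * g) 0 = lookup f 0 * lookup g 0"
proof -
  define f0 :: "'k poly4" where "f0 = single 0 (lookup f 0)"
  have "f - f0 \<in> mm" by (simp add: mm_iff f0_def lookup_minus)
  then have "g * (f - f0) \<in> mm" by (rule wideal_mult_left)
  then have "lookup (f * g) 0 = lookup (f0 * g) 0"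
    by (simp add: mm_iff algebra_simps lookup_minus)
  also have "\<dots> = lookup f 0 * lookup g 0"
    unfolding f0_def using lookup_single_mult[of 0 "lookup f 0" g 0] by simp
  finally show ?thesis .
qed

lemma res_inject: "res x = res y \<longleftrightarrow> x = (y :: 'k::field)"
proof
  assume "res x = res y"
  moreover have "single 0 x \<in> res x" by (simp add: res_def)
  ultimately have "single 0 x \<in> res y" by simp
  then show "x = y" by (simp add: res_def)
qed simp

lemma residue_carrier: "carrier residue_module = range res"
proof -
  have "carrier residue_module = range (\<lambda>f. irrelevant_ideal +>\<^bsub>R4\<^esub> f)"
    by (auto simp: residue_module_def Let_def FactRing_def A_RCOSETS_def')
  also have "\<dots> = range res"
  proof
    show "range res \<subseteq> range (\<lambda>f. irrelevant_ideal +>\<^bsub>R4\<^esub> f)"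
      unfolding coset_eq_res by (auto intro!: image_eqI[of _ _ "single 0 _"])
  qed (auto simp: coset_eq_res)
  finally show ?thesis .
qed

lemma irrelevant_ring_hom:
  "(+>\<^bsub>R4\<^esub>) irrelevant_ideal \<in> ring_hom R4 (R4 Quot irrelevant_ideal)"
  by (rule ideal.rcos_ring_hom) (simp add: irrelevant_ideal_eq wideal_ideal)

lemma residue_add: "res x \<oplus>\<^bsub>residue_module\<^esub> res y = res (x + y)"
  using ring_hom_add[OF irrelevant_ring_hom, of "single 0 x" "single 0 y"]
  by (simp add: residue_module_def Let_def coset_eq_res lookup_add)

lemma residue_smult: "r \<odot>\<^bsub>residue_module\<^esub> res y = res (lookup r 0 * y)"
  using ring_hom_mult[OF irrelevant_ring_hom, of r "single 0 y"]
  by (simp add: residue_module_def Let_def coset_eq_res lookup_mult_0)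

lemma residue_component:
  "component (residue_module :: ('k::field poly4, 'k poly4 set) graded_module) j
    = (if j = 0 then range res else {res 0})"
proof -
  let ?R = "residue_module :: ('k poly4, 'k poly4 set) graded_module"
  have eq: "component ?R j = (\<lambda>f. res (lookup f 0)) ` {f. homogeneous j f}"
    by (simp add: residue_module_def Let_def coset_eq_res)
  show ?thesis
  proof (cases "j = 0")
    case True
    have "res x \<in> component ?R j" for x :: 'k
      unfolding eq using True
      by (intro image_eqI[of _ _ "single 0 x"]) (simp_all add: homogeneous_def mdeg_def)
    then have "component ?R j = range res" unfolding eq by blast
    then show ?thesis using True by simp
  next
    case False
    have "lookup f 0 = 0" if "homogeneous j f" for f :: "'k poly4"
      using that False by (auto simp: homogeneous_def in_keys_iff mdeg_def dest: bspec[of _ _ 0])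
    moreover have "homogeneous j (0 :: 'k poly4)" by (simp add: homogeneous_def)
    ultimately have "component ?R j = {res 0}" unfolding eq by (force intro: image_eqI[of _ _ 0])
    then show ?thesis using False by simp
  qed
qed

abbreviation (input) kpow :: "nat \<Rightarrow> int \<Rightarrow> ('k::field poly4, nat \<Rightarrow> 'k poly4 set) graded_module" where
  "kpow m t \<equiv> twist (direct_power m residue_module) t"

lemma kpow_carrier: "carrier (kpow m t) = (\<Pi>\<^sub>E i\<in>{..<m}. range res)"
  by (simp add: twist_def direct_power_def residue_carrier)

lemma kpow_add: "u \<oplus>\<^bsub>kpow m t\<^esub> v = (\<lambda>i\<in>{..<m}. u i \<oplus>\<^bsub>residue_module\<^esub> v i)"
  by (simp add: twist_def direct_power_def)

lemma kpow_smult: "r \<odot>\<^bsub>kpow m t\<^esub> v = (\<lambda>i\<in>{..<m}. r \<odot>\<^bsub>residue_module\<^esub> v i)"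
  by (simp add: twist_def direct_power_def)

lemma kpow_component:
  "component (kpow m t) j = (\<Pi>\<^sub>E i\<in>{..<m}. if t + j = 0 then range res else {res 0})"
  by (simp add: twist_def direct_power_def residue_component)

lemma kpow_Var_smult:
  fixes v :: "nat \<Rightarrow> 'k::field poly4 set"
  assumes v: "v \<in> carrier (kpow m t)"
  shows "Var i \<odot>\<^bsub>kpow m t\<^esub> v = (\<lambda>i\<in>{..<m}. res 0)"
proof -
  have "Var i \<odot>\<^bsub>residue_module\<^esub> v l = res 0" if "l \<in> {..<m}" for l
  proof -
    have "v l \<in> range res" using PiE_mem[OF v[unfolded kpow_carrier] that] .
    then obtain x where x: "v l = res x" by (rule rangeE)
    have "lookup (Var i :: 'k poly4) 0 = 0"
      using mm_iff[of "Var i :: 'k poly4"] by (simp add: Var_in_wideal pind_def)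
    then show ?thesis by (simp add: x residue_smult)
  qed
  then show ?thesis unfolding kpow_smult by (rule restrict_ext)
qed

section \<open>First cohomology of a tetrahedral curve\<close>

locale tetrahedral =
  fixes a :: "4 set \<Rightarrow> nat" and I :: "'k::field poly4 set"
  assumes I_eq: "I = tI a"
begin

abbreviation Z :: "int \<Rightarrow> 'k cochain monoid" where
  "Z j \<equiv> cocycle_group I j 1"

abbreviation Bd :: "int \<Rightarrow> 'k cochain set" where
  "Bd j \<equiv> coboundaries I j 1"

abbreviation H :: "int \<Rightarrow> 'k cochain set monoid" where
  "H \<equiv> cohomology 1 I"

definition cls :: "int \<Rightarrow> 'k cochain \<Rightarrow> 'k cochain set" where
  "cls j c = Bd j #>\<^bsub>Z j\<^esub> c"

lemma sections_I_iff:
  "q \<in> sections I j S \<longleftrightarrow> q \<in> laurent \<and> (\<forall>u. lc q u \<noteq> 0 \<longrightarrow> sum u UNIV = j \<and> good a u S)"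
  unfolding I_eq by (rule sections_iff)

lemma sections_zero: "0 \<in> sections I j S"
  by (simp add: sections_I_iff laurent_zero)

lemma sections_add: "q \<in> sections I j S \<Longrightarrow> r \<in> sections I j S \<Longrightarrow> q + r \<in> sections I j S"
  unfolding sections_I_iff using laurent_add lc_add by (metis add_0)

lemma sections_minus: "q \<in> sections I j S \<Longrightarrow> - q \<in> sections I j S"
  unfolding sections_I_iff using laurent_minus lc_minus by (metis neg_equal_0_iff_equal)

lemma sections_mono: "q \<in> sections I j S \<Longrightarrow> S \<subseteq> S' \<Longrightarrow> q \<in> sections I j S'"
  unfolding sections_I_iff using good_mono by blast

lemma cochains_laurent: "c \<in> cochains I j p \<Longrightarrow> c S \<in> laurent"
  unfolding cochains_def by (cases "card S = p + 1") (auto simp: sections_I_iff laurent_zero dest: spec[of _ S])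

lemma cochains_add: "c \<in> cochains I j p \<Longrightarrow> c' \<in> cochains I j p \<Longrightarrow> (\<lambda>S. c S + c' S) \<in> cochains I j p"
  unfolding cochains_def by (simp add: sections_add)

lemma cochains_minus: "c \<in> cochains I j p \<Longrightarrow> (\<lambda>S. - c S) \<in> cochains I j p"
  unfolding cochains_def by (simp add: sections_minus)

lemma cochains_zero: "(\<lambda>S. 0) \<in> cochains I j p"
  unfolding cochains_def by (simp add: sections_zero)

lemma cochains_mult:
  "homogeneous n r \<Longrightarrow> c \<in> cochains I (j - n) p \<Longrightarrow> (\<lambda>S. Fract r 1 * c S) \<in> cochains I j p"
  unfolding cochains_def unfolding I_eq by (auto intro: sections_mult)

lemma Z_carrier: "c \<in> carrier (Z j) \<longleftrightarrow> c \<in> cochains I j 1 \<and> cech_d c = (\<lambda>S. 0)"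
  by (simp add: cocycle_group_def)

lemma Z_simps [simp]: "c \<otimes>\<^bsub>Z j\<^esub> c' = (\<lambda>S. c S + c' S)" "\<one>\<^bsub>Z j\<^esub> = (\<lambda>S. 0)"
  by (simp_all add: cocycle_group_def)

lemma Z_comm_group: "comm_group (Z j)"
proof (rule comm_groupI)
  fix c assume "c \<in> carrier (Z j)"
  then have "(\<lambda>S. - c S) \<in> carrier (Z j)" by (simp add: Z_carrier cochains_minus cech_d_minus)
  then show "\<exists>c'\<in>carrier (Z j). c' \<otimes>\<^bsub>Z j\<^esub> c = \<one>\<^bsub>Z j\<^esub>"
    by (rule bexI[rotated]) simp
qed (auto simp: Z_carrier cochains_add cochains_zero cech_d_add cech_d_zero algebra_simps)

lemma Bd_eq: "Bd j = cech_d ` cochains I j 0"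
  by (simp add: coboundaries_def One_nat_def)

lemma Bd_add:
  assumes "b \<in> Bd j" "b' \<in> Bd j"
  shows "(\<lambda>S. b S + b' S) \<in> Bd j"
proof -
  obtain x x' where x: "x \<in> cochains I j 0" "b = cech_d x" "x' \<in> cochains I j 0" "b' = cech_d x'"
    using assms unfolding Bd_eq by blast
  show ?thesis unfolding Bd_eq
    by (rule image_eqI[OF _ cochains_add[OF x(1,3)]]) (simp only: x cech_d_add)
qed

lemma Bd_minus:
  assumes "b \<in> Bd j"
  shows "(\<lambda>S. - b S) \<in> Bd j"
proof -
  obtain x where x: "x \<in> cochains I j 0" "b = cech_d x" using assms unfolding Bd_eq by blast
  show ?thesis unfolding Bd_eq
    by (rule image_eqI[OF _ cochains_minus[OF x(1)]]) (simp only: x cech_d_minus)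
qed

lemma Bd_zero: "(\<lambda>S. 0) \<in> Bd j"
  unfolding Bd_eq by (rule image_eqI[OF _ cochains_zero]) (simp only: cech_d_zero)

lemma Bd_mult:
  assumes "homogeneous n r" "b \<in> Bd (j - n)"
  shows "(\<lambda>S. Fract r 1 * b S) \<in> Bd j"
proof -
  obtain x where x: "x \<in> cochains I (j - n) 0" "b = cech_d x" using assms unfolding Bd_eq by blast
  show ?thesis unfolding Bd_eq
    by (rule image_eqI[OF _ cochains_mult[OF assms(1) x(1)]]) (simp only: x cech_d_mult)
qed

lemma cech_d_cochain:
  assumes c: "c \<in> cochains I j 0"
  shows "cech_d c \<in> carrier (Z j)"
proof -
  have c0: "c S = 0" if "card S \<noteq> 1" for S using c that by (simp add: cochains_def)
  have "cech_d c \<in> cochains I j 1" unfolding cochains_def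
  proof (intro CollectI allI)
    fix S :: "4 set"
    show "if card S = 1 + 1 then cech_d c S \<in> sections I j S else cech_d c S = 0"
    proof (cases "card S = 2")
      case True
      then obtain i k where S: "S = {i, k}" "i < k" by (rule card_2_lessE)
      have "c {i} \<in> sections I j {i}" "c {k} \<in> sections I j {k}"
        using c unfolding cochains_def by (auto dest: spec[of _ "{i}"] spec[of _ "{k}"])
      then have "c {i} \<in> sections I j S" "c {k} \<in> sections I j S" using S sections_mono by blast+
      then have "c {k} - c {i} \<in> sections I j S" using sections_add sections_minus by fastforce
      then show ?thesis using True by (simp add: S cech_d_pair)
    next
      case False
      then show ?thesis using cech_d_eq_0[of 1 c S] c0 by simp
    qed
  qed
  then show ?thesis using cech_d_cech_d[OF c0] by (simp add: Z_carrier)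
qed

lemma Bd_subgroup: "subgroup (Bd j) (Z j)"
proof -
  interpret Z: comm_group "Z j" by (rule Z_comm_group)
  show ?thesis
  proof (rule Z.subgroupI)
    show sub: "Bd j \<subseteq> carrier (Z j)" unfolding Bd_eq using cech_d_cochain by blast
    show "Bd j \<noteq> {}" using Bd_zero by blast
    fix b assume b: "b \<in> Bd j"
    have "inv\<^bsub>Z j\<^esub> b = (\<lambda>S. - b S)"
      by (rule Z.inv_equality) (use b Bd_minus sub in auto)
    then show "inv\<^bsub>Z j\<^esub> b \<in> Bd j" using Bd_minus[OF b] by simp
    fix b' assume "b' \<in> Bd j"
    then show "b \<otimes>\<^bsub>Z j\<^esub> b' \<in> Bd j" using Bd_add[OF b] by simp
  qed
qed

lemma H_comm_group: "comm_group (H j)"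
  unfolding cohomology_def by (rule comm_group.abelian_FactGroup[OF Z_comm_group Bd_subgroup])

lemma cls_altdef: "cls j c = {c'. (\<lambda>S. c' S - c S) \<in> Bd j}"
proof -
  have "(\<exists>b\<in>Bd j. c' = (\<lambda>S. b S + c S)) \<longleftrightarrow> (\<lambda>S. c' S - c S) \<in> Bd j" for c'
  proof
    assume "(\<lambda>S. c' S - c S) \<in> Bd j"
    then show "\<exists>b\<in>Bd j. c' = (\<lambda>S. b S + c S)" by (rule bexI[rotated]) simp
  qed auto
  then show ?thesis unfolding cls_def r_coset_def by auto
qed

lemma cls_self: "c \<in> cls j c"
  by (simp add: cls_altdef Bd_zero)

lemma cls_eq_iff: "cls j c = cls j c' \<longleftrightarrow> (\<lambda>S. c S - c' S) \<in> Bd j"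
proof
  assume d: "(\<lambda>S. c S - c' S) \<in> Bd j"
  have "(\<lambda>S. x S - c S) \<in> Bd j \<longleftrightarrow> (\<lambda>S. x S - c' S) \<in> Bd j" for x
  proof
    assume "(\<lambda>S. x S - c S) \<in> Bd j"
    from Bd_add[OF this d] show "(\<lambda>S. x S - c' S) \<in> Bd j" by simp
  next
    assume "(\<lambda>S. x S - c' S) \<in> Bd j"
    from Bd_add[OF this Bd_minus[OF d]] show "(\<lambda>S. x S - c S) \<in> Bd j" by simp
  qed
  then show "cls j c = cls j c'" by (simp add: cls_altdef)
next
  assume "cls j c = cls j c'"
  then have "c \<in> cls j c'" using cls_self by blast
  then show "(\<lambda>S. c S - c' S) \<in> Bd j" by (simp add: cls_altdef)
qed

lemma H_carrier: "carrier (H j) = cls j ` carrier (Z j)"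
  by (simp add: cohomology_def carrier_FactGroup cls_def[abs_def])

lemma H_one: "\<one>\<^bsub>H j\<^esub> = cls j (\<lambda>S. 0)"
  by (simp add: cohomology_def cls_altdef)

lemma zero_in_Z: "(\<lambda>S. 0) \<in> carrier (Z j)"
  by (simp add: Z_carrier cochains_zero cech_d_zero)

lemma cls_mult:
  assumes "c \<in> carrier (Z j)" "c' \<in> carrier (Z j)"
  shows "cls j c \<otimes>\<^bsub>H j\<^esub> cls j c' = cls j (\<lambda>S. c S + c' S)"
  using normal.rcos_sum[OF comm_group.subgroup_imp_normal[OF Z_comm_group Bd_subgroup] assms]
  by (simp add: cohomology_def cls_def)

lemma Z_mult:
  assumes "homogeneous n r" "c \<in> carrier (Z (j - n))"
  shows "(\<lambda>S. Fract r 1 * c S) \<in> carrier (Z j)"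
  using assms cochains_mult by (simp add: Z_carrier cech_d_mult)

text \<open>The product of a form with a coboundary is a coboundary, so all representatives in the
  union give the same class.\<close>

lemma hom_act_cls:
  assumes "homogeneous n r"
  shows "hom_act I j r (cls (j - n) c) = cls j (\<lambda>S. Fract r 1 * c S)"
proof -
  have "cls j (\<lambda>S. Fract r 1 * c' S) = cls j (\<lambda>S. Fract r 1 * c S)" if "c' \<in> cls (j - n) c" for c'
  proof -
    have "(\<lambda>S. c' S - c S) \<in> Bd (j - n)" using that by (simp add: cls_altdef)
    from Bd_mult[OF assms this] show ?thesis unfolding cls_eq_iff by (simp add: right_diff_distrib)
  qed
  then show ?thesis unfolding hom_act_def cls_def[symmetric] using cls_self by blast
qed

lemma hom_act_one:
  assumes "homogeneous n r"
  shows "hom_act I j r \<one>\<^bsub>H (j - n)\<^esub> = \<one>\<^bsub>H j\<^esub>"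
  unfolding H_one hom_act_cls[OF assms] by simp

text \<open>The representative is arbitrary; at a gap and a pair \<open>S\<close> the value does not
  depend on it, because coboundaries have no coefficient there.\<close>

definition ev :: "4 set \<Rightarrow> (4 \<Rightarrow> int) \<Rightarrow> 'k cochain set \<Rightarrow> 'k" where
  "ev S u K = lc ((SOME c. c \<in> K) S) u"

lemma ev_cls:
  assumes g: "gap a W u" and S: "card S = 2" and c: "c \<in> carrier (Z j)"
  shows "ev S u (cls j c) = lc (c S) u"
proof -
  define c' where "c' = (SOME c'. c' \<in> cls j c)"
  have "c' \<in> cls j c" unfolding c'_def using someI[of "\<lambda>c'. c' \<in> cls j c", OF cls_self] .
  then obtain b where b: "b \<in> cochains I j 0" "(\<lambda>S. c' S - c S) = cech_d b"
    by (auto simp: cls_altdef Bd_eq)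
  obtain i k where ik: "S = {i, k}" "i < k" using S by (rule card_2_lessE)
  have "b {i} \<in> sections I j {i}" "b {k} \<in> sections I j {k}"
    using b(1) unfolding cochains_def by (auto dest: spec[of _ "{i}"] spec[of _ "{k}"])
  then have z: "lc (b {i}) u = 0" "lc (b {k}) u = 0"
    unfolding sections_I_iff using gap_not_good_singleton[OF g] by blast+
  have "c' S = c S + (b {k} - b {i})"
    using fun_cong[OF b(2), of S] cech_d_pair[OF ik(2), of b] ik(1) by (simp add: algebra_simps)
  moreover have cL: "c S \<in> laurent" using c cochains_laurent unfolding Z_carrier by blast
  moreover note bL = cochains_laurent[OF b(1)]
  ultimately have "lc (c' S) u = lc (c S) u"
    by (simp add: lc_add[OF cL laurent_diff[OF bL bL]] lc_diff[OF bL bL] z)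
  then show ?thesis by (simp add: ev_def c'_def)
qed

text \<open>The cocycle is the coboundary of the cochain that is equal on the two points of \<open>W\<close> and zero on
  the others; that cochain has coefficients outside of the localised ideals.\<close>

lemma exists_cocycle:
  fixes F :: "(4 \<Rightarrow> int) \<Rightarrow> 'k"
  assumes pq: "p \<in> W" "q \<notin> W" and fin: "finite {u. F u \<noteq> 0}"
    and F: "\<And>u. F u \<noteq> 0 \<Longrightarrow> gap a W u \<and> sum u UNIV = j"
  obtains c where "c \<in> carrier (Z j)" "\<And>u. lc (c {p, q}) u = F u"
proof -
  \<comment> \<open>The coboundary at a pair is the value at the larger point minus that at the
    smaller one, and the cochain is nonzero at \<open>p\<close> but not at \<open>q\<close>; this
    sign makes the entry at \<open>{p, q}\<close> have coefficients \<open>F\<close>.\<close>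
  define F' where "F' = (\<lambda>u. if p < q then - F u else F u)"
  have fin': "finite {u. F' u \<noteq> 0}" using fin by (simp add: F'_def)
  obtain x where x: "x \<in> laurent" "\<And>u. lc x u = F' u" using laurent_ex[OF fin'] by blast
  define b where "b = (\<lambda>S. if \<exists>i\<in>W. S = {i} then x else 0)"
  have b0: "b S = 0" if "card S \<noteq> 1" for S using that by (auto simp: b_def)
  have bs: "b {i} = (if i \<in> W then x else 0)" for i by (auto simp: b_def)
  have "cech_d b \<in> cochains I j 1" unfolding cochains_def
  proof (intro CollectI allI)
    fix S :: "4 set"
    show "if card S = 1 + 1 then cech_d b S \<in> sections I j S else cech_d b S = 0"
    proof (cases "card S = 2")
      case True
      then obtain i k where S: "S = {i, k}" "i < k" by (rule card_2_lessE)
      have "cech_d b S \<in> sections I j S"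
      proof (cases "i \<in> W \<longleftrightarrow> k \<in> W")
        case eq: True
        then have "cech_d b S = 0" by (simp add: S cech_d_pair bs)
        then show ?thesis by (simp add: sections_zero)
      next
        case False
        then have ne: "S \<noteq> W" "S \<noteq> - W" using S by auto
        have "x \<in> sections I j S" unfolding sections_I_iff
        proof (intro conjI allI impI x)
          fix u assume "lc x u \<noteq> 0"
          then have "F u \<noteq> 0" by (auto simp: x F'_def split: if_splits)
          then have g: "gap a W u" "sum u UNIV = j" using F by auto
          then show "sum u UNIV = j" "good a u S"
            using gap_good[OF _ True g(1)] ne by (auto simp: gap_def)
        qed
        then have "cech_d b S = x \<or> cech_d b S = - x" "x \<in> sections I j S"
          using False by (auto simp: S cech_d_pair bs)
        then show ?thesis using sections_minus by auto
      qed
      then show ?thesis using True by simp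
    next
      case False
      then show ?thesis using cech_d_eq_0[of 1 b S] b0 by simp
    qed
  qed
  then have "cech_d b \<in> carrier (Z j)" using cech_d_cech_d[OF b0] by (simp add: Z_carrier)
  moreover have "lc (cech_d b {p, q}) u = F u" for u
  proof (cases "p < q")
    case True
    then show ?thesis using pq x(1) by (simp add: cech_d_pair bs lc_minus x F'_def)
  next
    case False
    then have "q < p" using pq by (metis linorder_less_linear)
    then show ?thesis using pq False cech_d_pair[of q p b] by (simp add: insert_commute bs x F'_def)
  qed
  ultimately show ?thesis using that by blast
qed

text \<open>In each degree a cocycle is the difference of a potential on the four points, here
  normalised to vanish at the point 0. It is a coboundary of sections once a constant makes the
  potential vanish at all points that are not good, and \<open>const_on_bad\<close> provides this
  constant.\<close>

lemma coboundary_criterion: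
  assumes c: "c \<in> carrier (Z j)"
    and gap: "\<And>W u. gap a W u \<Longrightarrow> \<exists>p\<in>W. \<exists>q\<in>- W. lc (c {p, q}) u = 0"
  shows "c \<in> Bd j"
proof -
  have cc: "c \<in> cochains I j 1" and dc: "cech_d c = (\<lambda>S. 0)" using c by (auto simp: Z_carrier)
  have cL: "c S \<in> laurent" for S using cochains_laurent[OF cc] .
  have c_sec: "c S \<in> sections I j S" if "card S = 2" for S using cc that by (simp add: cochains_def)
  define \<beta> where "\<beta> u i = (if i = 0 then 0 else lc (c {0, i}) u)" for u and i :: 4
  have diff: "lc (c {i, k}) u = \<beta> u k - \<beta> u i" if ik: "i < k" for i k u
  proof (cases "i = 0")
    case True
    then show ?thesis using ik by (auto simp: \<beta>_def)
  next
    case False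
    then have "0 < i" using exhaust_4[of i] less_4 by auto
    then have "c {i, k} - c {0, k} + c {0, i} = 0"
      using cech_d_triple[of 0 i k c] ik dc by simp
    then have "c {i, k} = c {0, k} - c {0, i}" by (simp add: algebra_simps add_eq_0_iff)
    moreover have "k \<noteq> 0" using \<open>0 < i\<close> ik by auto
    ultimately show ?thesis using False by (simp add: \<beta>_def lc_diff cL)
  qed
  have diff': "lc (c {i, k}) u = 0 \<Longrightarrow> \<beta> u i = \<beta> u k" if "i \<noteq> k" for i k u
    using diff[of i k u] diff[of k i u] that
    by (cases i k rule: linorder_cases) (auto simp: insert_commute)
  have rel: "\<beta> u i = \<beta> u k" if "i \<noteq> k" "\<not> good a u {i, k}" for u i k
  proof -
    have "c {i, k} \<in> sections I j {i, k}" using c_sec that by simp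
    then have "lc (c {i, k}) u = 0" using that(2) unfolding sections_I_iff by blast
    then show ?thesis using diff' that by blast
  qed
  have const: "\<beta> u i = \<beta> u k" if "\<not> good a u {i}" "\<not> good a u {k}" for u i k
  proof (rule const_on_bad[where a = a and u = u and \<beta> = "\<beta> u"])
    fix W assume "gap a W u"
    then obtain p q where "p \<in> W" "q \<in> - W" "lc (c {p, q}) u = 0" using gap by blast
    moreover from this have "\<beta> u p = \<beta> u q" by (intro diff') auto
    ultimately show "\<exists>i\<in>W. \<exists>j\<in>- W. \<beta> u i = \<beta> u j" by blast
  qed (use rel that in blast)+
  \<comment> \<open>Where every point is good any constant is admissible; the value zero keeps the
    support of the corrected potential finite.\<close>
  define t where "t u = (if \<exists>i. \<not> good a u {i} then \<beta> u (SOME i. \<not> good a u {i}) else 0)" for u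
  have t: "\<beta> u i = t u" if "\<not> good a u {i}" for u i
  proof -
    have "\<not> good a u {SOME i. \<not> good a u {i}}" using that by (rule someI)
    then show ?thesis using that const[OF that] by (auto simp: t_def)
  qed
  have t0: "\<exists>i. \<beta> u i \<noteq> 0" if "\<beta> u k - t u \<noteq> 0" for u k
  proof (rule ccontr)
    assume "\<not> ?thesis"
    then have "\<beta> u i = 0" for i by simp
    then show False using that by (simp add: t_def split: if_splits)
  qed
  have "finite {u. \<beta> u i \<noteq> 0}" for i
    using finite_lc[OF cL, of "{0, i}"] by (simp add: \<beta>_def)
  then have "finite (\<Union>i. {u. \<beta> u i \<noteq> 0})" by simp
  moreover have "{u. \<beta> u k - t u \<noteq> 0} \<subseteq> (\<Union>i. {u. \<beta> u i \<noteq> 0})" for k using t0 by auto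
  ultimately have fin: "finite {u. \<beta> u k - t u \<noteq> 0}" for k by (meson finite_subset)
  have "\<exists>x. x \<in> laurent \<and> (\<forall>u. lc x u = \<beta> u k - t u)" for k
    using laurent_ex[OF fin[of k]] by blast
  then obtain x where x: "\<And>k. x k \<in> laurent" "\<And>k u. lc (x k) u = \<beta> u k - t u" by metis
  define b where "b S = (if card S = 1 then x (the_elem S) else 0)" for S
  have b: "b \<in> cochains I j 0" unfolding cochains_def
  proof (intro CollectI allI)
    fix S :: "4 set"
    have "x k \<in> sections I j {k}" for k unfolding sections_I_iff
    proof (intro conjI allI impI x)
      fix u assume nz: "lc (x k) u \<noteq> 0"
      then obtain i where i: "\<beta> u i \<noteq> 0" using t0 x by metis
      then have i0: "i \<noteq> 0" "lc (c {0, i}) u \<noteq> 0" by (auto simp: \<beta>_def split: if_splits)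
      have "c {0, i} \<in> sections I j {0, i}" using c_sec i0 by simp
      then show "sum u UNIV = j" using i0 unfolding sections_I_iff by blast
      show "good a u {k}" using nz t x by (metis right_minus_eq)
    qed
    then show "if card S = 0 + 1 then b S \<in> sections I j S else b S = 0"
      by (auto simp: b_def elim!: card_1_singletonE)
  qed
  have bL: "b S \<in> laurent" for S using cochains_laurent[OF b] .
  have "c = cech_d b"
  proof
    fix S :: "4 set"
    show "c S = cech_d b S"
    proof (cases "card S = 2")
      case True
      then obtain i k where S: "S = {i, k}" "i < k" by (rule card_2_lessE)
      show ?thesis
      proof (rule lc_inject[OF cL])
        show "cech_d b S \<in> laurent" by (simp add: S cech_d_pair laurent_diff bL)
        show "lc (c S) u = lc (cech_d b S) u" for u
          unfolding S(1) cech_d_pair[OF S(2)] lc_diff[OF bL bL] diff[OF S(2)] by (simp add: b_def x)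
      qed
    next
      case False
      have "b S = 0" if "card S \<noteq> 1" for S using that by (simp add: b_def)
      then have "cech_d b S = 0" using cech_d_eq_0[of 1 b S] False by simp
      then show ?thesis using cc False by (simp add: cochains_def)
    qed
  qed
  then show ?thesis using b Bd_eq by blast
qed

section \<open>The module structure and its comparison with copies of the residue field\<close>

abbreviation M :: "('k poly4, int \<Rightarrow> 'k cochain set) graded_module" where
  "M \<equiv> hartshorne_rao I"

lemma M_carrier: "h \<in> carrier M \<longleftrightarrow> (\<forall>j. h j \<in> carrier (H j)) \<and> finite {j. h j \<noteq> \<one>\<^bsub>H j\<^esub>}"
  by (simp add: hartshorne_rao_def Let_def)

lemma M_add: "h \<oplus>\<^bsub>M\<^esub> h' = (\<lambda>j. h j \<otimes>\<^bsub>H j\<^esub> h' j)"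
  by (simp add: hartshorne_rao_def Let_def)

lemma M_smult: "r \<odot>\<^bsub>M\<^esub> h = (\<lambda>j. finprod (H j) (\<lambda>n. hom_act I j (hom_part n r) (h (j - int n))) {n. hom_part n r \<noteq> 0})"
  by (simp add: hartshorne_rao_def Let_def)

lemma M_component: "component M j = {h \<in> carrier M. \<forall>i. i \<noteq> j \<longrightarrow> h i = \<one>\<^bsub>H i\<^esub>}"
  by (simp add: hartshorne_rao_def Let_def)

lemma hom_act_closed:
  assumes "homogeneous n r" "K \<in> carrier (H (j - n))"
  shows "hom_act I j r K \<in> carrier (H j)"
  using assms hom_act_cls[OF assms(1)] Z_mult[OF assms(1)] unfolding H_carrier by auto

lemma M_smult_Var:
  assumes "h \<in> carrier M"
  shows "Var i \<odot>\<^bsub>M\<^esub> h = (\<lambda>j. hom_act I j (Var i) (h (j - 1)))"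
proof
  fix j
  interpret Hj: comm_group "H j" by (rule H_comm_group)
  have "Var i \<noteq> (0 :: 'k poly4)" unfolding Var_def by (metis lookup_single_eq lookup_zero zero_neq_one)
  then have "{n. hom_part n (Var i) \<noteq> (0 :: 'k poly4)} = {1}" by (auto simp: hom_part_Var)
  moreover have "hom_act I j (Var i) (h (j - 1)) \<in> carrier (H j)"
    using hom_act_closed[OF homogeneous_Var] assms by (simp add: M_carrier)
  ultimately show "(Var i \<odot>\<^bsub>M\<^esub> h) j = hom_act I j (Var i) (h (j - 1))"
    by (simp add: M_smult hom_part_Var)
qed

lemma single_class_in_M: "(\<lambda>j. if j = j0 then cls j0 c else \<one>\<^bsub>H j\<^esub>) \<in> carrier M" if "c \<in> carrier (Z j0)"
proof -
  have "finite {j. (if j = j0 then cls j0 c else \<one>\<^bsub>H j\<^esub>) \<noteq> \<one>\<^bsub>H j\<^esub>}"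
    by (rule finite_subset[of _ "{j0}"]) auto
  then show ?thesis using that zero_in_Z unfolding M_carrier H_carrier H_one by auto
qed

lemma ev_Var_mult:
  assumes "gap a W (u(i := u i + 1))" "card S = 2" "c \<in> carrier (Z (j - 1))"
  shows "ev S (u(i := u i + 1)) (hom_act I j (Var i) (cls (j - 1) c)) = lc (c S) u"
proof -
  have "c S \<in> laurent" using assms(3) cochains_laurent unfolding Z_carrier by blast
  then show ?thesis
    unfolding hom_act_cls[OF homogeneous_Var] ev_cls[OF assms(1,2) Z_mult[OF homogeneous_Var assms(3)]]
    by (simp add: lc_Var_mult)
qed

text \<open>If \<open>u\<close> and its successor in direction \<open>i\<close> are gaps, then multiplication by \<open>Var i\<close> does not vanish
  in degree \<open>u\<close>, while it does vanish on the direct sum of residue fields.\<close>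

lemma no_adjacent_gaps_if_iso:
  assumes iso: "graded_iso R4 M (kpow m t)"
  shows "no_adjacent_gaps a"
  unfolding no_adjacent_gaps_def
proof (intro allI impI notI)
  fix W u i assume g: "gap a W u" "gap a W (u(i := u i + 1))"
  obtain \<phi> where bij: "bij_betw \<phi> (carrier M) (carrier (kpow m t))"
    and sm': "\<forall>r\<in>carrier R4. \<forall>h\<in>carrier M. \<phi> (r \<odot>\<^bsub>M\<^esub> h) = r \<odot>\<^bsub>kpow m t\<^esub> \<phi> h"
    using iso unfolding graded_iso_def by blast
  have inj: "inj_on \<phi> (carrier M)" using bij by (rule bij_betw_imp_inj_on)
  have \<phi>: "\<phi> h \<in> carrier (kpow m t)" if "h \<in> carrier M" for h using bij_betwE[OF bij] that by blast
  have sm: "\<phi> (r \<odot>\<^bsub>M\<^esub> h) = r \<odot>\<^bsub>kpow m t\<^esub> \<phi> h" if "h \<in> carrier M" for r h using sm' that by simp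
  define j where "j = sum u UNIV"
  have "card W = 2" "card (- W) = 2" using g card_Compl_2 by (auto simp: gap_def)
  then have "W \<noteq> {}" "- W \<noteq> {}" by auto
  then obtain p q where pq: "p \<in> W" "q \<in> - W" by blast
  then have "p \<noteq> q" by auto
  then have S: "card {p, q} = 2" by simp
  have fin: "finite {v. (if v = u then 1 else 0 :: 'k) \<noteq> 0}" by simp
  obtain c where c: "c \<in> carrier (Z j)" "\<And>v. lc (c {p, q}) v = (if v = u then 1 else 0)"
  proof (rule exists_cocycle[OF pq(1) _ fin])
    show "q \<notin> W" using pq by simp
    show "gap a W v \<and> sum v UNIV = j" if "(if v = u then 1 else 0 :: 'k) \<noteq> 0" for v
      using that g by (auto simp: j_def split: if_splits)
  qed blast
  define h where "h d k = (if k = j then cls j d else \<one>\<^bsub>H k\<^esub>)" for d k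
  have h_in: "h d \<in> carrier M" if "d \<in> carrier (Z j)" for d
    unfolding h_def using single_class_in_M[OF that] .
  have Vh: "Var i \<odot>\<^bsub>M\<^esub> h d = (\<lambda>k. if k = j + 1 then cls (j + 1) (\<lambda>S. Fract (Var i) 1 * d S) else \<one>\<^bsub>H k\<^esub>)"
    if "d \<in> carrier (Z j)" for d
  proof
    fix k
    show "(Var i \<odot>\<^bsub>M\<^esub> h d) k = (if k = j + 1 then cls (j + 1) (\<lambda>S. Fract (Var i) 1 * d S) else \<one>\<^bsub>H k\<^esub>)"
      unfolding M_smult_Var[OF h_in[OF that]] h_def
      using hom_act_cls[OF homogeneous_Var, of "j + 1" i d] hom_act_one[OF homogeneous_Var, of k i]
      by auto
  qed
  have Vin: "Var i \<odot>\<^bsub>M\<^esub> h d \<in> carrier M" if "d \<in> carrier (Z j)" for d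
    unfolding Vh[OF that] by (rule single_class_in_M) (use Z_mult[OF homogeneous_Var, of d "j + 1"] that in simp)
  \<comment> \<open>The zero cocycle is treated alongside \<open>c\<close>, so that injectivity of
    \<open>\<phi>\<close> applies without knowing that \<open>\<phi>\<close> preserves zero.\<close>
  have "\<phi> (Var i \<odot>\<^bsub>M\<^esub> h d) = (\<lambda>i\<in>{..<m}. res 0)" if "d \<in> carrier (Z j)" for d
    unfolding sm[OF h_in[OF that]] by (rule kpow_Var_smult[OF \<phi>[OF h_in[OF that]]])
  from this[OF c(1)] this[OF zero_in_Z]
  have "\<phi> (Var i \<odot>\<^bsub>M\<^esub> h c) = \<phi> (Var i \<odot>\<^bsub>M\<^esub> h (\<lambda>S. 0))" by simp
  then have "Var i \<odot>\<^bsub>M\<^esub> h c = Var i \<odot>\<^bsub>M\<^esub> h (\<lambda>S. 0)"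
    using inj Vin c(1) zero_in_Z by (simp add: inj_on_eq_iff)
  then have "hom_act I (j + 1) (Var i) (cls j c) = hom_act I (j + 1) (Var i) (cls j (\<lambda>S. 0))"
    unfolding M_smult_Var[OF h_in[OF c(1)]] M_smult_Var[OF h_in[OF zero_in_Z]]
    by (drule_tac fun_cong[of _ _ "j + 1"]) (simp add: h_def)
  then have "lc (c {p, q}) u = lc 0 u"
    using ev_Var_mult[OF g(2) S, of c "j + 1"] ev_Var_mult[OF g(2) S, of "\<lambda>S. 0" "j + 1"] c(1) zero_in_Z
    by simp
  then show False by (simp add: c)
qed

text \<open>With one matching and one degree \<open>j0\<close>, the coefficients at the finitely
  many gaps, read from the entry at a single pair \<open>S\<close> meeting both halves, are
  coordinates of the cohomology; \<open>m\<close> counts the gaps.\<close>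

lemma iso_if_no_adjacent_gaps:
  assumes B: "no_adjacent_gaps a"
  shows "\<exists>m t. graded_iso R4 M (kpow m t)"
proof -
  obtain W where W: "card W = 2" "\<And>W' u. gap a W' u \<Longrightarrow> W' = W \<or> W' = - W"
  proof (cases "\<exists>W u. gap a W u")
    case True
    then obtain W u where g: "gap a W u" by blast
    then have "card W = 2" by (simp add: gap_def)
    then show ?thesis using that gap_unique[OF B g] by blast
  next
    case False
    then show ?thesis using that[of "{0, 1}"] by auto
  qed
  have gW: "gap a W u" if "gap a W' u" for W' u
    using W(2)[OF that] that gap_Compl[OF that] by auto
  define U where "U = {u. gap a W u}"
  define j0 where "j0 = int (a W) + int (a (- W)) - 2"
  have deg: "sum u UNIV = j0" if "u \<in> U" for u
    using gap_degree[OF B] that unfolding U_def j0_def by blast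
  have "U \<subseteq> (\<Pi>\<^sub>E i\<in>UNIV. {0..j0})"
  proof
    fix u assume u: "u \<in> U"
    have "u i \<le> j0" for i
      unfolding deg[OF u, symmetric] using u by (intro member_le_sum) (auto simp: U_def gap_def)
    then show "u \<in> (\<Pi>\<^sub>E i\<in>UNIV. {0..j0})" using u by (auto simp: U_def gap_def)
  qed
  then have finU: "finite U" by (rule finite_subset) (simp add: finite_PiE)
  define m where "m = card U"
  \<comment> \<open>In the twist the component of degree \<open>j\<close> is the former one of
    degree \<open>j - j0\<close>, so the copies of the residue field sit in degree
    \<open>j0\<close>.\<close>
  let ?N = "kpow m (- j0) :: ('k poly4, nat \<Rightarrow> 'k poly4 set) graded_module"
  obtain e where e: "bij_betw e {..<m} U"
    using ex_bij_betw_nat_finite[OF finU] by (auto simp: m_def atLeast0LessThan)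
  have eU: "gap a W (e l)" if "l < m" for l using e that by (auto simp: bij_betw_def U_def)
  have "W \<noteq> {}" "- W \<noteq> {}" using W(1) card_Compl_2[OF W(1)] by auto
  then obtain p q where pq: "p \<in> W" "q \<in> - W" by blast
  define S where "S = {p, q}"
  have "p \<noteq> q" using pq by auto
  then have S: "card S = 2" by (simp add: S_def)
  have cobound: "c \<in> Bd j" if c: "c \<in> carrier (Z j)" and 0: "\<And>u. gap a W u \<Longrightarrow> lc (c S) u = 0" for c j
  proof (rule coboundary_criterion[OF c])
    fix W' u assume g: "gap a W' u"
    from W(2)[OF g] show "\<exists>p\<in>W'. \<exists>q\<in>- W'. lc (c {p, q}) u = 0"
    proof
      assume "W' = W"
      then show ?thesis using 0[OF gW[OF g]] pq S_def by blast
    next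
      assume "W' = - W"
      then show ?thesis using 0[OF gW[OF g]] pq unfolding S_def by (metis double_complement insert_commute)
    qed
  qed
  have cS_deg: "lc (c S) u = 0" if c: "c \<in> carrier (Z j)" and "sum u UNIV \<noteq> j" for c j u
  proof -
    have "c S \<in> sections I j S" using c S unfolding Z_carrier cochains_def by (auto dest: spec[of _ S])
    then show ?thesis using that(2) unfolding sections_I_iff by blast
  qed
  have trivial: "K = \<one>\<^bsub>H j\<^esub>" if K: "K \<in> carrier (H j)" and j: "j \<noteq> j0" for K j
  proof -
    obtain c where c: "c \<in> carrier (Z j)" "K = cls j c" using K unfolding H_carrier by blast
    have "c \<in> Bd j" by (rule cobound[OF c(1)]) (use cS_deg[OF c(1)] deg j U_def in auto)
    then show ?thesis unfolding c H_one cls_eq_iff by simp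
  qed
  have family: "h = (\<lambda>j. if j = j0 then h j0 else \<one>\<^bsub>H j\<^esub>)" if "h \<in> carrier M" for h
    using that trivial unfolding M_carrier by (auto simp: fun_eq_iff)
  define \<phi> where "\<phi> h = (\<lambda>l\<in>{..<m}. res (ev S (e l) (h j0)))" for h
  have ev: "ev S (e l) (cls j c) = lc (c S) (e l)" if "l < m" "c \<in> carrier (Z j)" for l c j
    by (rule ev_cls[OF eU[OF that(1)] S that(2)])
  have cE: "\<exists>c\<in>carrier (Z j). h j = cls j c" if "h \<in> carrier M" for h j
    using that unfolding M_carrier H_carrier by blast
  have cL: "c S' \<in> laurent" if "c \<in> carrier (Z j)" for c S' j
    using that cochains_laurent unfolding Z_carrier by blast
  have \<phi>_in: "\<phi> h \<in> carrier ?N" for h by (auto simp: \<phi>_def kpow_carrier)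
  have inj: "inj_on \<phi> (carrier M)"
  proof (rule inj_onI)
    fix h h' assume h: "h \<in> carrier M" and h': "h' \<in> carrier M" and eq: "\<phi> h = \<phi> h'"
    obtain c where c: "c \<in> carrier (Z j0)" "h j0 = cls j0 c" using cE[OF h] by blast
    obtain c' where c': "c' \<in> carrier (Z j0)" "h' j0 = cls j0 c'" using cE[OF h'] by blast
    have d: "(\<lambda>S. c S - c' S) \<in> carrier (Z j0)"
      using c(1) c'(1) cochains_add[OF _ cochains_minus, of c j0 1 c'] cech_d_add[of c "\<lambda>S. - c' S"] cech_d_minus[of c']
      by (simp add: Z_carrier)
    have "(\<lambda>S. c S - c' S) \<in> Bd j0"
    proof (rule cobound[OF d])
      fix u assume "gap a W u"
      then obtain l where l: "l < m" "u = e l" using e by (auto simp: bij_betw_def U_def)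
      have "lc (c S) u = lc (c' S) u"
        using fun_cong[OF eq, of l] l c c' by (simp add: \<phi>_def res_inject ev)
      then show "lc (c S - c' S) u = 0" by (simp add: lc_diff cL[OF c(1)] cL[OF c'(1)])
    qed
    then have "h j0 = h' j0" by (simp add: c c' cls_eq_iff)
    then show "h = h'" using family[OF h] family[OF h'] by metis
  qed
  have surj: "\<phi> ` carrier M = carrier ?N"
  proof
    show "\<phi> ` carrier M \<subseteq> carrier ?N" using \<phi>_in by blast
    show "carrier ?N \<subseteq> \<phi> ` carrier M"
    proof
      fix v :: "nat \<Rightarrow> 'k poly4 set" assume v: "v \<in> carrier ?N"
      then have "\<forall>l. \<exists>x. l < m \<longrightarrow> v l = res x" unfolding kpow_carrier by blast
      then obtain x where x: "\<And>l. l < m \<Longrightarrow> v l = res (x l)" by metis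
      define F where "F u = (if u \<in> U then x (inv_into {..<m} e u) else 0)" for u
      have "finite {u. F u \<noteq> 0}" by (rule finite_subset[OF _ finU]) (auto simp: F_def)
      moreover have "gap a W u \<and> sum u UNIV = j0" if "F u \<noteq> 0" for u
        using that deg[of u] by (auto simp: F_def U_def split: if_splits)
      ultimately obtain c where c: "c \<in> carrier (Z j0)" "\<And>u. lc (c {p, q}) u = F u"
        using exists_cocycle[of p W q F j0] pq by blast
      have "v = \<phi> (\<lambda>j. if j = j0 then cls j0 c else \<one>\<^bsub>H j\<^esub>)"
      proof
        fix l
        show "v l = \<phi> (\<lambda>j. if j = j0 then cls j0 c else \<one>\<^bsub>H j\<^esub>) l"
        proof (cases "l < m")
          case True
          have "F (e l) = x l"
            using True e eU bij_betw_inv_into_left[OF e, of l] by (simp add: F_def U_def)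
          then show ?thesis using True x ev c by (simp add: \<phi>_def S_def)
        next
          case False
          then have "v l = undefined" using PiE_arb[OF v[unfolded kpow_carrier], of l] by simp
          then show ?thesis using False by (simp add: \<phi>_def)
        qed
      qed
      then show "v \<in> \<phi> ` carrier M" using single_class_in_M[OF c(1)] by blast
    qed
  qed
  have add: "\<phi> (h \<oplus>\<^bsub>M\<^esub> h') = \<phi> h \<oplus>\<^bsub>?N\<^esub> \<phi> h'"
    if h: "h \<in> carrier M" and h': "h' \<in> carrier M" for h h'
  proof -
    obtain c where c: "c \<in> carrier (Z j0)" "h j0 = cls j0 c" using cE[OF h] by blast
    obtain c' where c': "c' \<in> carrier (Z j0)" "h' j0 = cls j0 c'" using cE[OF h'] by blast
    have d: "(\<lambda>S. c S + c' S) \<in> carrier (Z j0)"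
      using c(1) c'(1) cochains_add by (simp add: Z_carrier cech_d_add)
    show ?thesis
      unfolding \<phi>_def kpow_add M_add
      by (rule restrict_ext)
        (simp add: c c' cls_mult[OF c(1) c'(1)] ev[OF _ d] ev[OF _ c(1)] ev[OF _ c'(1)] residue_add
          lc_add[OF cL[OF c(1)] cL[OF c'(1)]])
  qed
  have smult: "\<phi> (r \<odot>\<^bsub>M\<^esub> h) = r \<odot>\<^bsub>?N\<^esub> \<phi> h" if h: "h \<in> carrier M" for r h
  proof -
    interpret H0: comm_group "H j0" by (rule H_comm_group)
    obtain c where c: "c \<in> carrier (Z j0)" "h j0 = cls j0 c" using cE[OF h] by blast
    define r0 where "r0 = lookup r 0"
    define G where "G n = hom_act I j0 (hom_part n r) (h (j0 - int n))" for n
    \<comment> \<open>A part of \<open>r\<close> of positive degree \<open>n\<close> acts on a class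
      from degree \<open>j0 - n\<close>, where the module vanishes; only the constant term
      survives.\<close>
    have Gpos: "G n = \<one>\<^bsub>H j0\<^esub>" if "n \<noteq> 0" for n
    proof -
      have "h (j0 - int n) = \<one>\<^bsub>H (j0 - int n)\<^esub>"
        using h that by (intro trivial) (auto simp: M_carrier)
      then show ?thesis unfolding G_def using hom_act_one[OF homogeneous_hom_part] by simp
    qed
    have hom0: "homogeneous 0 (single 0 r0)" by (simp add: homogeneous_def mdeg_def)
    have d: "(\<lambda>S. Fract (single 0 r0) 1 * c S) \<in> carrier (Z j0)"
      using Z_mult[OF hom0, of c j0] c by simp
    have G0: "G 0 = cls j0 (\<lambda>S. Fract (single 0 r0) 1 * c S)"
      using hom_act_cls[OF hom0, of j0 c] by (simp add: G_def hom_part_0 c r0_def)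
    have G0_in: "G 0 \<in> carrier (H j0)" unfolding G0 H_carrier using d by blast
    let ?A = "{n. hom_part n r \<noteq> 0}"
    have rest: "finprod (H j0) G (?A - {0}) = \<one>\<^bsub>H j0\<^esub>"
      by (rule H0.finprod_one_eqI) (auto simp: Gpos)
    have "finprod (H j0) G ?A = G 0"
    proof (cases "0 \<in> ?A")
      case True
      then have "?A = insert 0 (?A - {0})" by blast
      then have "finprod (H j0) G ?A = finprod (H j0) G (insert 0 (?A - {0}))" by simp
      also have "\<dots> = G 0 \<otimes>\<^bsub>H j0\<^esub> finprod (H j0) G (?A - {0})"
        using finite_hom_part[of r] G0_in Gpos by (intro H0.finprod_insert) auto
      also have "\<dots> = G 0" unfolding rest using G0_in by simp
      finally show ?thesis .
    next
      \<comment> \<open>The index 0 is missing when the constant term of \<open>r\<close> is zero;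
        \<open>G 0\<close> is then the identity and still equals the product.\<close>
      case False
      then have "single 0 r0 = (0 :: 'k poly4)" by (simp add: hom_part_0 r0_def)
      then have "G 0 = \<one>\<^bsub>H j0\<^esub>" unfolding G0 H_one by (simp add: fract_collapse)
      moreover have "?A - {0} = ?A" using False by blast
      ultimately show ?thesis using rest by simp
    qed
    then have "(r \<odot>\<^bsub>M\<^esub> h) j0 = cls j0 (\<lambda>S. Fract (single 0 r0) 1 * c S)"
      using G0 by (simp add: M_smult G_def[abs_def])
    then show ?thesis
      unfolding \<phi>_def kpow_smult
      by (intro restrict_ext)
        (simp add: c ev[OF _ d] ev[OF _ c(1)] residue_smult lc_const_mult[OF cL[OF c(1)]] r0_def[symmetric])
  qed
  have comp: "\<phi> ` component M j = component ?N j" for j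
  proof (cases "j = j0")
    case True
    have "h i = \<one>\<^bsub>H i\<^esub>" if "h \<in> carrier M" "i \<noteq> j" for h i
      using that trivial[of "h i" i] True unfolding M_carrier by blast
    then have "component M j = carrier M" unfolding M_component by blast
    moreover have "component ?N j = carrier ?N"
      by (simp add: kpow_component kpow_carrier True)
    ultimately show ?thesis using surj by simp
  next
    case False
    let ?h0 = "\<lambda>j. \<one>\<^bsub>H j\<^esub>"
    have h0: "?h0 \<in> carrier M"
      unfolding M_carrier using H_comm_group by (auto simp: comm_group_def intro: group.is_monoid monoid.one_closed)
    have "component M j = {?h0}"
    proof
      show "component M j \<subseteq> {?h0}"
      proof
        fix h assume h: "h \<in> component M j"
        have "h i = \<one>\<^bsub>H i\<^esub>" for i
          using h trivial[of "h i" i] False unfolding M_component M_carrier by (cases "i = j") auto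
        then show "h \<in> {?h0}" by auto
      qed
      show "{?h0} \<subseteq> component M j" using h0 by (simp add: M_component)
    qed
    moreover have "\<phi> ?h0 = (\<lambda>l\<in>{..<m}. res 0)"
      unfolding \<phi>_def by (rule restrict_ext) (simp add: H_one ev[OF _ zero_in_Z])
    moreover have "component ?N j = {\<lambda>l\<in>{..<m}. res 0}"
    proof -
      have "v = (\<lambda>l\<in>{..<m}. res 0)" if "v \<in> (\<Pi>\<^sub>E i\<in>{..<m}. {res (0 :: 'k)})" for v
        using that by (auto simp: fun_eq_iff PiE_iff extensional_def)
      then show ?thesis using False by (auto simp: kpow_component)
    qed
    ultimately show ?thesis by simp
  qed
  have "graded_iso R4 M ?N"
    unfolding graded_iso_def
    by (rule exI[of _ \<phi>]) (use inj surj add smult comp in \<open>auto simp: bij_betw_def\<close>)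
  then show ?thesis by blast
qed

end

theorem corollary4p7:
  fixes a1 a2 a3 a4 a5 a6 :: nat
    and C :: "'k::field poly4 set"
  assumes "C = tetrahedral_ideal a1 a2 a3 a4 a5 a6"
  shows "arithmetically_buchsbaum C \<longleftrightarrow>
    (\<exists>(m::nat) (t::int).
       graded_iso R4 (hartshorne_rao C) (twist (direct_power m residue_module) t))"
proof -
  let ?a = "tet_exp a1 a2 a3 a4 a5 a6"
  have C: "C = tI ?a" using assms by (simp add: tetrahedral_ideal_eq)
  interpret tetrahedral ?a C by standard (rule C)
  show ?thesis
    using arithmetically_buchsbaum_iff[of ?a, where 'k = 'k] no_adjacent_gaps_if_iso iso_if_no_adjacent_gaps
    unfolding C[symmetric] by blast
qed

end
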